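(* Let $W=I_n$ be the dihedral group of order $2n$ ($n\ge2$ finite) with $S=\{1,2\}$. The $\mathbb Z[q]$-algebra $E_q(I_n)$ is isomorphic to the quotient of the path algebra $\mathcal Q_q=\mathbb Z[q]\mathcal Q$ of the Hasse quiver $\mathcal Q$ by the ideal generated by the following relations $\mathcal J_n$. (1) Quasi-idempotent relations: for $i=1,2$, (i) $\delta_{\{i\}}\upsilon_{\{i\}}=(1+q)e_{\{i\}}$; (ii) $\delta_{\{1,2\},\{i\}}\upsilon_{\{i\},\{1,2\}}=(1+q+\cdots+q^{n-1})e_{\{1,2\}}$. (2) Sandwich relations: (i) $\upsilon_{\{1\}}\upsilon_{\{1\},\{1,2\}}=\upsilon_{\{2\}}\upsilon_{\{2\},\{1,2\}}$; (ii) $\delta_{\{1,2\},\{1\}}\delta_{\{1\}}=\delta_{\{1,2\},\{2\}}\delta_{\{2\}}$. (3) Refined braid relations: for $(s,t)=(1,2)$ and $(s,t)=(2,1)$, (i) if $n$ is even, $\upsilon_{\{t\},\{1,2\}}\delta_{\{1,2\},\{s\}}=\delta_{\{t\}}\big(\sum_{j=2}^nb_j^n\chi_{[j-2]t}\big)\upsilon_{\{s\}}$, where $\chi_{[0]t}=e_\emptyset$; (ii) if $n$ is odd, $\upsilon_{\{s\},\{1,2\}}\delta_{\{1,2\},\{s\}}=\delta_{\{s\}}\big(\sum_{j=3}^nb_j^n\chi_{[j-2]t}\big)\upsilon_{\{s\}}+(-q)^{\frac{n-1}2}e_{\{s\}}$.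
   Context: The Hecke algebra $H_q=H_q(I_n)$ is the $\mathbb Z[q]$-algebra with basis $T_w$ ($w\in I_n$), generated by $T_1,T_2$ with $T_i^2=(q-1)T_i+q$ and the braid relation $T_1T_2T_1\cdots=T_2T_1T_2\cdots$ ($n$ factors each). $\Lambda$ is the set of all subsets of $S=\{1,2\}$, $x_I=\sum_{w\in W_I}T_w$ for $I\in\Lambda$ (with $W_I=\langle I\rangle$), and $E_q(I_n)=\mathrm{End}_{H_q}(\bigoplus_{I\in\Lambda}x_IH_q)$ (right modules). The Hasse quiver $\mathcal Q$ has vertices $\emptyset,\{1\},\{2\},\{1,2\}$ with trivial paths $e_K$, and arrows, for $i=1,2$: $\delta_{\{i\}}$ from $\emptyset$ to $\{i\}$, $\upsilon_{\{i\}}$ from $\{i\}$ to $\emptyset$, $\delta_{\{1,2\},\{i\}}$ from $\{i\}$ to $\{1,2\}$, $\upsilon_{\{i\},\{1,2\}}$ from $\{1,2\}$ to $\{i\}$. In the path algebra, $\alpha\beta$ is concatenation if the starting vertex of $\alpha$ is the ending vertex of $\beta$ and $0$ otherwise. $\chi_i=\upsilon_{\{i\}}\delta_{\{i\}}$; for $m\ge1$, $\chi_{[m]t}=\cdots\chi_t\chi_s\chi_t$ is the alternating product of $m$ factors in $\chi_s,\chi_t$ ($\{s,t\}=\{1,2\}$) ending on the right with $\chi_t$. For $1\le j\le n$, $b^n_j=\binom{j+k-1}{j-1}(-q)^k$ if $k=\frac{n-j}2$ is an integer, and $b_j^n=0$ otherwise. *)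

theory Defs
  imports
    "HOL-Library.Poly_Mapping"
    "HOL-Computational_Algebra.Polynomial"
    "Graph_Theory.Arc_Walk"
    "HOL-Algebra.Generated_Groups"
    "HOL-Algebra.QuotRing"
    "HOL-Algebra.Module"
begin

section \<open>Associative algebras given by generators and relations\<close>

text \<open>
  A not necessarily commutative algebra over a coefficient type is an HOL-Algebra record of type
  \<^typ>\<open>('r, 'a) module\<close>, which carries both a ring structure and scalar multiplication. (The locale \<^locale>\<open>algebra\<close> is
  restricted to commutative algebras.)
\<close>

definition algebra_iso :: "('r, 'a) module \<Rightarrow> ('r, 'b) module \<Rightarrow> ('a \<Rightarrow> 'b) set" where
  "algebra_iso A B =
    {h \<in> ring_iso A B. \<forall>c. \<forall>x\<in>carrier A. h (c \<odot>\<^bsub>A\<^esub> x) = c \<odot>\<^bsub>B\<^esub> h x}"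

definition algebra_isomorphic :: "('r, 'a) module \<Rightarrow> ('r, 'b) module \<Rightarrow> bool" where
  "algebra_isomorphic A B \<longleftrightarrow> algebra_iso A B \<noteq> {}"

text \<open>
  The quotient ring \<open>A Quot I\<close> with the induced scalar multiplication: \<open>c\<close> times the coset
  \<open>I + x\<close> is \<open>I + c x\<close>. (The union is over a single coset, since an ideal of an algebra is
  closed under scalars.)
\<close>

definition quotient_algebra :: "('r, 'a) module \<Rightarrow> 'a set \<Rightarrow> ('r, 'a set) module" where
  "quotient_algebra A I = ring.extend (A Quot I)
     (module.fields (\<lambda>c X. \<Union>x\<in>X. I +>\<^bsub>A\<^esub> (c \<odot>\<^bsub>A\<^esub> x)))"

text \<open>A relation \<open>l = r\<close> is encoded as the pair \<open>(l, r)\<close>.\<close>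

definition relation_ideal :: "('r, 'a) module \<Rightarrow> ('a \<times> 'a) set \<Rightarrow> 'a set" where
  "relation_ideal A R = Idl\<^bsub>A\<^esub> {l \<ominus>\<^bsub>A\<^esub> r | l r. (l, r) \<in> R}"

section \<open>Path algebras of quivers\<close>

text \<open>
  A quiver is a \<^typ>\<open>('v, 'e) pre_digraph\<close>. A path is a triple (start, arrows, end), where the
  arrows are listed in the order in which they are traversed. The product \<open>\<alpha> \<beta>\<close> of two paths
  means \<open>\<beta>\<close> followed by \<open>\<alpha>\<close> if \<open>\<alpha>\<close> starts where \<open>\<beta>\<close> ends, and is \<open>0\<close> otherwise.
\<close>

type_synonym ('v, 'e) path = "'v \<times> 'e list \<times> 'v"

definition paths :: "('v, 'e) pre_digraph \<Rightarrow> ('v, 'e) path set" where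
  "paths Q = {(u, p, v). pre_digraph.awalk Q u p v}"

definition path_term ::
    "('v, 'e) path \<Rightarrow> ('v, 'e) path \<Rightarrow> 'r \<Rightarrow> (('v, 'e) path \<Rightarrow>\<^sub>0 'r::comm_ring_1)" where
  "path_term = (\<lambda>(u, p, v) (u', p', v') c.
     if u = v' then Poly_Mapping.single (u', p' @ p, v) c else 0)"

definition path_algebra ::
    "('v, 'e) pre_digraph \<Rightarrow> ('r::comm_ring_1, ('v, 'e) path \<Rightarrow>\<^sub>0 'r) module" where
  "path_algebra Q =
    \<lparr>carrier = {f. Poly_Mapping.keys f \<subseteq> paths Q},
     mult = (\<lambda>f g. \<Sum>\<alpha>\<in>Poly_Mapping.keys f. \<Sum>\<beta>\<in>Poly_Mapping.keys g.
        path_term \<alpha> \<beta> (Poly_Mapping.lookup f \<alpha> * Poly_Mapping.lookup g \<beta>)),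
     one = (\<Sum>v\<in>verts Q. Poly_Mapping.single (v, [], v) 1),
     zero = 0,
     add = (+),
     smult = (\<lambda>c. Poly_Mapping.map ((*) c))\<rparr>"

definition arrow_elt :: "('v, 'e) pre_digraph \<Rightarrow> 'e \<Rightarrow> (('v, 'e) path \<Rightarrow>\<^sub>0 'r::comm_ring_1)" where
  "arrow_elt Q a = Poly_Mapping.single (tail Q a, [a], head Q a) 1"

definition trivial_path :: "'v \<Rightarrow> (('v, 'e) path \<Rightarrow>\<^sub>0 'r::comm_ring_1)" where
  "trivial_path v = Poly_Mapping.single (v, [], v) 1"

lemma path_term_zero [simp]: "path_term \<alpha> \<beta> 0 = 0"
  by (auto simp: path_term_def split: prod.splits)

lemma path_term_add: "path_term \<alpha> \<beta> (c + d) = path_term \<alpha> \<beta> c + path_term \<alpha> \<beta> d"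
  by (auto simp: path_term_def single_add split: prod.splits)

lemma path_algebra_mult_superset:
  fixes f g :: "('v, 'e) path \<Rightarrow>\<^sub>0 'r::comm_ring_1"
  assumes "finite A" "finite B" "Poly_Mapping.keys f \<subseteq> A" "Poly_Mapping.keys g \<subseteq> B"
  shows "f \<otimes>\<^bsub>path_algebra Q\<^esub> g = (\<Sum>\<alpha>\<in>A. \<Sum>\<beta>\<in>B.
    path_term \<alpha> \<beta> (Poly_Mapping.lookup f \<alpha> * Poly_Mapping.lookup g \<beta>))"
proof -
  have "(\<Sum>\<beta>\<in>Poly_Mapping.keys g. path_term \<alpha> \<beta> (c * Poly_Mapping.lookup g \<beta>)) =
        (\<Sum>\<beta>\<in>B. path_term \<alpha> \<beta> (c * Poly_Mapping.lookup g \<beta>))" for \<alpha> c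
    using assms by (intro sum.mono_neutral_left) (auto simp: in_keys_iff)
  then show ?thesis
    unfolding path_algebra_def using assms
    by (simp, intro sum.mono_neutral_left) (auto simp: in_keys_iff)
qed

lemma path_algebra_mult_add_left:
  "(f + g) \<otimes>\<^bsub>path_algebra Q\<^esub> h = f \<otimes>\<^bsub>path_algebra Q\<^esub> h + g \<otimes>\<^bsub>path_algebra Q\<^esub> h"
proof -
  let ?A = "Poly_Mapping.keys f \<union> Poly_Mapping.keys g" and ?B = "Poly_Mapping.keys h"
  have "Poly_Mapping.keys (f + g) \<subseteq> ?A" by (rule keys_add)
  then show ?thesis
    by (simp add: path_algebra_mult_superset[of ?A ?B] lookup_add ring_distribs path_term_add
      sum.distrib)
qed

lemma path_algebra_mult_add_right:
  "h \<otimes>\<^bsub>path_algebra Q\<^esub> (f + g) = h \<otimes>\<^bsub>path_algebra Q\<^esub> f + h \<otimes>\<^bsub>path_algebra Q\<^esub> g"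
proof -
  let ?A = "Poly_Mapping.keys f \<union> Poly_Mapping.keys g" and ?B = "Poly_Mapping.keys h"
  have "Poly_Mapping.keys (f + g) \<subseteq> ?A" by (rule keys_add)
  then show ?thesis
    by (simp add: path_algebra_mult_superset[of ?B ?A] lookup_add ring_distribs path_term_add
      sum.distrib)
qed

lemma path_algebra_mult_zero [simp]:
  "0 \<otimes>\<^bsub>path_algebra Q\<^esub> h = 0" "h \<otimes>\<^bsub>path_algebra Q\<^esub> 0 = 0"
  by (simp_all add: path_algebra_def)

lemma path_algebra_mult_sum_left:
  "(\<Sum>i\<in>I. f i) \<otimes>\<^bsub>path_algebra Q\<^esub> h = (\<Sum>i\<in>I. f i \<otimes>\<^bsub>path_algebra Q\<^esub> h)"
  by (induction I rule: infinite_finite_induct) (simp_all add: path_algebra_mult_add_left)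

lemma path_algebra_mult_sum_right:
  "h \<otimes>\<^bsub>path_algebra Q\<^esub> (\<Sum>i\<in>I. f i) = (\<Sum>i\<in>I. h \<otimes>\<^bsub>path_algebra Q\<^esub> f i)"
  by (induction I rule: infinite_finite_induct) (simp_all add: path_algebra_mult_add_right)

lemma path_algebra_mult_single:
  "Poly_Mapping.single \<alpha> c \<otimes>\<^bsub>path_algebra Q\<^esub> Poly_Mapping.single \<beta> d = path_term \<alpha> \<beta> (c * d)"
  by (subst path_algebra_mult_superset[of "{\<alpha>}" "{\<beta>}"]) auto

lemma poly_mapping_sum_single:
  fixes f :: "'k \<Rightarrow>\<^sub>0 'r::comm_monoid_add"
  shows "f = (\<Sum>k\<in>Poly_Mapping.keys f. Poly_Mapping.single k (Poly_Mapping.lookup f k))"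
  by (rule poly_mapping_eqI)
     (auto simp: lookup_sum lookup_single when_def in_keys_iff sum.delta' cong: if_cong)

lemma path_algebra_mult_assoc:
  "(f \<otimes>\<^bsub>path_algebra Q\<^esub> g) \<otimes>\<^bsub>path_algebra Q\<^esub> h =
   f \<otimes>\<^bsub>path_algebra Q\<^esub> (g \<otimes>\<^bsub>path_algebra Q\<^esub> h)"
proof -
  have single: "(Poly_Mapping.single \<alpha> c \<otimes>\<^bsub>path_algebra Q\<^esub> Poly_Mapping.single \<beta> d)
        \<otimes>\<^bsub>path_algebra Q\<^esub> Poly_Mapping.single \<gamma> k =
      Poly_Mapping.single \<alpha> c \<otimes>\<^bsub>path_algebra Q\<^esub>
        (Poly_Mapping.single \<beta> d \<otimes>\<^bsub>path_algebra Q\<^esub> Poly_Mapping.single \<gamma> k)"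
    for \<alpha> \<beta> \<gamma> :: "('a, 'b) path" and c d k :: 'c
    by (cases \<alpha>; cases \<beta>; cases \<gamma>)
       (auto simp: path_algebra_mult_single path_term_def mult.assoc)
  show ?thesis
    apply (subst (1 2) poly_mapping_sum_single[of f])
    apply (subst (1 2) poly_mapping_sum_single[of g])
    apply (subst (1 2) poly_mapping_sum_single[of h])
    apply (simp only: path_algebra_mult_sum_left path_algebra_mult_sum_right single)
    done
qed

lemma path_term_keys:
  assumes "\<alpha> \<in> paths Q" "\<beta> \<in> paths Q"
  shows "Poly_Mapping.keys (path_term \<alpha> \<beta> c) \<subseteq> paths Q"
proof -
  have "pre_digraph.cas Q u p v \<Longrightarrow> pre_digraph.cas Q v p' w \<Longrightarrow> pre_digraph.cas Q u (p @ p') w"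
    for u p v p' w
    by (induction p arbitrary: u) (auto simp: pre_digraph.cas.simps)
  then show ?thesis
    using assms
    by (auto simp: path_term_def paths_def pre_digraph.awalk_def split: prod.splits if_splits)
qed

lemma path_algebra_carrier_iff:
  "f \<in> carrier (path_algebra Q) \<longleftrightarrow> Poly_Mapping.keys f \<subseteq> paths Q"
  by (simp add: path_algebra_def)

lemma path_algebra_sum_carrier:
  assumes "\<And>i. i \<in> I \<Longrightarrow> f i \<in> carrier (path_algebra Q)"
  shows "(\<Sum>i\<in>I. f i) \<in> carrier (path_algebra Q)"
  using assms
proof (induction I rule: infinite_finite_induct)
  case (insert i I)
  then show ?case
    using keys_add[of "f i" "sum f I"] by (auto simp: path_algebra_carrier_iff)
qed (auto simp: path_algebra_carrier_iff)

lemma path_algebra_mult_closed: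
  assumes "f \<in> carrier (path_algebra Q)" "g \<in> carrier (path_algebra Q)"
  shows "f \<otimes>\<^bsub>path_algebra Q\<^esub> g \<in> carrier (path_algebra Q)"
proof -
  have "f \<otimes>\<^bsub>path_algebra Q\<^esub> g = (\<Sum>\<alpha>\<in>Poly_Mapping.keys f. \<Sum>\<beta>\<in>Poly_Mapping.keys g.
      path_term \<alpha> \<beta> (Poly_Mapping.lookup f \<alpha> * Poly_Mapping.lookup g \<beta>))"
    by (simp add: path_algebra_def)
  also have "\<dots> \<in> carrier (path_algebra Q)"
  proof (intro path_algebra_sum_carrier)
    fix \<alpha> \<beta> assume "\<alpha> \<in> Poly_Mapping.keys f" "\<beta> \<in> Poly_Mapping.keys g"
    then have "\<alpha> \<in> paths Q" "\<beta> \<in> paths Q"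
      using assms unfolding path_algebra_carrier_iff by blast+
    then show "path_term \<alpha> \<beta> (Poly_Mapping.lookup f \<alpha> * Poly_Mapping.lookup g \<beta>)
        \<in> carrier (path_algebra Q)"
      unfolding path_algebra_carrier_iff by (rule path_term_keys)
  qed
  finally show ?thesis .
qed

lemma path_algebra_one:
  fixes f :: "('v, 'e) path \<Rightarrow>\<^sub>0 'r::comm_ring_1"
  assumes fin: "finite (verts Q)" and f: "f \<in> carrier (path_algebra Q)"
    and wf: "wf_digraph Q"
  shows "\<one>\<^bsub>path_algebra Q\<^esub> \<otimes>\<^bsub>path_algebra Q\<^esub> f = f"
    and "f \<otimes>\<^bsub>path_algebra Q\<^esub> \<one>\<^bsub>path_algebra Q\<^esub> = f"
proof -
  interpret wf_digraph Q by (rule wf)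
  have ends: "u \<in> verts Q \<and> v \<in> verts Q" if "(u, p, v) \<in> Poly_Mapping.keys f" for u p v
    using that f by (auto simp: path_algebra_carrier_iff paths_def)
  have one: "\<one>\<^bsub>path_algebra Q\<^esub> =
      (\<Sum>v\<in>verts Q. Poly_Mapping.single (v, [], v) 1 :: ('v, 'e) path \<Rightarrow>\<^sub>0 'r)"
    by (simp add: path_algebra_def)
  have L: "\<one>\<^bsub>path_algebra Q\<^esub> \<otimes>\<^bsub>path_algebra Q\<^esub> Poly_Mapping.single \<alpha> c = Poly_Mapping.single \<alpha> c"
    and R: "Poly_Mapping.single \<alpha> c \<otimes>\<^bsub>path_algebra Q\<^esub> \<one>\<^bsub>path_algebra Q\<^esub> = Poly_Mapping.single \<alpha> c"
    if "\<alpha> \<in> Poly_Mapping.keys f" for \<alpha> and c :: 'r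
    using ends[of "fst \<alpha>" "fst (snd \<alpha>)" "snd (snd \<alpha>)"] that fin
    by (auto simp: one path_algebra_mult_sum_left path_algebra_mult_sum_right
      path_algebra_mult_single path_term_def case_prod_unfold sum.delta sum.delta')
  let ?f = "\<Sum>k\<in>Poly_Mapping.keys f. Poly_Mapping.single k (Poly_Mapping.lookup f k)"
  have "\<one>\<^bsub>path_algebra Q\<^esub> \<otimes>\<^bsub>path_algebra Q\<^esub> ?f = ?f"
    by (simp only: path_algebra_mult_sum_right L cong: sum.cong)
  then show "\<one>\<^bsub>path_algebra Q\<^esub> \<otimes>\<^bsub>path_algebra Q\<^esub> f = f"
    by (simp only: poly_mapping_sum_single[of f, symmetric])
  have "?f \<otimes>\<^bsub>path_algebra Q\<^esub> \<one>\<^bsub>path_algebra Q\<^esub> = ?f"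
    by (simp only: path_algebra_mult_sum_left R cong: sum.cong)
  then show "f \<otimes>\<^bsub>path_algebra Q\<^esub> \<one>\<^bsub>path_algebra Q\<^esub> = f"
    by (simp only: poly_mapping_sum_single[of f, symmetric])
qed

lemma path_algebra_ring:
  fixes Q :: "('v, 'e) pre_digraph"
  assumes fin: "finite (verts Q)" and wf: "wf_digraph Q"
  shows "ring (path_algebra Q :: ('r::comm_ring_1, ('v, 'e) path \<Rightarrow>\<^sub>0 'r) module)" (is "ring ?A")
proof (rule ringI)
  have ops [simp]: "x \<oplus>\<^bsub>?A\<^esub> y = x + y" "\<zero>\<^bsub>?A\<^esub> = 0" for x y :: "('v, 'e) path \<Rightarrow>\<^sub>0 'r"
    by (simp_all add: path_algebra_def)
  have plus: "x + y \<in> carrier ?A" if "x \<in> carrier ?A" "y \<in> carrier ?A" for x y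
    using that keys_add[of x y] by (auto simp: path_algebra_carrier_iff)
  show "abelian_group ?A"
  proof (rule abelian_groupI)
    fix x assume "x \<in> carrier ?A"
    then show "\<exists>y\<in>carrier ?A. y \<oplus>\<^bsub>?A\<^esub> x = \<zero>\<^bsub>?A\<^esub>"
      by (intro bexI[of _ "- x"]) (auto simp: path_algebra_carrier_iff)
  qed (simp_all add: plus add_ac, simp add: path_algebra_carrier_iff)
  have one: "\<one>\<^bsub>?A\<^esub> \<in> carrier ?A"
  proof -
    have "(\<Sum>v\<in>verts Q. Poly_Mapping.single (v, [], v) 1) \<in> carrier ?A"
      by (intro path_algebra_sum_carrier)
         (auto simp: path_algebra_carrier_iff paths_def pre_digraph.awalk_def pre_digraph.cas.simps)
    then show ?thesis by (simp add: path_algebra_def)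
  qed
  show "Group.monoid ?A"
    by (rule monoidI)
       (simp_all add: one path_algebra_mult_closed path_algebra_mult_assoc path_algebra_one fin wf)
  fix f g h :: "('v, 'e) path \<Rightarrow>\<^sub>0 'r"
  show "(f \<oplus>\<^bsub>?A\<^esub> g) \<otimes>\<^bsub>?A\<^esub> h = f \<otimes>\<^bsub>?A\<^esub> h \<oplus>\<^bsub>?A\<^esub> g \<otimes>\<^bsub>?A\<^esub> h"
    unfolding ops by (rule path_algebra_mult_add_left)
  show "h \<otimes>\<^bsub>?A\<^esub> (f \<oplus>\<^bsub>?A\<^esub> g) = h \<otimes>\<^bsub>?A\<^esub> f \<oplus>\<^bsub>?A\<^esub> h \<otimes>\<^bsub>?A\<^esub> g"
    unfolding ops by (rule path_algebra_mult_add_right)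
qed

lemma path_algebra_smult_closed:
  "f \<in> carrier (path_algebra Q) \<Longrightarrow> c \<odot>\<^bsub>path_algebra Q\<^esub> f \<in> carrier (path_algebra Q)"
  by (auto simp: path_algebra_def in_keys_iff map.rep_eq when_def subset_iff)

lemma arrow_elt_closed:
  assumes "wf_digraph Q" "a \<in> arcs Q"
  shows "arrow_elt Q a \<in> carrier (path_algebra Q)"
  using assms
  by (auto simp: arrow_elt_def path_algebra_carrier_iff paths_def pre_digraph.awalk_def
    pre_digraph.cas.simps wf_digraph.tail_in_verts)

lemma trivial_path_closed:
  "v \<in> verts Q \<Longrightarrow> trivial_path v \<in> carrier (path_algebra Q)"
  by (auto simp: trivial_path_def path_algebra_carrier_iff paths_def pre_digraph.awalk_def
    pre_digraph.cas.simps)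

section \<open>Dihedral groups\<close>

text \<open>
  The dihedral group \<open>I\<^sub>n\<close> of order \<open>2 n\<close>: the pair \<open>(k, e)\<close> stands for the map
  \<open>z \<mapsto> k + z\<close> (\<open>e = False\<close>) or \<open>z \<mapsto> k - z\<close> (\<open>e = True\<close>) on the integers modulo \<open>n\<close>.
\<close>

definition dihedral :: "nat \<Rightarrow> (int \<times> bool) monoid" where
  "dihedral n =
    \<lparr>carrier = {0..<int n} \<times> UNIV,
     mult = (\<lambda>(k, e) (l, f). ((k + (if e then - l else l)) mod int n, e \<noteq> f)),
     one = (0, False)\<rparr>"

lemma dihedral_group:
  assumes "n \<ge> 1"
  shows "group (dihedral n)" "order (dihedral n) = 2 * n"
proof -
  show "group (dihedral n)"
  proof (rule groupI)
    fix a assume a: "a \<in> carrier (dihedral n)"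
    obtain k f where kf: "a = (k, f)" by (cases a)
    show "\<exists>b\<in>carrier (dihedral n). b \<otimes>\<^bsub>dihedral n\<^esub> a = \<one>\<^bsub>dihedral n\<^esub>"
      using assms a kf
      by (intro bexI[of _ "if f then a else ((- k) mod int n, False)"])
         (auto simp: dihedral_def mod_simps)
  next
    fix a b c :: "int \<times> bool"
    show "a \<otimes>\<^bsub>dihedral n\<^esub> b \<otimes>\<^bsub>dihedral n\<^esub> c = a \<otimes>\<^bsub>dihedral n\<^esub> (b \<otimes>\<^bsub>dihedral n\<^esub> c)"
      by (cases a; cases b; cases c) (auto simp: dihedral_def mod_simps algebra_simps)
  qed (use assms in \<open>auto simp: dihedral_def\<close>)
  show "order (dihedral n) = 2 * n"
    by (simp add: order_def dihedral_def)
qed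

text \<open>The Coxeter generators, indexed by \<open>{1, 2}\<close>; their product has order \<open>n\<close>.\<close>

definition simple_refl :: "nat \<Rightarrow> int \<times> bool" where
  "simple_refl i = (if i = 1 then 0 else 1, True)"

definition word_prod :: "nat \<Rightarrow> nat list \<Rightarrow> int \<times> bool" where
  "word_prod n is = foldr (\<lambda>i w. simple_refl i \<otimes>\<^bsub>dihedral n\<^esub> w) is \<one>\<^bsub>dihedral n\<^esub>"

definition reduced_word :: "nat \<Rightarrow> nat list \<Rightarrow> int \<times> bool \<Rightarrow> bool" where
  "reduced_word n is w \<longleftrightarrow> is \<in> lists {1, 2} \<and> word_prod n is = w \<and>
     (\<forall>js\<in>lists {1, 2}. word_prod n js = w \<longrightarrow> length is \<le> length js)"

definition parabolic :: "nat \<Rightarrow> nat set \<Rightarrow> (int \<times> bool) set" where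
  "parabolic n I = generate (dihedral n) (simple_refl ` I)"

section \<open>The Hecke algebra\<close>

text \<open>The polynomial ring over the integers in \<open>\<q>\<close> is \<^typ>\<open>int poly\<close>.\<close>

definition \<q> :: "int poly" where "\<q> = [:0, 1:]"

text \<open>
  The free algebra on two generators is the path algebra of the quiver with one vertex and
  two loops.
\<close>

definition loop_quiver :: "(unit, nat) pre_digraph" where
  "loop_quiver = \<lparr>verts = UNIV, arcs = {1, 2}, tail = (\<lambda>_. ()), head = (\<lambda>_. ())\<rparr>"

type_synonym free_elt = "(unit, nat) path \<Rightarrow>\<^sub>0 int poly"

abbreviation free_alg :: "(int poly, free_elt) module" where
  "free_alg \<equiv> path_algebra loop_quiver"

abbreviation X\<^sub>F :: "nat \<Rightarrow> free_elt" where
  "X\<^sub>F \<equiv> arrow_elt loop_quiver"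

text \<open>\<open>alt_prod i j n\<close> is the product \<open>X\<^sub>i X\<^sub>j X\<^sub>i \<cdots>\<close> with \<open>n\<close> factors.\<close>

fun alt_prod :: "nat \<Rightarrow> nat \<Rightarrow> nat \<Rightarrow> free_elt" where
  "alt_prod i j 0 = \<one>\<^bsub>free_alg\<^esub>"
| "alt_prod i j (Suc m) = X\<^sub>F i \<otimes>\<^bsub>free_alg\<^esub> alt_prod j i m"

definition hecke_relations :: "nat \<Rightarrow> (free_elt \<times> free_elt) set" where
  "hecke_relations n =
     {(X\<^sub>F i \<otimes>\<^bsub>free_alg\<^esub> X\<^sub>F i,
       ((\<q> - 1) \<odot>\<^bsub>free_alg\<^esub> X\<^sub>F i) \<oplus>\<^bsub>free_alg\<^esub> (\<q> \<odot>\<^bsub>free_alg\<^esub> \<one>\<^bsub>free_alg\<^esub>)) | i. i \<in> {1, 2}}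
     \<union> {(alt_prod 1 2 n, alt_prod 2 1 n)}"

lemma free_alg_ring: "ring free_alg"
  by (rule path_algebra_ring) (auto simp: loop_quiver_def wf_digraph_def)

lemma hecke_relations_closed:
  "hecke_relations n \<subseteq> carrier free_alg \<times> carrier free_alg"
proof -
  interpret F: ring free_alg by (rule free_alg_ring)
  have X: "X\<^sub>F i \<in> carrier free_alg" if "i \<in> {1, 2}" for i
    using that by (intro arrow_elt_closed) (auto simp: loop_quiver_def wf_digraph_def)
  have alt: "alt_prod i j m \<in> carrier free_alg" if "i \<in> {1, 2}" "j \<in> {1, 2}" for i j m
    using that
  proof (induction m arbitrary: i j)
    case (Suc m)
    show ?case
      unfolding alt_prod.simps using Suc by (intro F.m_closed X) auto
  qed simp
  show ?thesis
    unfolding hecke_relations_def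
    using X alt by (auto intro!: F.m_closed F.a_closed path_algebra_smult_closed)
qed

definition hecke :: "nat \<Rightarrow> (int poly, free_elt set) module" where
  "hecke n = quotient_algebra free_alg (relation_ideal free_alg (hecke_relations n))"

definition T_gen :: "nat \<Rightarrow> nat \<Rightarrow> free_elt set" where
  "T_gen n i = relation_ideal free_alg (hecke_relations n) +>\<^bsub>free_alg\<^esub> X\<^sub>F i"

text \<open>
  The standard basis element \<open>T\<^sub>w\<close> is the product of the generators along a reduced expression
  of \<open>w\<close>; by the braid relation it does not depend on the chosen reduced expression.
\<close>

definition T\<^sub>H :: "nat \<Rightarrow> int \<times> bool \<Rightarrow> free_elt set" where
  "T\<^sub>H n w = foldr (\<lambda>i h. T_gen n i \<otimes>\<^bsub>hecke n\<^esub> h) (SOME is. reduced_word n is w) \<one>\<^bsub>hecke n\<^esub>"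

definition x\<^sub>H :: "nat \<Rightarrow> nat set \<Rightarrow> free_elt set" where
  "x\<^sub>H n I = (\<Oplus>\<^bsub>hecke n\<^esub>w\<in>parabolic n I. T\<^sub>H n w)"

section \<open>The Hecke endomorphism algebra\<close>

text \<open>
  The endomorphism algebra of the direct sum of a finite family of right ideals \<open>M i\<close>
  (\<open>i \<in> L\<close>) of the algebra \<open>H\<close>, regarded as right \<open>H\<close>-modules. Elements of the direct sum are
  extensional functions on \<open>L\<close>, endomorphisms are extensional functions on the direct sum.
\<close>

definition dsum :: "'i set \<Rightarrow> ('i \<Rightarrow> 'h set) \<Rightarrow> ('i \<Rightarrow> 'h) set" where
  "dsum L M = (\<Pi>\<^sub>E i\<in>L. M i)"

definition dsum_end ::
    "('r, 'h) module \<Rightarrow> 'i set \<Rightarrow> ('i \<Rightarrow> 'h set) \<Rightarrow> ('r, ('i \<Rightarrow> 'h) \<Rightarrow> ('i \<Rightarrow> 'h)) module" where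
  "dsum_end H L M =
    \<lparr>carrier = {\<phi> \<in> dsum L M \<rightarrow>\<^sub>E dsum L M.
        (\<forall>u\<in>dsum L M. \<forall>v\<in>dsum L M.
           \<phi> (\<lambda>i\<in>L. u i \<oplus>\<^bsub>H\<^esub> v i) = (\<lambda>i\<in>L. \<phi> u i \<oplus>\<^bsub>H\<^esub> \<phi> v i)) \<and>
        (\<forall>u\<in>dsum L M. \<forall>h\<in>carrier H.
           \<phi> (\<lambda>i\<in>L. u i \<otimes>\<^bsub>H\<^esub> h) = (\<lambda>i\<in>L. \<phi> u i \<otimes>\<^bsub>H\<^esub> h))},
     mult = compose (dsum L M),
     one = (\<lambda>u\<in>dsum L M. u),
     zero = (\<lambda>u\<in>dsum L M. \<lambda>i\<in>L. \<zero>\<^bsub>H\<^esub>),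
     add = (\<lambda>\<phi> \<psi>. \<lambda>u\<in>dsum L M. \<lambda>i\<in>L. \<phi> u i \<oplus>\<^bsub>H\<^esub> \<psi> u i),
     smult = (\<lambda>c \<phi>. \<lambda>u\<in>dsum L M. \<lambda>i\<in>L. c \<odot>\<^bsub>H\<^esub> \<phi> u i)\<rparr>"

definition hecke_endo ::
    "nat \<Rightarrow> (int poly, (nat set \<Rightarrow> free_elt set) \<Rightarrow> (nat set \<Rightarrow> free_elt set)) module" where
  "hecke_endo n =
     dsum_end (hecke n) (Pow {1, 2}) (\<lambda>I. {x\<^sub>H n I \<otimes>\<^bsub>hecke n\<^esub> h | h. h \<in> carrier (hecke n)})"

section \<open>The Hasse quiver and its relations\<close>

text \<open>\<open>Delta K J\<close> and \<open>Upsilon K J\<close> both run from \<open>J\<close> to \<open>K\<close>, up and down respectively.\<close>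

datatype arrow = Delta "nat set" "nat set" | Upsilon "nat set" "nat set"

fun arrow_tail :: "arrow \<Rightarrow> nat set" where
  "arrow_tail (Delta K J) = J"
| "arrow_tail (Upsilon K J) = J"

fun arrow_head :: "arrow \<Rightarrow> nat set" where
  "arrow_head (Delta K J) = K"
| "arrow_head (Upsilon K J) = K"

definition hasse_quiver :: "(nat set, arrow) pre_digraph" where
  "hasse_quiver =
    \<lparr>verts = {{}, {1}, {2}, {1, 2}},
     arcs = (\<Union>i\<in>{1, 2}. {Delta {i} {}, Upsilon {} {i}, Delta {1, 2} {i}, Upsilon {i} {1, 2}}),
     tail = arrow_tail,
     head = arrow_head\<rparr>"

type_synonym hasse_elt = "(nat set, arrow) path \<Rightarrow>\<^sub>0 int poly"

abbreviation Qq :: "(int poly, hasse_elt) module" where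
  "Qq \<equiv> path_algebra hasse_quiver"

abbreviation \<delta>\<^sub>Q :: "nat set \<Rightarrow> nat set \<Rightarrow> hasse_elt" where
  "\<delta>\<^sub>Q K J \<equiv> arrow_elt hasse_quiver (Delta K J)"

abbreviation \<upsilon>\<^sub>Q :: "nat set \<Rightarrow> nat set \<Rightarrow> hasse_elt" where
  "\<upsilon>\<^sub>Q K J \<equiv> arrow_elt hasse_quiver (Upsilon K J)"

abbreviation e\<^sub>Q :: "nat set \<Rightarrow> hasse_elt" where
  "e\<^sub>Q \<equiv> trivial_path"

definition \<chi>\<^sub>Q :: "nat \<Rightarrow> hasse_elt" where
  "\<chi>\<^sub>Q i = \<upsilon>\<^sub>Q {} {i} \<otimes>\<^bsub>Qq\<^esub> \<delta>\<^sub>Q {i} {}"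

text \<open>
  For \<open>{s, t} = {1, 2}\<close>, \<open>\<chi>\<^sub>Q_alt s t m\<close> is the product \<open>\<cdots> \<chi>\<^sub>t \<chi>\<^sub>s \<chi>\<^sub>t\<close> with \<open>m\<close> factors; the
  empty product is the trivial path at the empty set, not the identity of the algebra.
\<close>

fun \<chi>\<^sub>Q_alt :: "nat \<Rightarrow> nat \<Rightarrow> nat \<Rightarrow> hasse_elt" where
  "\<chi>\<^sub>Q_alt s t 0 = e\<^sub>Q {}"
| "\<chi>\<^sub>Q_alt s t (Suc m) = \<chi>\<^sub>Q_alt t s m \<otimes>\<^bsub>Qq\<^esub> \<chi>\<^sub>Q t"

definition b_coeff :: "nat \<Rightarrow> nat \<Rightarrow> int poly" where
  "b_coeff n j =
    (if even (n - j) then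
       let k = (n - j) div 2 in of_nat ((j + k - 1) choose (j - 1)) * (- \<q>) ^ k
     else 0)"

definition quasi_idempotent_relations :: "nat \<Rightarrow> (hasse_elt \<times> hasse_elt) set" where
  "quasi_idempotent_relations n =
     {(\<delta>\<^sub>Q {i} {} \<otimes>\<^bsub>Qq\<^esub> \<upsilon>\<^sub>Q {} {i}, (1 + \<q>) \<odot>\<^bsub>Qq\<^esub> e\<^sub>Q {i}) | i. i \<in> {1, 2}}
     \<union> {(\<delta>\<^sub>Q {1, 2} {i} \<otimes>\<^bsub>Qq\<^esub> \<upsilon>\<^sub>Q {i} {1, 2}, (\<Sum>k<n. \<q> ^ k) \<odot>\<^bsub>Qq\<^esub> e\<^sub>Q {1, 2}) | i. i \<in> {1, 2}}"

definition sandwich_relations :: "(hasse_elt \<times> hasse_elt) set" where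
  "sandwich_relations =
     {(\<upsilon>\<^sub>Q {} {1} \<otimes>\<^bsub>Qq\<^esub> \<upsilon>\<^sub>Q {1} {1, 2}, \<upsilon>\<^sub>Q {} {2} \<otimes>\<^bsub>Qq\<^esub> \<upsilon>\<^sub>Q {2} {1, 2}),
      (\<delta>\<^sub>Q {1, 2} {1} \<otimes>\<^bsub>Qq\<^esub> \<delta>\<^sub>Q {1} {}, \<delta>\<^sub>Q {1, 2} {2} \<otimes>\<^bsub>Qq\<^esub> \<delta>\<^sub>Q {2} {})}"

definition refined_braid_relations :: "nat \<Rightarrow> (hasse_elt \<times> hasse_elt) set" where
  "refined_braid_relations n =
    (if even n then
       {(\<upsilon>\<^sub>Q {t} {1, 2} \<otimes>\<^bsub>Qq\<^esub> \<delta>\<^sub>Q {1, 2} {s},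
         \<delta>\<^sub>Q {t} {} \<otimes>\<^bsub>Qq\<^esub> (\<Oplus>\<^bsub>Qq\<^esub>j\<in>{2..n}. b_coeff n j \<odot>\<^bsub>Qq\<^esub> \<chi>\<^sub>Q_alt s t (j - 2)) \<otimes>\<^bsub>Qq\<^esub> \<upsilon>\<^sub>Q {} {s})
        | s t. (s, t) \<in> {(1, 2), (2, 1)}}
     else
       {(\<upsilon>\<^sub>Q {s} {1, 2} \<otimes>\<^bsub>Qq\<^esub> \<delta>\<^sub>Q {1, 2} {s},
         (\<delta>\<^sub>Q {s} {} \<otimes>\<^bsub>Qq\<^esub> (\<Oplus>\<^bsub>Qq\<^esub>j\<in>{3..n}. b_coeff n j \<odot>\<^bsub>Qq\<^esub> \<chi>\<^sub>Q_alt s t (j - 2)) \<otimes>\<^bsub>Qq\<^esub> \<upsilon>\<^sub>Q {} {s})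
         \<oplus>\<^bsub>Qq\<^esub> ((- \<q>) ^ ((n - 1) div 2) \<odot>\<^bsub>Qq\<^esub> e\<^sub>Q {s}))
        | s t. (s, t) \<in> {(1, 2), (2, 1)}})"

definition hasse_relations :: "nat \<Rightarrow> (hasse_elt \<times> hasse_elt) set" where
  "hasse_relations n = quasi_idempotent_relations n \<union> sandwich_relations \<union> refined_braid_relations n"

lemma Qq_ring: "ring Qq"
  by (rule path_algebra_ring) (auto simp: hasse_quiver_def wf_digraph_def)

lemma hasse_relations_closed:
  "hasse_relations n \<subseteq> carrier Qq \<times> carrier Qq"
proof -
  interpret Q: ring Qq by (rule Qq_ring)
  have wf: "wf_digraph hasse_quiver"
    by (auto simp: hasse_quiver_def wf_digraph_def)
  have arcs: "Delta {i} {} \<in> arcs hasse_quiver" "Upsilon {} {i} \<in> arcs hasse_quiver"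
    "Delta {1, 2} {i} \<in> arcs hasse_quiver" "Upsilon {i} {1, 2} \<in> arcs hasse_quiver"
    if "i = 1 \<or> i = 2" for i
    using that by (auto simp: hasse_quiver_def)
  note [simp] = arcs[THEN arrow_elt_closed[OF wf]]
  have verts: "verts hasse_quiver = {{}, {1}, {2}, {1, 2}}"
    by (simp add: hasse_quiver_def)
  have [simp]: "e\<^sub>Q {} \<in> carrier Qq" "e\<^sub>Q {1, 2} \<in> carrier Qq"
    "i = 1 \<or> i = 2 \<Longrightarrow> e\<^sub>Q {i} \<in> carrier Qq" for i
    by (rule trivial_path_closed; auto simp: verts)+
  have [simp]: "\<chi>\<^sub>Q i \<in> carrier Qq" if "i = 1 \<or> i = 2" for i
    using that unfolding \<chi>\<^sub>Q_def by simp
  have [simp]: "\<chi>\<^sub>Q_alt s t m \<in> carrier Qq" if "s = 1 \<or> s = 2" "t = 1 \<or> t = 2" for s t m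
    using that by (induction m arbitrary: s t) simp_all
  have [simp]: "(\<Oplus>\<^bsub>Qq\<^esub>j\<in>J. b_coeff n j \<odot>\<^bsub>Qq\<^esub> \<chi>\<^sub>Q_alt s t (j - 2)) \<in> carrier Qq"
    if "s = 1 \<or> s = 2" "t = 1 \<or> t = 2" for s t J
    using that by (intro Q.finsum_closed) (auto intro!: path_algebra_smult_closed)
  show ?thesis
    unfolding hasse_relations_def quasi_idempotent_relations_def sandwich_relations_def
      refined_braid_relations_def
    by (auto simp del: One_nat_def intro!: Q.m_closed Q.a_closed path_algebra_smult_closed)
qed

end

(*
  Put xi_i = 1 + T_i. In the Hecke algebra, left multiplication by the xi_i on the elements
  c j m = sum of T_w over all w below the alternating word of length m ending in j is given by
    xi_i c j m = (1 + q) c j m                      if the word starts with i,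
    xi_i c j m = c j (m + 1) + q c j (m - 1)        otherwise,
  and modulo the quadratic relations the braid relation says c 1 n = c 2 n. The rule above, read
  as a definition of operators on a free module with basis 1, c j m (0 < m < n), c 1 n, gives a
  representation: the operator of c 1 n - c 2 n commutes with the analogous right operators and
  kills the cyclic vector 1. Hence these 2 n elements form a basis of H.

  The quiver algebra acts on the sum of the x_I H by left multiplications with elements of H, and
  the coefficients b_j^n are those of the recursion for c, so all relations hold. Using the
  relations, e_K Q e_J is spanned by elements that map x_J to distinct basis elements c j m, namely
  those whose word starts in K and ends in J; this gives injectivity. For surjectivity,
  x_i z = (1 + q) z or z x_j = (1 + q) z forces z into the span of the c j m whose word starts
  with i or ends with j, so every homomorphism from x_J H to x_K H is hit.
*)

theory Submission
  imports Defs "HOL-Library.Function_Algebras"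
begin

section \<open>Algebras presented by a quiver with relations\<close>

text \<open>The shift by one makes \<open>\<xi> i\<close> the generator of the right ideal at {i},
  so that every upsilon can act as an inclusion. The elements c j m are, up to a power of the square
  root of q, the Kazhdan-Lusztig elements of the dihedral group, whose Kazhdan-Lusztig polynomials
  are all 1. Their recursion is that of the Chebyshev polynomials of the second kind with a
  parameter q, and the b_j^n are the coefficients of those polynomials. Writing c j m as
  \<open>\<zeta> j m\<close> times \<open>\<xi> j\<close> supplies the operators into the vertex
  {1,2}: left multiplication by \<open>\<zeta> j n\<close> carries the generator at {j} to the
  generator at {1,2}. They are found from coordinates instead, using only that 1 + q is not a zero
  divisor. As H is given by a presentation alone, the independence of any candidate basis needs a
  concrete representation.\<close>

lemma lookup_smult [simp]:
  "Poly_Mapping.lookup (c \<odot>\<^bsub>path_algebra Q\<^esub> f) p = c * Poly_Mapping.lookup f p"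
  by (simp add: path_algebra_def map.rep_eq when_def)

lemma path_algebra_simps [simp]:
  "f \<oplus>\<^bsub>path_algebra Q\<^esub> g = f + g" "\<zero>\<^bsub>path_algebra Q\<^esub> = 0"
  by (simp_all add: path_algebra_def)

lemma path_algebra_smult_module:
  "c \<odot>\<^bsub>path_algebra Q\<^esub> (f + g) = c \<odot>\<^bsub>path_algebra Q\<^esub> f + c \<odot>\<^bsub>path_algebra Q\<^esub> g"
  "(c + d) \<odot>\<^bsub>path_algebra Q\<^esub> f = c \<odot>\<^bsub>path_algebra Q\<^esub> f + d \<odot>\<^bsub>path_algebra Q\<^esub> f"
  "c \<odot>\<^bsub>path_algebra Q\<^esub> (d \<odot>\<^bsub>path_algebra Q\<^esub> f) = (c * d) \<odot>\<^bsub>path_algebra Q\<^esub> f"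
  "1 \<odot>\<^bsub>path_algebra Q\<^esub> f = f"
  "0 \<odot>\<^bsub>path_algebra Q\<^esub> f = 0"
  "c \<odot>\<^bsub>path_algebra Q\<^esub> 0 = 0"
  "c \<odot>\<^bsub>path_algebra Q\<^esub> (f - g) = c \<odot>\<^bsub>path_algebra Q\<^esub> f - c \<odot>\<^bsub>path_algebra Q\<^esub> g"
  "(c - d) \<odot>\<^bsub>path_algebra Q\<^esub> f = c \<odot>\<^bsub>path_algebra Q\<^esub> f - d \<odot>\<^bsub>path_algebra Q\<^esub> f"
  "(- c) \<odot>\<^bsub>path_algebra Q\<^esub> f = - (c \<odot>\<^bsub>path_algebra Q\<^esub> f)"
  "c \<odot>\<^bsub>path_algebra Q\<^esub> (- f) = - (c \<odot>\<^bsub>path_algebra Q\<^esub> f)"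
  by (rule poly_mapping_eqI; simp add: lookup_add lookup_minus algebra_simps)+

lemma path_algebra_smult_single:
  "c \<odot>\<^bsub>path_algebra Q\<^esub> Poly_Mapping.single p d = Poly_Mapping.single p (c * d)"
  by (rule poly_mapping_eqI) (simp add: lookup_single when_def)

lemma path_algebra_smult_sum:
  "c \<odot>\<^bsub>path_algebra Q\<^esub> (\<Sum>i\<in>I. f i) = (\<Sum>i\<in>I. c \<odot>\<^bsub>path_algebra Q\<^esub> f i)"
  by (induction I rule: infinite_finite_induct) (simp_all add: path_algebra_smult_module)

lemma path_algebra_mult_diff:
  "(f - g) \<otimes>\<^bsub>path_algebra Q\<^esub> h = f \<otimes>\<^bsub>path_algebra Q\<^esub> h - g \<otimes>\<^bsub>path_algebra Q\<^esub> h"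
  "h \<otimes>\<^bsub>path_algebra Q\<^esub> (f - g) = h \<otimes>\<^bsub>path_algebra Q\<^esub> f - h \<otimes>\<^bsub>path_algebra Q\<^esub> g"
  "(- f) \<otimes>\<^bsub>path_algebra Q\<^esub> h = - (f \<otimes>\<^bsub>path_algebra Q\<^esub> h)"
  "h \<otimes>\<^bsub>path_algebra Q\<^esub> (- f) = - (h \<otimes>\<^bsub>path_algebra Q\<^esub> f)"
proof -
  show neg: "(- f) \<otimes>\<^bsub>path_algebra Q\<^esub> h = - (f \<otimes>\<^bsub>path_algebra Q\<^esub> h)"
    "h \<otimes>\<^bsub>path_algebra Q\<^esub> (- f) = - (h \<otimes>\<^bsub>path_algebra Q\<^esub> f)" for f
    by (metis (no_types) add.right_inverse path_algebra_mult_add_left path_algebra_mult_add_right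
        path_algebra_mult_zero minus_unique)+
  show "(f - g) \<otimes>\<^bsub>path_algebra Q\<^esub> h = f \<otimes>\<^bsub>path_algebra Q\<^esub> h - g \<otimes>\<^bsub>path_algebra Q\<^esub> h"
    "h \<otimes>\<^bsub>path_algebra Q\<^esub> (f - g) = h \<otimes>\<^bsub>path_algebra Q\<^esub> f - h \<otimes>\<^bsub>path_algebra Q\<^esub> g"
    by (simp_all only: diff_conv_add_uminus path_algebra_mult_add_left
        path_algebra_mult_add_right neg)
qed

lemma path_term_smult:
  "path_term \<alpha> \<beta> (c * d) = c \<odot>\<^bsub>path_algebra Q\<^esub> path_term \<alpha> \<beta> d"
  by (auto simp: path_term_def path_algebra_smult_single path_algebra_smult_module split: prod.splits)

lemma path_algebra_mult_smult:
  fixes f g :: "('v, 'e) path \<Rightarrow>\<^sub>0 'r::comm_ring_1"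
  shows "(c \<odot>\<^bsub>path_algebra Q\<^esub> f) \<otimes>\<^bsub>path_algebra Q\<^esub> g = c \<odot>\<^bsub>path_algebra Q\<^esub> (f \<otimes>\<^bsub>path_algebra Q\<^esub> g)"
  and "f \<otimes>\<^bsub>path_algebra Q\<^esub> (c \<odot>\<^bsub>path_algebra Q\<^esub> g) = c \<odot>\<^bsub>path_algebra Q\<^esub> (f \<otimes>\<^bsub>path_algebra Q\<^esub> g)"
proof -
  have keys: "Poly_Mapping.keys (c \<odot>\<^bsub>path_algebra Q\<^esub> h) \<subseteq> Poly_Mapping.keys h"
    for h :: "('v, 'e) path \<Rightarrow>\<^sub>0 'r"
    by (auto simp: in_keys_iff)
  note sup = path_algebra_mult_superset[of "Poly_Mapping.keys f" "Poly_Mapping.keys g"]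
  show "(c \<odot>\<^bsub>path_algebra Q\<^esub> f) \<otimes>\<^bsub>path_algebra Q\<^esub> g = c \<odot>\<^bsub>path_algebra Q\<^esub> (f \<otimes>\<^bsub>path_algebra Q\<^esub> g)"
    by (simp add: sup keys path_algebra_smult_sum path_term_smult[symmetric] mult.assoc)
  show "f \<otimes>\<^bsub>path_algebra Q\<^esub> (c \<odot>\<^bsub>path_algebra Q\<^esub> g) = c \<odot>\<^bsub>path_algebra Q\<^esub> (f \<otimes>\<^bsub>path_algebra Q\<^esub> g)"
    by (simp add: sup keys path_algebra_smult_sum path_term_smult[symmetric] mult.left_commute)
qed

lemmas path_algebra_expand =
  path_algebra_mult_add_left path_algebra_mult_add_right path_algebra_mult_diff
  path_algebra_mult_smult path_algebra_smult_module path_algebra_mult_assoc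

lemma path_algebra_carrier_zero: "0 \<in> carrier (path_algebra Q)"
  by (simp add: path_algebra_carrier_iff)

lemma path_algebra_carrier_add:
  "f \<in> carrier (path_algebra Q) \<Longrightarrow> g \<in> carrier (path_algebra Q) \<Longrightarrow> f + g \<in> carrier (path_algebra Q)"
  using keys_add[of f g] by (auto simp: path_algebra_carrier_iff)

lemma path_algebra_carrier_uminus:
  "f \<in> carrier (path_algebra Q) \<Longrightarrow> - f \<in> carrier (path_algebra Q)"
  by (simp add: path_algebra_carrier_iff)

lemma path_algebra_carrier_diff:
  "f \<in> carrier (path_algebra Q) \<Longrightarrow> g \<in> carrier (path_algebra Q) \<Longrightarrow> f - g \<in> carrier (path_algebra Q)"
  using path_algebra_carrier_add[of f Q "- g"] path_algebra_carrier_uminus by auto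

lemmas path_algebra_closed [simp, intro] =
  path_algebra_carrier_zero path_algebra_carrier_add path_algebra_carrier_uminus
  path_algebra_carrier_diff path_algebra_smult_closed path_algebra_mult_closed
  path_algebra_sum_carrier

text \<open>A path arises from a trivial one by attaching arrows at its end, that is, by multiplying
  with arrows on the left. The arrow step is stated for arbitrary elements, not only for paths,
  which suits spans and actions.\<close>

lemma path_algebra_induct [consumes 2, case_names add smult zero trivial arrow]:
  assumes wf: "wf_digraph Q" and f: "f \<in> carrier (path_algebra Q)"
    and add: "\<And>f g. P f \<Longrightarrow> P g \<Longrightarrow> P (f + g)"
    and smult: "\<And>c f. P f \<Longrightarrow> P (c \<odot>\<^bsub>path_algebra Q\<^esub> f)"
    and zero: "P 0"
    and trivial: "\<And>v. v \<in> verts Q \<Longrightarrow> P (trivial_path v)"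
    and arrow: "\<And>a f. a \<in> arcs Q \<Longrightarrow> f \<in> carrier (path_algebra Q) \<Longrightarrow> P f \<Longrightarrow>
      P (arrow_elt Q a \<otimes>\<^bsub>path_algebra Q\<^esub> f)"
  shows "P (f :: ('v, 'e) path \<Rightarrow>\<^sub>0 'r::comm_ring_1)"
proof -
  interpret wf_digraph Q by (rule wf)
  have path: "P (Poly_Mapping.single (u, p, v) 1) \<and> v \<in> verts Q" if "awalk u p v" for u p v
    using that
  proof (induction p arbitrary: v rule: rev_induct)
    case Nil
    then show ?case using trivial[of u] by (auto simp: trivial_path_def awalk_def)
  next
    case (snoc a p)
    then have "awalk u p (tail Q a)" "a \<in> arcs Q" "v = head Q a"
      by (auto simp: awalk_simps)
    moreover from this have "arrow_elt Q a \<otimes>\<^bsub>path_algebra Q\<^esub> Poly_Mapping.single (u, p, tail Q a) (1::'r)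
        = Poly_Mapping.single (u, p @ [a], v) 1"
      by (simp add: arrow_elt_def path_algebra_mult_single path_term_def)
    ultimately show ?case
      using snoc.IH[of "tail Q a"] arrow[of a "Poly_Mapping.single (u, p, tail Q a) 1"]
      by (auto simp: path_algebra_carrier_iff paths_def)
  qed
    have "P (\<Sum>k\<in>S. Poly_Mapping.single k (Poly_Mapping.lookup f k))"
      if "S \<subseteq> Poly_Mapping.keys f" for S
      using finite_subset[OF that finite_keys] that
    proof (induction S rule: finite_induct)
      case empty
      then show ?case using zero by simp
    next
      case (insert k S)
      obtain u p w where k: "k = (u, p, w)" by (cases k)
      then have "awalk u p w"
        using insert.prems f by (auto simp: path_algebra_carrier_iff paths_def)
      then show ?case
        using insert smult[OF path[THEN conjunct1], of u p w "Poly_Mapping.lookup f k"]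
        by (auto simp: k path_algebra_smult_single intro!: add)
    qed
    from this[OF subset_refl] show ?thesis
      by (simp only: poly_mapping_sum_single[of f, symmetric])
qed

section \<open>Ideals, congruences and quotients of path algebras\<close>

lemma path_algebra_idealI:
  assumes "finite (verts Q)" "wf_digraph Q"
    and "J \<subseteq> carrier (path_algebra Q)" "0 \<in> J"
    and "\<And>f g. f \<in> J \<Longrightarrow> g \<in> J \<Longrightarrow> f + g \<in> J" "\<And>f. f \<in> J \<Longrightarrow> - f \<in> J"
    and "\<And>f g. f \<in> J \<Longrightarrow> g \<in> carrier (path_algebra Q) \<Longrightarrow> g \<otimes>\<^bsub>path_algebra Q\<^esub> f \<in> J"
    and "\<And>f g. f \<in> J \<Longrightarrow> g \<in> carrier (path_algebra Q) \<Longrightarrow> f \<otimes>\<^bsub>path_algebra Q\<^esub> g \<in> J"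
  shows "ideal J (path_algebra Q :: ('r::comm_ring_1, ('v, 'e) path \<Rightarrow>\<^sub>0 'r) module)"
proof (rule idealI)
  interpret A: ring "path_algebra Q :: ('r::comm_ring_1, ('v, 'e) path \<Rightarrow>\<^sub>0 'r) module"
    by (rule path_algebra_ring) fact+
  show "ring (path_algebra Q :: ('r::comm_ring_1, ('v, 'e) path \<Rightarrow>\<^sub>0 'r) module)" ..
  have "\<ominus>\<^bsub>path_algebra Q\<^esub> g = - g" if "g \<in> carrier (path_algebra Q)" for g :: "('v, 'e) path \<Rightarrow>\<^sub>0 'r"
    using that A.minus_equality[of "- g" g] by simp
  then show "subgroup J (add_monoid (path_algebra Q))"
    using assms(3-6) by (intro A.add.subgroupI) (auto simp: a_inv_def)
qed (use assms in auto)

text \<open>Three instances follow: the free algebra modulo the quadratic relations alone, the Hecke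
  algebra, and the algebra of the Hasse quiver. Computations stay with representatives in the path
  algebra, \<open>\<approx>\<close> being equality in the quotient; cosets enter only through
  \<open>cls\<close>.\<close>

locale presented_path_algebra =
  fixes Q :: "('v, 'e) pre_digraph" and R :: "(('v, 'e) path \<Rightarrow>\<^sub>0 'r::comm_ring_1) rel"
  assumes fin: "finite (verts Q)" and wf: "wf_digraph Q"
    and R_closed: "R \<subseteq> carrier (path_algebra Q) \<times> carrier (path_algebra Q)"
begin

abbreviation A where "A \<equiv> path_algebra Q :: ('r, ('v, 'e) path \<Rightarrow>\<^sub>0 'r) module"
abbreviation I where "I \<equiv> relation_ideal A R"

sublocale A: ring A
  by (rule path_algebra_ring[OF fin wf])

lemma A_minus:
  assumes "f \<in> carrier A" "g \<in> carrier A"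
  shows "f \<ominus>\<^bsub>A\<^esub> g = f - g"
proof -
  have "\<ominus>\<^bsub>A\<^esub> g = - g"
    using assms A.minus_equality[of "- g" g] by simp
  then show ?thesis by (simp add: a_minus_def)
qed

lemma generators_closed: "{l \<ominus>\<^bsub>A\<^esub> r | l r. (l, r) \<in> R} \<subseteq> carrier A"
  using R_closed by auto

lemma I_ideal: "ideal I A"
  unfolding relation_ideal_def by (rule A.genideal_ideal[OF generators_closed])

definition eqv (infix \<open>\<approx>\<close> 50) where "f \<approx> g \<longleftrightarrow> f - g \<in> I"

lemma eqv_relation: "(l, r) \<in> R \<Longrightarrow> l \<approx> r"
proof -
  assume lr: "(l, r) \<in> R"
  then have "l - r \<in> {l \<ominus>\<^bsub>A\<^esub> r | l r. (l, r) \<in> R}"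
    using A_minus[of l r, symmetric] R_closed by auto
  then show "l \<approx> r"
    using A.genideal_self[OF generators_closed] by (auto simp: eqv_def relation_ideal_def)
qed

lemma I_minimal:
  assumes "ideal J A" and "\<And>l r. (l, r) \<in> R \<Longrightarrow> l - r \<in> J"
  shows "I \<subseteq> J"
  unfolding relation_ideal_def
proof (rule A.genideal_minimal[OF assms(1)], safe)
  fix l r assume lr: "(l, r) \<in> R"
  then have "l \<in> carrier A" "r \<in> carrier A" using R_closed by auto
  then show "l \<ominus>\<^bsub>A\<^esub> r \<in> J" using assms(2)[OF lr] by (simp add: A_minus)
qed

lemma I_add: "f \<in> I \<Longrightarrow> g \<in> I \<Longrightarrow> f + g \<in> I"
  using additive_subgroup.a_closed[OF ideal.axioms(1)[OF I_ideal], of f g] by simp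

lemma I_zero: "0 \<in> I"
  using additive_subgroup.zero_closed[OF ideal.axioms(1)[OF I_ideal]] by simp

text \<open>A ring ideal is stable under scalars because a scalar acts as multiplication by its
  multiple of the identity.\<close>

lemma I_smult: assumes "f \<in> I" shows "c \<odot>\<^bsub>A\<^esub> f \<in> I"
proof -
  have f: "f \<in> carrier A" using assms by (rule ideal.Icarr[OF I_ideal])
  have "(c \<odot>\<^bsub>A\<^esub> \<one>\<^bsub>A\<^esub>) \<otimes>\<^bsub>A\<^esub> f = c \<odot>\<^bsub>A\<^esub> f"
    using f by (simp add: path_algebra_mult_smult)
  moreover have "(c \<odot>\<^bsub>A\<^esub> \<one>\<^bsub>A\<^esub>) \<otimes>\<^bsub>A\<^esub> f \<in> I"
    using assms by (intro ideal.I_l_closed[OF I_ideal]) auto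
  ultimately show ?thesis by simp
qed

lemma I_uminus: "f \<in> I \<Longrightarrow> - f \<in> I"
  using I_smult[of f "-1"] by (simp add: path_algebra_smult_module)

lemma I_diff: "f \<in> I \<Longrightarrow> g \<in> I \<Longrightarrow> f - g \<in> I"
  using I_add[of f "- g"] I_uminus[of g] by simp

lemma eqv_refl [simp]: "f \<approx> f"
  by (simp add: eqv_def I_zero)

lemma eqv_sym: "f \<approx> g \<Longrightarrow> g \<approx> f"
  using I_uminus[of "f - g"] by (simp add: eqv_def)

lemma eqv_trans [trans]: "f \<approx> g \<Longrightarrow> g \<approx> h \<Longrightarrow> f \<approx> h"
  using I_add[of "f - g" "g - h"] by (simp add: eqv_def)

lemma eqv_add: "f \<approx> g \<Longrightarrow> f' \<approx> g' \<Longrightarrow> f + f' \<approx> g + g'"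
  using I_add[of "f - g" "f' - g'"] by (simp add: eqv_def algebra_simps)

lemma eqv_diff: "f \<approx> g \<Longrightarrow> f' \<approx> g' \<Longrightarrow> f - f' \<approx> g - g'"
  using I_diff[of "f - g" "f' - g'"] by (simp add: eqv_def algebra_simps)

lemma eqv_smult: "f \<approx> g \<Longrightarrow> c \<odot>\<^bsub>A\<^esub> f \<approx> c \<odot>\<^bsub>A\<^esub> g"
  using I_smult[of "f - g" c] by (simp add: eqv_def path_algebra_smult_module)

lemma eqv_sum: "(\<And>i. i \<in> S \<Longrightarrow> f i \<approx> g i) \<Longrightarrow> (\<Sum>i\<in>S. f i) \<approx> (\<Sum>i\<in>S. g i)"
  by (induction S rule: infinite_finite_induct) (auto intro: eqv_add)

lemma eqv_mult_left: "f \<approx> g \<Longrightarrow> h \<in> carrier A \<Longrightarrow> h \<otimes>\<^bsub>A\<^esub> f \<approx> h \<otimes>\<^bsub>A\<^esub> g"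
  using ideal.I_l_closed[OF I_ideal, of "f - g" h] by (simp add: eqv_def path_algebra_mult_diff)

lemma eqv_mult_right: "f \<approx> g \<Longrightarrow> h \<in> carrier A \<Longrightarrow> f \<otimes>\<^bsub>A\<^esub> h \<approx> g \<otimes>\<^bsub>A\<^esub> h"
  using ideal.I_r_closed[OF I_ideal, of "f - g" h] by (simp add: eqv_def path_algebra_mult_diff)

lemma eqv_carrier: "f \<approx> g \<Longrightarrow> g \<in> carrier A \<Longrightarrow> f \<in> carrier A"
  using ideal.Icarr[OF I_ideal, of "f - g"] path_algebra_carrier_add[of "f - g" Q g] by (simp add: eqv_def)

text \<open>A span modulo the relations; it serves for \<open>basis_elt\<close> in the Hecke algebra
  and for \<open>lift\<close> in the quiver algebra.\<close>

definition in_span :: "('s \<Rightarrow> (('v, 'e) path \<Rightarrow>\<^sub>0 'r)) \<Rightarrow> 's set \<Rightarrow> (('v, 'e) path \<Rightarrow>\<^sub>0 'r) \<Rightarrow> bool" where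
  "in_span g S f \<longleftrightarrow> (\<exists>v. eqv f (\<Sum>s\<in>S. v s \<odot>\<^bsub>A\<^esub> g s))"

lemma in_span_eqv: "in_span g S f \<Longrightarrow> eqv f' f \<Longrightarrow> in_span g S f'"
  unfolding in_span_def using eqv_trans by blast

lemma in_span_add:
  assumes "in_span g S f" "in_span g S f'"
  shows "in_span g S (f + f')"
proof -
  obtain v w where "eqv f (\<Sum>s\<in>S. v s \<odot>\<^bsub>A\<^esub> g s)" "eqv f' (\<Sum>s\<in>S. w s \<odot>\<^bsub>A\<^esub> g s)"
    using assms by (auto simp: in_span_def)
  then have "eqv (f + f') (\<Sum>s\<in>S. (v s + w s) \<odot>\<^bsub>A\<^esub> g s)"
    by (simp add: path_algebra_smult_module sum.distrib eqv_add)
  then show ?thesis unfolding in_span_def by (intro exI[of _ "\<lambda>s. v s + w s"])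
qed

lemma in_span_smult:
  assumes "in_span g S f"
  shows "in_span g S (c \<odot>\<^bsub>A\<^esub> f)"
proof -
  obtain v where "eqv f (\<Sum>s\<in>S. v s \<odot>\<^bsub>A\<^esub> g s)"
    using assms by (auto simp: in_span_def)
  then have "eqv (c \<odot>\<^bsub>A\<^esub> f) (c \<odot>\<^bsub>A\<^esub> (\<Sum>s\<in>S. v s \<odot>\<^bsub>A\<^esub> g s))"
    by (rule eqv_smult)
  then have "eqv (c \<odot>\<^bsub>A\<^esub> f) (\<Sum>s\<in>S. (c * v s) \<odot>\<^bsub>A\<^esub> g s)"
    by (simp add: path_algebra_smult_module path_algebra_smult_sum)
  then show ?thesis unfolding in_span_def by (intro exI[of _ "\<lambda>s. c * v s"])
qed

lemma in_span_zero: "in_span g S 0"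
  unfolding in_span_def by (intro exI[of _ "\<lambda>_. 0"]) (simp add: path_algebra_smult_module)

lemma in_span_sum: "(\<And>i. i \<in> N \<Longrightarrow> in_span g S (f i)) \<Longrightarrow> in_span g S (\<Sum>i\<in>N. f i)"
  by (induction N rule: infinite_finite_induct) (auto simp: in_span_zero in_span_add)

lemma in_span_base:
  assumes "finite S" "s \<in> S"
  shows "in_span g S (g s)"
proof -
  have "(\<Sum>s'\<in>S. (if s' = s then 1 else 0) \<odot>\<^bsub>A\<^esub> g s') = (\<Sum>s'\<in>S. if s' = s then g s else 0)"
    by (intro sum.cong refl) (simp add: path_algebra_smult_module)
  also have "\<dots> = g s" using assms by simp
  finally show ?thesis
    unfolding in_span_def by (intro exI[of _ "\<lambda>s'. if s' = s then 1 else 0"]) simp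
qed

abbreviation QA where "QA \<equiv> quotient_algebra A I"
definition cls where "cls f = I +>\<^bsub>A\<^esub> f"

lemma cls_def': "cls f = (\<lambda>i. i + f) ` I"
  by (auto simp: cls_def a_r_coset_def r_coset_def)

lemma cls_eq_iff:
  "cls f = cls g \<longleftrightarrow> f \<approx> g"
proof
  assume "cls f = cls g"
  moreover have "f \<in> cls f" using I_zero by (force simp: cls_def')
  ultimately obtain i where "i \<in> I" "f = i + g" by (auto simp: cls_def')
  then show "f \<approx> g" by (simp add: eqv_def)
next
  have sub: "cls f \<subseteq> cls g" if "f \<approx> g" for f g
  proof
    fix x assume "x \<in> cls f"
    then obtain i where "i \<in> I" "x = i + f" by (auto simp: cls_def')
    moreover have "i + f = (i + (f - g)) + g" by simp
    ultimately show "x \<in> cls g"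
      using I_add[of i "f - g"] that unfolding cls_def' eqv_def by blast
  qed
  assume "f \<approx> g" then show "cls f = cls g" using sub eqv_sym by blast
qed

lemma mem_cls_iff: "f \<in> cls g \<longleftrightarrow> f \<approx> g"
proof
  assume "f \<in> cls g"
  then show "f \<approx> g" by (auto simp: cls_def' eqv_def)
next
  assume "f \<approx> g"
  then show "f \<in> cls g" using I_zero cls_eq_iff[of f g] by (force simp: cls_def')
qed

lemma QA_simps:
  "carrier QA = cls ` carrier A"
  "\<zero>\<^bsub>QA\<^esub> = cls 0"
  "\<one>\<^bsub>QA\<^esub> = cls \<one>\<^bsub>A\<^esub>"
  by (auto simp: quotient_algebra_def ring.defs module.defs FactRing_def A_RCOSETS_defs
      cls_def a_r_coset_def r_coset_def)

lemma QA_add: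
  "f \<in> carrier A \<Longrightarrow> g \<in> carrier A \<Longrightarrow> cls f \<oplus>\<^bsub>QA\<^esub> cls g = cls (f + g)"
  using ideal.a_rcos_sum[OF I_ideal, of f g] by (simp add: quotient_algebra_def ring.defs module.defs FactRing_def cls_def)

lemma QA_mult:
  "f \<in> carrier A \<Longrightarrow> g \<in> carrier A \<Longrightarrow> cls f \<otimes>\<^bsub>QA\<^esub> cls g = cls (f \<otimes>\<^bsub>A\<^esub> g)"
  using ideal.rcoset_mult_add[OF I_ideal, of f g] by (simp add: quotient_algebra_def ring.defs module.defs FactRing_def cls_def)

lemma QA_smult: "c \<odot>\<^bsub>QA\<^esub> cls f = cls (c \<odot>\<^bsub>A\<^esub> f)"
proof -
  have "c \<odot>\<^bsub>QA\<^esub> cls f = (\<Union>x\<in>cls f. cls (c \<odot>\<^bsub>A\<^esub> x))"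
    by (simp add: quotient_algebra_def ring.defs module.defs FactRing_def cls_def)
  also have "\<dots> = (\<Union>x\<in>cls f. cls (c \<odot>\<^bsub>A\<^esub> f))"
    by (intro SUP_cong refl) (simp add: cls_eq_iff mem_cls_iff eqv_smult)
  also have "\<dots> = cls (c \<odot>\<^bsub>A\<^esub> f)"
    using mem_cls_iff[of f f] by auto
  finally show ?thesis .
qed

lemma QA_ring: "ring QA"
proof -
  interpret F: ring "A Quot I" by (rule ideal.quotient_is_ring[OF I_ideal])
  have eqs: "carrier QA = carrier (A Quot I)" "mult QA = mult (A Quot I)" "add QA = add (A Quot I)"
    "one QA = one (A Quot I)" "zero QA = zero (A Quot I)"
    by (simp_all add: quotient_algebra_def ring.defs module.defs FactRing_def)
  show ?thesis
    by (rule ringI; (rule abelian_groupI monoidI)?)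
       (auto simp: eqs F.l_distr F.r_distr F.a_ac F.m_assoc intro: F.a_inv_closed F.l_neg)
qed

lemma finsum_cls:
  assumes "\<And>i. i \<in> S \<Longrightarrow> f i \<in> carrier A"
  shows "(\<Oplus>\<^bsub>QA\<^esub>i\<in>S. cls (f i)) = cls (\<Sum>i\<in>S. f i)"
proof -
  interpret QA: ring QA by (rule QA_ring)
  show ?thesis using assms
  proof (induction S rule: infinite_finite_induct)
    case (infinite S)
    then show ?case by (simp add: QA_simps QA.finsum_infinite)
  next
    case empty
    then show ?case by (simp add: QA_simps)
  next
    case (insert i S)
    then show ?case
      by (subst QA.finsum_insert) (auto simp: QA_simps QA_add Pi_def path_algebra_sum_carrier)
  qed
qed

end

section \<open>Representations of path algebras\<close>

text \<open>One module serves all vertices, instead of one module per vertex. For the Hasse quiver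
  it is the free algebra, and the submodule belonging to each vertex is imposed later by the
  predicate \<open>vec\<close>; for the loop quiver it is the space of coordinate functions.\<close>

locale arrow_action =
  fixes sc :: "'r::comm_ring_1 \<Rightarrow> 'm::ab_group_add \<Rightarrow> 'm" and act :: "'e \<Rightarrow> 'm \<Rightarrow> 'm"
  assumes sc_add: "sc c (x + y) = sc c x + sc c y"
    and sc_add_left: "sc (c + d) x = sc c x + sc d x"
    and sc_sc: "sc c (sc d x) = sc (c * d) x"
    and sc_one: "sc 1 x = x"
    and act_add: "act a (x + y) = act a x + act a y"
    and act_sc: "act a (sc c x) = sc c (act a x)"
begin

lemma sc_zero [simp]: "sc c 0 = 0" "sc 0 x = 0"
  using sc_add[of c 0 0] sc_add_left[of 0 0 x] by auto

lemma sc_sum: "sc c (\<Sum>i\<in>S. x i) = (\<Sum>i\<in>S. sc c (x i))"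
  by (induction S rule: infinite_finite_induct) (simp_all add: sc_add)

lemma walk_zero: "fold act p 0 = 0"
proof (induction p)
  case (Cons a p)
  then show ?case using act_add[of a 0 0] by simp
qed simp

lemma walk_add: "fold act p (x + y) = fold act p x + fold act p y"
  by (induction p arbitrary: x y) (simp_all add: act_add)

lemma walk_sc: "fold act p (sc c x) = sc c (fold act p x)"
  by (induction p arbitrary: x) (simp_all add: act_sc)

text \<open>An element of \<open>\<Oplus>\<^sub>v M\<close>, the sum over the vertices \<open>v\<close>, is a function \<open>m\<close> on vertices;
  a path from \<open>u\<close> to \<open>v\<close> moves the component at \<open>u\<close> to the component at \<open>v\<close>.\<close>

definition single_act :: "('v, 'e) path \<Rightarrow> 'r \<Rightarrow> ('v \<Rightarrow> 'm) \<Rightarrow> 'v \<Rightarrow> 'm" where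
  "single_act = (\<lambda>(u, p, v) c m k. if k = v then sc c (fold act p (m u)) else 0)"

definition path_act :: "(('v, 'e) path \<Rightarrow>\<^sub>0 'r) \<Rightarrow> ('v \<Rightarrow> 'm) \<Rightarrow> 'v \<Rightarrow> 'm" where
  "path_act f m k = (\<Sum>\<alpha>\<in>Poly_Mapping.keys f. single_act \<alpha> (Poly_Mapping.lookup f \<alpha>) m k)"

lemma path_act_superset:
  assumes "finite S" "Poly_Mapping.keys f \<subseteq> S"
  shows "path_act f m k = (\<Sum>\<alpha>\<in>S. single_act \<alpha> (Poly_Mapping.lookup f \<alpha>) m k)"
  unfolding path_act_def using assms
  by (intro sum.mono_neutral_left) (auto simp: in_keys_iff single_act_def split: prod.splits)

lemma path_act_single: "path_act (Poly_Mapping.single \<alpha> c) m k = single_act \<alpha> c m k"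
  by (subst path_act_superset[of "{\<alpha>}"]) auto

lemma path_act_add: "path_act (f + g) m k = path_act f m k + path_act g m k"
proof -
  let ?S = "Poly_Mapping.keys f \<union> Poly_Mapping.keys g"
  have "Poly_Mapping.keys (f + g) \<subseteq> ?S" by (rule keys_add)
  then show ?thesis
    by (simp add: path_act_superset[of ?S] sum.distrib[symmetric] lookup_add single_act_def sc_add_left
        split: prod.splits cong: sum.cong) (auto intro!: sum.cong simp: sc_add_left)
qed

lemma path_act_zero [simp]: "path_act 0 m k = 0"
  by (simp add: path_act_def)

lemma path_act_diff: "path_act (f - g) m k = path_act f m k - path_act g m k"
  using path_act_add[of "f - g" g m k] by simp

lemma path_act_sum: "path_act (\<Sum>i\<in>S. f i) m k = (\<Sum>i\<in>S. path_act (f i) m k)"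
  by (induction S rule: infinite_finite_induct) (simp_all add: path_act_add)

lemma path_act_smult: "path_act (c \<odot>\<^bsub>path_algebra Q\<^esub> f) m k = sc c (path_act f m k)"
  by (subst path_act_superset[of "Poly_Mapping.keys f"])
     (auto simp: in_keys_iff path_act_def sc_sum single_act_def sc_sc intro!: sum.cong split: prod.splits)

lemma path_act_arg_add: "path_act f (\<lambda>u. m u + m' u) k = path_act f m k + path_act f m' k"
  by (auto simp: path_act_def sum.distrib[symmetric] single_act_def walk_add sc_add
      split: prod.splits intro!: sum.cong)

lemma path_act_arg_zero [simp]: "path_act f (\<lambda>u. 0) k = 0"
  by (auto simp: path_act_def single_act_def walk_zero split: prod.splits intro!: sum.neutral)

lemma path_act_arg_sum: "path_act f (\<lambda>u. \<Sum>i\<in>S. m i u) k = (\<Sum>i\<in>S. path_act f (m i) k)"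
  by (induction S rule: infinite_finite_induct) (simp_all add: path_act_arg_add)

lemma path_act_arg_sc: "path_act f (\<lambda>u. sc c (m u)) k = sc c (path_act f m k)"
  by (auto simp: path_act_def sc_sum single_act_def walk_sc sc_sc mult.commute
      split: prod.splits intro!: sum.cong)

text \<open>On single paths, concatenation of arrow lists is composition of folds; if the paths do
  not meet, the left one reads a component at which the right one has put zero. The general case
  follows by bilinearity.\<close>

lemma path_act_mult:
  "path_act (f \<otimes>\<^bsub>path_algebra Q\<^esub> g) m k = path_act f (path_act g m) k"
proof -
  have single: "path_act (Poly_Mapping.single \<alpha> c \<otimes>\<^bsub>path_algebra Q\<^esub> Poly_Mapping.single \<beta> d) m k
      = path_act (Poly_Mapping.single \<alpha> c) (path_act (Poly_Mapping.single \<beta> d) m) k" for \<alpha> \<beta> c d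
    by (cases \<alpha>; cases \<beta>)
       (simp add: path_algebra_mult_single path_term_def path_act_single single_act_def walk_zero
         walk_sc sc_sc)
  have right: "path_act (Poly_Mapping.single \<alpha> c \<otimes>\<^bsub>path_algebra Q\<^esub> g) m k
      = path_act (Poly_Mapping.single \<alpha> c) (path_act g m) k" for \<alpha> c
  proof -
    have "path_act g m = (\<lambda>u. \<Sum>\<beta>\<in>Poly_Mapping.keys g.
        path_act (Poly_Mapping.single \<beta> (Poly_Mapping.lookup g \<beta>)) m u)"
      by (rule ext, subst poly_mapping_sum_single[of g], simp only: path_act_sum)
    then show ?thesis
      by (subst poly_mapping_sum_single[of g], simp only: path_algebra_mult_sum_right path_act_sum
          path_act_arg_sum single)
  qed
  show ?thesis
    by (subst (1 2) poly_mapping_sum_single[of f],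
        simp only: path_algebra_mult_sum_left path_act_sum right)
qed

lemma path_act_arrow: "path_act (arrow_elt Q a) m k = (if k = head Q a then act a (m (tail Q a)) else 0)"
  by (simp add: arrow_elt_def path_act_single single_act_def sc_one)

lemma path_act_trivial: "path_act (trivial_path v) m k = (if k = v then m v else 0)"
  by (simp add: trivial_path_def path_act_single single_act_def sc_one)

lemma path_act_one:
  assumes "finite (verts Q)" "k \<in> verts Q"
  shows "path_act \<one>\<^bsub>path_algebra Q\<^esub> m k = m k"
proof -
  have "path_act \<one>\<^bsub>path_algebra Q\<^esub> m k = (\<Sum>v\<in>verts Q. path_act (trivial_path v) m k)"
    by (simp add: path_algebra_def path_act_sum trivial_path_def)
  also have "\<dots> = m k" using assms by (simp add: path_act_trivial)
  finally show ?thesis .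
qed

end

section \<open>The elements \<open>c j m\<close> of the Hecke algebra\<close>

abbreviation free_mult (infixl \<open>\<star>\<close> 70) where "f \<star> g \<equiv> f \<otimes>\<^bsub>free_alg\<^esub> g"
abbreviation free_smult (infixr \<open>*\<^sub>F\<close> 75) where "c *\<^sub>F f \<equiv> c \<odot>\<^bsub>free_alg\<^esub> f"
abbreviation free_one (\<open>\<one>\<^sub>F\<close>) where "\<one>\<^sub>F \<equiv> \<one>\<^bsub>free_alg\<^esub>"

text \<open>The first letter of the alternating word of length \<open>m\<close> in \<open>1\<close> and \<open>2\<close> with last letter \<open>j\<close>.\<close>

definition first_letter :: "nat \<Rightarrow> nat \<Rightarrow> nat" where
  "first_letter j m = (if odd m then j else 3 - j)"

definition letter :: "nat \<Rightarrow> bool" where "letter i \<longleftrightarrow> i = 1 \<or> i = 2"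

lemma letter_simps [simp]: "letter 1" "letter 2" "letter (Suc 0)"
  by (auto simp: letter_def)

lemma letter_other [simp]: "letter i \<Longrightarrow> letter (3 - i)" "letter i \<Longrightarrow> 3 - (3 - i) = i"
  "letter i \<Longrightarrow> 3 - i \<noteq> i" "letter i \<Longrightarrow> i \<noteq> 3 - i"
  by (auto simp: letter_def)

lemma letter_cases: "letter i \<Longrightarrow> letter j \<Longrightarrow> j = i \<or> j = 3 - i"
  by (auto simp: letter_def)

lemma letter_first [simp]: "letter j \<Longrightarrow> letter (first_letter j m)"
  by (simp add: first_letter_def)

lemma first_letter_simps: "first_letter j 0 = 3 - j" "first_letter j (Suc 0) = j"
  "first_letter j (Suc (Suc m)) = first_letter j m"
  "letter j \<Longrightarrow> first_letter j (Suc m) = 3 - first_letter j m"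
  by (auto simp: first_letter_def)

text \<open>At a fixed length, exchanging first and last letter is an involution. It translates
  between \<open>c\<^sub>F\<close>, indexed by last letters, and \<open>t\<^sub>F\<close>, indexed
  by first letters.\<close>

lemma first_letter_first_letter: "letter j \<Longrightarrow> first_letter (first_letter j m) m = j"
  by (auto simp: first_letter_def)

lemma first_letter_pred:
  assumes "letter j" "m \<ge> 1"
  shows "first_letter j (m - 1) = 3 - first_letter j m"
  using assms by (cases m) (simp_all add: first_letter_def)

lemma first_letter_other:
  "letter j \<Longrightarrow> first_letter (3 - j) m = 3 - first_letter j m"
  by (auto simp: first_letter_def)

definition \<xi> :: "nat \<Rightarrow> free_elt" where "\<xi> i = \<one>\<^sub>F + X\<^sub>F i"

text \<open>A noncommutative Chebyshev recursion of the second kind. The index \<open>m\<close>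
  counts the letters after multiplication by \<open>\<xi> j\<close> on the right, hence the identity
  at length 1.\<close>

fun \<zeta> :: "nat \<Rightarrow> nat \<Rightarrow> free_elt" where
  "\<zeta> j 0 = 0"
| "\<zeta> j (Suc 0) = \<one>\<^sub>F"
| "\<zeta> j (Suc (Suc m)) = \<xi> (first_letter j m) \<star> \<zeta> j (Suc m) - \<q> *\<^sub>F \<zeta> j m"

text \<open>Modulo the quadratic relations, \<open>c j m\<close> is the sum of \<open>T\<^sub>w\<close> over all \<open>w\<close> below the
  alternating word of length \<open>m\<close> that ends in \<open>j\<close> (see \<open>quad_c\<close>).\<close>

definition c\<^sub>F :: "nat \<Rightarrow> nat \<Rightarrow> free_elt" where
  "c\<^sub>F j m = \<zeta> j m \<star> \<xi> j"

definition t\<^sub>F :: "nat \<Rightarrow> nat \<Rightarrow> free_elt" where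
  "t\<^sub>F i m = alt_prod i (3 - i) m"

text \<open>In a dihedral group the Bruhat order compares lengths, so this is everything strictly
  below a word of length \<open>m \<ge> 1\<close>.\<close>

definition lower_sum :: "nat \<Rightarrow> free_elt" where
  "lower_sum m = \<one>\<^sub>F + (\<Sum>l=1..<m. t\<^sub>F 1 l + t\<^sub>F 2 l)"

definition quadratic_relations :: "(free_elt \<times> free_elt) set" where
  "quadratic_relations = {(X\<^sub>F i \<star> X\<^sub>F i, (\<q> - 1) *\<^sub>F X\<^sub>F i + \<q> *\<^sub>F \<one>\<^sub>F) | i. i \<in> {1, 2}}"

lemma quadratic_relations_subset: "quadratic_relations \<subseteq> hecke_relations n"
  unfolding quadratic_relations_def hecke_relations_def by auto

lemma loop_quiver_wf: "finite (verts loop_quiver)" "wf_digraph loop_quiver"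
  by (auto simp: loop_quiver_def wf_digraph_def)

interpretation quad: presented_path_algebra loop_quiver quadratic_relations
  using quadratic_relations_subset[of 0] hecke_relations_closed[of 0]
  by unfold_locales (auto simp: loop_quiver_def wf_digraph_def)

lemma X_closed [simp, intro]: "letter i \<Longrightarrow> X\<^sub>F i \<in> carrier free_alg"
  by (rule arrow_elt_closed) (auto simp: loop_quiver_def wf_digraph_def letter_def)

lemma one_closed [simp, intro]: "\<one>\<^sub>F \<in> carrier free_alg"
  by (rule quad.A.one_closed)

lemma \<xi>_closed [simp, intro]: "letter i \<Longrightarrow> \<xi> i \<in> carrier free_alg"
  by (simp add: \<xi>_def)

lemma \<zeta>_closed [simp, intro]: "letter j \<Longrightarrow> \<zeta> j m \<in> carrier free_alg"
  by (induction j m rule: \<zeta>.induct) auto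

lemma c_closed [simp, intro]: "letter j \<Longrightarrow> c\<^sub>F j m \<in> carrier free_alg"
  by (simp add: c\<^sub>F_def)

lemma t_closed [simp, intro]: "letter i \<Longrightarrow> t\<^sub>F i m \<in> carrier free_alg"
proof (induction m arbitrary: i)
  case (Suc m)
  from Suc.IH[of "3 - i"] Suc.prems show ?case by (auto simp: t\<^sub>F_def)
qed (simp add: t\<^sub>F_def)

lemma lower_sum_closed [simp, intro]: "lower_sum m \<in> carrier free_alg"
  by (auto simp: lower_sum_def)

lemma free_one_mult [simp]:
  "f \<in> carrier free_alg \<Longrightarrow> \<one>\<^sub>F \<star> f = f" "f \<in> carrier free_alg \<Longrightarrow> f \<star> \<one>\<^sub>F = f"
  using quad.A.l_one quad.A.r_one by auto

lemma c_simps: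
  assumes "letter j"
  shows "c\<^sub>F j 0 = 0" "c\<^sub>F j (Suc 0) = \<xi> j"
  "c\<^sub>F j (Suc (Suc m)) = \<xi> (first_letter j m) \<star> c\<^sub>F j (Suc m) - \<q> *\<^sub>F c\<^sub>F j m"
  using assms by (simp_all add: c\<^sub>F_def path_algebra_expand)

lemma t_Suc: "letter i \<Longrightarrow> t\<^sub>F i (Suc m) = X\<^sub>F i \<star> t\<^sub>F (3 - i) m"
  by (simp add: t\<^sub>F_def)

lemma t_0: "t\<^sub>F i 0 = \<one>\<^sub>F"
  by (simp add: t\<^sub>F_def)

lemma t_1: "letter i \<Longrightarrow> t\<^sub>F i (Suc 0) = X\<^sub>F i"
  by (simp add: t_Suc t_0)

lemma lower_sum_Suc:
  assumes "letter i" "m \<ge> 1"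
  shows "lower_sum (Suc m) = lower_sum m + t\<^sub>F i m + t\<^sub>F (3 - i) m"
  using assms by (auto simp: lower_sum_def letter_def numeral_2_eq_2 add_ac)

lemma lower_sum_1: "lower_sum (Suc 0) = \<one>\<^sub>F"
  by (simp add: lower_sum_def)

lemma quad_X_X:
  "letter i \<Longrightarrow> quad.eqv (X\<^sub>F i \<star> X\<^sub>F i) ((\<q> - 1) *\<^sub>F X\<^sub>F i + \<q> *\<^sub>F \<one>\<^sub>F)"
  by (rule quad.eqv_relation) (auto simp: quadratic_relations_def letter_def)

lemma quad_X_t:
  assumes "letter i"
  shows "quad.eqv (X\<^sub>F i \<star> t\<^sub>F i (Suc m)) ((\<q> - 1) *\<^sub>F t\<^sub>F i (Suc m) + \<q> *\<^sub>F t\<^sub>F (3 - i) m)"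
proof -
  have "X\<^sub>F i \<star> t\<^sub>F i (Suc m) = (X\<^sub>F i \<star> X\<^sub>F i) \<star> t\<^sub>F (3 - i) m"
    using assms by (simp add: t_Suc path_algebra_mult_assoc)
  also have "quad.eqv \<dots> (((\<q> - 1) *\<^sub>F X\<^sub>F i + \<q> *\<^sub>F \<one>\<^sub>F) \<star> t\<^sub>F (3 - i) m)"
    using assms by (intro quad.eqv_mult_right quad_X_X) auto
  also have "\<dots> = (\<q> - 1) *\<^sub>F t\<^sub>F i (Suc m) + \<q> *\<^sub>F t\<^sub>F (3 - i) m"
    using assms by (simp add: t_Suc path_algebra_expand)
  finally show ?thesis .
qed

text \<open>The summands are the T_w for w below or equal to the word of length \<open>Suc m\<close>
  starting with \<open>i\<close>. They fall into pairs T_w, X_i T_w with w not starting with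
  \<open>i\<close>, and the quadratic relation makes X_i multiply the sum of such a pair by q. The
  induction adds one pair at a time.\<close>

lemma quad_X_eigen:
  assumes "letter i"
  shows "quad.eqv (X\<^sub>F i \<star> (lower_sum (Suc m) + t\<^sub>F i (Suc m))) (\<q> *\<^sub>F (lower_sum (Suc m) + t\<^sub>F i (Suc m)))"
proof (induction m)
  case 0
  have "X\<^sub>F i \<star> (lower_sum (Suc 0) + t\<^sub>F i (Suc 0)) = X\<^sub>F i + X\<^sub>F i \<star> X\<^sub>F i"
    using assms by (simp add: lower_sum_1 t_Suc t_0 path_algebra_expand)
  also have "quad.eqv \<dots> (X\<^sub>F i + ((\<q> - 1) *\<^sub>F X\<^sub>F i + \<q> *\<^sub>F \<one>\<^sub>F))"
    using assms by (intro quad.eqv_add quad.eqv_refl quad_X_X)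
  also have "\<dots> = \<q> *\<^sub>F (lower_sum (Suc 0) + t\<^sub>F i (Suc 0))"
    using assms by (simp add: lower_sum_1 t_Suc t_0 path_algebra_smult_module)
  finally show ?case .
next
  case (Suc m)
  let ?C = "\<lambda>m. lower_sum (Suc m) + t\<^sub>F i (Suc m)"
  have C: "?C (Suc m) = ?C m + (t\<^sub>F i (Suc (Suc m)) + t\<^sub>F (3 - i) (Suc m))"
    using lower_sum_Suc[OF assms, of "Suc m"] by (simp add: add_ac)
  have "X\<^sub>F i \<star> ?C (Suc m) = X\<^sub>F i \<star> ?C m + (X\<^sub>F i \<star> t\<^sub>F i (Suc (Suc m)) + t\<^sub>F i (Suc (Suc m)))"
    unfolding C using assms by (simp add: path_algebra_mult_add_right t_Suc[of i "Suc m"])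
  also have "quad.eqv \<dots> (\<q> *\<^sub>F ?C m + (((\<q> - 1) *\<^sub>F t\<^sub>F i (Suc (Suc m)) + \<q> *\<^sub>F t\<^sub>F (3 - i) (Suc m))
      + t\<^sub>F i (Suc (Suc m))))"
    using assms by (intro quad.eqv_add quad.eqv_refl quad_X_t Suc)
  also have "\<dots> = \<q> *\<^sub>F ?C (Suc m)"
    unfolding C by (simp add: path_algebra_smult_module)
  finally show ?case .
qed

text \<open>Let \<open>i\<close> be the new first letter. The sum for the shorter word splits into
  two words that T_i lengthens and the sum for the word two letters shorter, on which T_i acts as q
  by \<open>quad_X_eigen\<close>. This q multiple is exactly what the recursion of
  \<open>\<zeta>\<close> subtracts. Only quadratic relations enter, so at length n the formula can
  be used to rewrite the braid relation.\<close>

lemma quad_c: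
  assumes "letter j" "m \<ge> 1"
  shows "quad.eqv (c\<^sub>F j m) (t\<^sub>F (first_letter j m) m + lower_sum m)"
  using assms(2)
proof (induction m rule: nat_less_induct)
  case (1 m)
  consider "m = 1" | "m = 2" | k where "m = Suc (Suc (Suc k))"
    using 1(2) by (metis One_nat_def Suc_1 not0_implies_Suc not_one_le_zero)
  then show ?case
  proof cases
    case 1
    then show ?thesis
      using assms(1) by (simp add: c_simps t_Suc t_0 lower_sum_1 \<xi>_def add_ac first_letter_simps)
  next
    case 2
    have l: "letter (3 - j)" using assms(1) by simp
    then have "c\<^sub>F j 2 = t\<^sub>F (first_letter j 2) 2 + lower_sum 2"
      using assms(1) lower_sum_Suc[OF assms(1), of 1]
      by (simp add: c_simps t_Suc[of _ "Suc 0"] t_1 lower_sum_1 \<xi>_def first_letter_simps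
          numeral_2_eq_2 path_algebra_expand add_ac)
    then show ?thesis using 2 by simp
  next
    case (3 k)
    define i where "i = first_letter j (Suc k)"
    have i: "letter i" "first_letter j (Suc (Suc k)) = 3 - i" "first_letter j m = i"
      using assms(1) 3 by (simp_all add: i_def first_letter_simps)
    let ?C = "\<lambda>i m. t\<^sub>F i m + lower_sum m"
    have IH: "quad.eqv (c\<^sub>F j (Suc (Suc k))) (?C (3 - i) (Suc (Suc k)))"
      "quad.eqv (c\<^sub>F j (Suc k)) (?C i (Suc k))"
      using 1(1)[rule_format, of "Suc (Suc k)"] 1(1)[rule_format, of "Suc k"] 3 i(2)
      unfolding i_def[symmetric] by simp_all
    have lower: "lower_sum (Suc (Suc k)) = ?C i (Suc k) + t\<^sub>F (3 - i) (Suc k)"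
      using lower_sum_Suc[OF i(1), of "Suc k"] by (simp add: add_ac)
    have "c\<^sub>F j m = \<xi> i \<star> c\<^sub>F j (Suc (Suc k)) - \<q> *\<^sub>F c\<^sub>F j (Suc k)"
      using assms(1) by (simp add: 3 c_simps i_def)
    also have "quad.eqv \<dots> (\<xi> i \<star> ?C (3 - i) (Suc (Suc k)) - \<q> *\<^sub>F ?C i (Suc k))"
      using i by (intro quad.eqv_diff quad.eqv_smult quad.eqv_mult_left IH) auto
    also have "\<xi> i \<star> ?C (3 - i) (Suc (Suc k)) - \<q> *\<^sub>F ?C i (Suc k)
        = ?C (3 - i) (Suc (Suc k)) + t\<^sub>F i m + X\<^sub>F i \<star> (lower_sum (Suc k) + t\<^sub>F i (Suc k))
          + t\<^sub>F i (Suc (Suc k)) - \<q> *\<^sub>F ?C i (Suc k)"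
      using i(1) by (simp add: \<xi>_def 3 lower path_algebra_expand t_Suc[of i "Suc k"]
          t_Suc[of i "Suc (Suc k)"] del: alt_prod.simps)
    also have "quad.eqv \<dots> (?C (3 - i) (Suc (Suc k)) + t\<^sub>F i m + \<q> *\<^sub>F (lower_sum (Suc k) + t\<^sub>F i (Suc k))
          + t\<^sub>F i (Suc (Suc k)) - \<q> *\<^sub>F ?C i (Suc k))"
      using i by (intro quad.eqv_add quad.eqv_diff quad.eqv_refl quad_X_eigen)
    also have "\<dots> = ?C i m"
      using lower_sum_Suc[OF i(1), of "Suc (Suc k)"] by (simp add: 3 add_ac)
    finally show ?thesis by (simp add: i)
  qed
qed

text \<open>Modulo the quadratic relations, the braid relation says \<open>c 1 n = c 2 n\<close>.\<close>

lemma quad_braid: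
  assumes "n \<ge> 1"
  shows "quad.eqv (c\<^sub>F (first_letter 1 n) n - c\<^sub>F (first_letter 2 n) n) (alt_prod 1 2 n - alt_prod 2 1 n)"
proof -
  have "quad.eqv (c\<^sub>F (first_letter 1 n) n - c\<^sub>F (first_letter 2 n) n)
     ((t\<^sub>F 1 n + lower_sum n) - (t\<^sub>F 2 n + lower_sum n))"
    using quad_c[of "first_letter 1 n" n] quad_c[of "first_letter 2 n" n] assms
    by (intro quad.eqv_diff) (auto simp: first_letter_first_letter simp del: One_nat_def)
  then show ?thesis by (simp add: t\<^sub>F_def numeral_2_eq_2 numeral_3_eq_3)
qed

section \<open>A basis of the Hecke algebra\<close>

type_synonym coords = "nat \<times> nat \<Rightarrow> int poly"

locale dihedral_hecke =
  fixes n :: nat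
  assumes n2: "n \<ge> 2"
begin

text \<open>The basis element \<open>c j m\<close> has coordinate \<open>(j, m)\<close> for \<open>0 < m < n\<close>; the identity and
  \<open>c 1 n = c 2 n\<close> have the coordinates \<open>(0, 0)\<close> and \<open>(0, n)\<close>.\<close>

definition slots :: "(nat \<times> nat) set" where
  "slots = {(0, 0), (0, n)} \<union> {1, 2} \<times> {1..<n}"

definition slot :: "nat \<Rightarrow> nat \<Rightarrow> nat \<times> nat" where
  "slot j m = (if m = 0 \<or> m = n then (0, m) else (j, m))"

lemma finite_slots [simp]: "finite slots"
  by (simp add: slots_def)

lemma slot_in_slots: "letter j \<Longrightarrow> m \<le> n \<Longrightarrow> slot j m \<in> slots"
  by (auto simp: slots_def slot_def letter_def)

lemma slots_cases:
  assumes "b \<in> slots"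
  obtains "b = (0, 0)" | "b = (0, n)" | j m where "b = (j, m)" "letter j" "1 \<le> m" "m < n"
  using assms by (auto simp: slots_def letter_def)

definition unit_vec :: "nat \<times> nat \<Rightarrow> coords" where
  "unit_vec b = (\<lambda>b'. if b' = b then 1 else 0)"

text \<open>Left multiplication by \<open>\<xi> i\<close> and right multiplication by \<open>\<xi> j\<close> in these coordinates.\<close>

definition left_op :: "nat \<Rightarrow> coords \<Rightarrow> coords" where
  "left_op i v = (\<lambda>(j, m).
     if m = 0 \<or> m > n then 0
     else if m = n then
       (if j = 0 then (1 + \<q>) * v (0, n) + v (first_letter i n, n - 1) else 0)
     else if letter j \<and> first_letter j m = i then
       (1 + \<q>) * v (j, m) + v (slot j (m - 1)) + (if m + 1 < n then \<q> * v (j, m + 1) else 0)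
     else 0)"

definition right_op :: "nat \<Rightarrow> coords \<Rightarrow> coords" where
  "right_op i v = (\<lambda>(j, m).
     if m = 0 \<or> m > n then 0
     else if m = n then
       (if j = 0 then (1 + \<q>) * v (0, n) + v (3 - i, n - 1) else 0)
     else if letter j \<and> j = i then
       (1 + \<q>) * v (j, m) + v (slot (3 - j) (m - 1)) + (if m + 1 < n then \<q> * v (3 - j, m + 1) else 0)
     else 0)"

section \<open>Commuting left and right operators on coordinates\<close>

lemma op_linear:
  "left_op i (v + w) = left_op i v + left_op i w"
  "right_op i (v + w) = right_op i v + right_op i w"
  "left_op i (\<lambda>b. c * v b) = (\<lambda>b. c * left_op i v b)"
  "right_op i (\<lambda>b. c * v b) = (\<lambda>b. c * right_op i v b)"
  by (auto simp: left_op_def right_op_def fun_eq_iff algebra_simps)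

lemma left_op_slots:
  "left_op i v (0, 0) = 0"
  "left_op i v (0, n) = (1 + \<q>) * v (0, n) + v (first_letter i n, n - 1)"
  "letter j \<Longrightarrow> 0 < m \<Longrightarrow> m < n \<Longrightarrow> left_op i v (j, m) = (if first_letter j m = i then
     (1 + \<q>) * v (j, m) + v (slot j (m - 1)) + (if m + 1 < n then \<q> * v (j, m + 1) else 0) else 0)"
  "b \<notin> slots \<Longrightarrow> left_op i v b = 0"
  using n2 by (auto simp: left_op_def slots_def letter_def split: prod.splits)

lemma right_op_slots:
  "right_op i v (0, 0) = 0"
  "right_op i v (0, n) = (1 + \<q>) * v (0, n) + v (3 - i, n - 1)"
  "letter j \<Longrightarrow> 0 < m \<Longrightarrow> m < n \<Longrightarrow> right_op i v (j, m) = (if j = i then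
     (1 + \<q>) * v (j, m) + v (slot (3 - j) (m - 1)) + (if m + 1 < n then \<q> * v (3 - j, m + 1) else 0) else 0)"
  "b \<notin> slots \<Longrightarrow> right_op i v b = 0"
  using n2 by (auto simp: right_op_def slots_def letter_def split: prod.splits)

lemma slot_simps:
  "slot j 0 = (0, 0)" "slot j n = (0, n)" "0 < m \<Longrightarrow> m < n \<Longrightarrow> slot j m = (j, m)"
  by (auto simp: slot_def)

lemma left_op_slot_zero:
  assumes "letter j" "m < n" "first_letter j m \<noteq> i"
  shows "left_op i v (slot j m) = 0"
  using assms by (cases "m = 0") (simp_all add: slot_simps left_op_slots)

lemma right_op_slot_zero:
  assumes "letter j" "m < n" "j \<noteq> i"
  shows "right_op i v (slot j m) = 0"
  using assms by (cases "m = 0") (simp_all add: slot_simps right_op_slots)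

text \<open>The image of \<open>left_op i\<close> is supported on words starting with
  \<open>i\<close> and on the top slot. Deleting or adding a first letter changes that letter, so
  the neighbours read by a second application carry zero and only the diagonal term 1 + q
  survives.\<close>

lemma left_op_left_op:
  assumes "letter i"
  shows "left_op i (left_op i v) = (\<lambda>b. (1 + \<q>) * left_op i v b)"
proof (rule ext)
  fix b :: "nat \<times> nat"
  show "left_op i (left_op i v) b = (1 + \<q>) * left_op i v b"
  proof (cases "b \<in> slots")
    case True
    then show ?thesis
    proof (cases rule: slots_cases)
      case 2
      have "first_letter (first_letter i n) (n - 1) \<noteq> i"
        using n2 assms first_letter_pred[of "first_letter i n" n]
        by (simp add: first_letter_first_letter)
      then have "left_op i v (first_letter i n, n - 1) = 0"
        using n2 assms by (simp add: left_op_slots)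
      then show ?thesis using 2 by (simp add: left_op_slots)
    next
      case (3 j m)
      show ?thesis
      proof (cases "first_letter j m = i")
        case True
        have "left_op i v (slot j (m - 1)) = 0"
          using 3 True assms first_letter_pred[of j m] by (intro left_op_slot_zero) auto
        moreover have "left_op i v (j, m + 1) = 0" if "m + 1 < n"
          using 3 that True assms by (simp add: left_op_slots first_letter_simps)
        ultimately show ?thesis using 3 True by (simp add: left_op_slots)
      qed (use 3 in \<open>simp add: left_op_slots\<close>)
    qed (simp add: left_op_slots)
  qed (simp add: left_op_slots)
qed

text \<open>One operator changes the beginning of a word and the other its end. They interact only
  at words that start with \<open>i\<close> and end in \<open>j\<close>, and at the top slot, which
  both words of length n share.\<close>

lemma left_op_right_op:
  assumes ij: "letter i" "letter j"
  shows "left_op i (right_op j v) = right_op j (left_op i v)"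
proof (rule ext)
  fix b :: "nat \<times> nat"
  show "left_op i (right_op j v) b = right_op j (left_op i v) b"
  proof (cases "b \<in> slots")
    case True
    then show ?thesis
    proof (cases rule: slots_cases)
      case 2
      define p where "p = first_letter i n"
      have p: "letter p" "first_letter p n = i" "p = j \<or> p = 3 - j"
        using ij letter_cases by (auto simp: p_def first_letter_first_letter)
      have pred: "first_letter j (n - 1) = 3 - first_letter j n"
        "first_letter (3 - j) (n - 1) = first_letter j n"
        using ij n2 first_letter_pred[of j n] first_letter_pred[of "3 - j" n] first_letter_other[of j n] by auto
      from p(3) show ?thesis
      proof
        assume [simp]: "p = j"
        have "right_op j v (p, n - 1) = (1 + \<q>) * v (j, n - 1) + v (slot (3 - j) (n - 1 - 1))"
          using n2 ij by (simp add: right_op_slots)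
        moreover have "left_op i v (3 - j, n - 1) = (1 + \<q>) * v (3 - j, n - 1) + v (slot (3 - j) (n - 1 - 1))"
          using n2 ij p pred by (simp add: left_op_slots)
        ultimately show ?thesis
          by (simp add: 2 left_op_slots right_op_slots p_def[symmetric] algebra_simps del: \<open>p = j\<close>)
             (simp add: algebra_simps)
      next
        assume [simp]: "p = 3 - j"
        have "right_op j v (p, n - 1) = 0"
          using n2 ij by (simp add: right_op_slots)
        moreover have "first_letter j n \<noteq> i"
          using ij p first_letter_other[of j n] letter_other(4)[of "first_letter j n"] by auto
        then have "left_op i v (3 - j, n - 1) = 0"
          using n2 ij pred by (simp add: left_op_slots)
        ultimately show ?thesis
          by (simp add: 2 left_op_slots right_op_slots p_def[symmetric] algebra_simps)
      qed
    next
      case (3 k m)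
      have pred: "first_letter (3 - k) (m - 1) = first_letter k m"
        using 3 first_letter_pred[of k m] first_letter_pred[of "3 - k" m] first_letter_other[of k m] by simp
      have succ: "first_letter (3 - k) (m + 1) = first_letter k m"
        using 3 by (simp add: first_letter_other first_letter_simps)
      show ?thesis
      proof (cases "k = j \<and> first_letter k m = i")
        case False
        have "right_op j v (slot k (m - 1)) = 0" if "k \<noteq> j"
          using 3 that by (intro right_op_slot_zero) auto
        moreover have "left_op i v (slot (3 - k) (m - 1)) = 0" if "first_letter k m \<noteq> i"
          using 3 that pred by (intro left_op_slot_zero) auto
        ultimately show ?thesis
          using False 3 succ by (auto simp: left_op_slots right_op_slots)
      next
        case True
        from True have T: "k = j" "first_letter j m = i" by auto
        \<comment> \<open>Both operators at length m - 1 read the same coordinates of lengths m - 2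
          and m, so only the multiples by 1 + q get interchanged. For m = 1 both slots are (0, 0),
          where the operators vanish.\<close>
        have down: "(1 + \<q>) * v (slot (3 - k) (m - 1)) + right_op j v (slot k (m - 1))
            = (1 + \<q>) * v (slot k (m - 1)) + left_op i v (slot (3 - k) (m - 1))"
        proof (cases "m = 1")
          case True
          then show ?thesis by (simp add: slot_simps left_op_slots right_op_slots)
        next
          case False
          then show ?thesis using 3 T pred
            by (auto simp: slot_simps left_op_slots right_op_slots)
        qed
        have up: "(1 + \<q>) * v (3 - k, m + 1) + right_op j v (k, m + 1)
            = (1 + \<q>) * v (k, m + 1) + left_op i v (3 - k, m + 1)" if "m + 1 < n"
          using T 3 that succ by (simp add: slot_simps left_op_slots right_op_slots)
        have up': "(if m + 1 < n then \<q> * ((1 + \<q>) * v (3 - k, m + 1) + right_op j v (k, m + 1)) else 0)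
            = (if m + 1 < n then \<q> * ((1 + \<q>) * v (k, m + 1) + left_op i v (3 - k, m + 1)) else 0)"
          using up by simp
        have "left_op i (right_op j v) b = (1 + \<q>) * ((1 + \<q>) * v (k, m))
           + ((1 + \<q>) * v (slot (3 - k) (m - 1)) + right_op j v (slot k (m - 1)))
           + (if m + 1 < n then \<q> * ((1 + \<q>) * v (3 - k, m + 1) + right_op j v (k, m + 1)) else 0)"
          using T 3 by (simp add: left_op_slots right_op_slots(3)[of j m j v]) (simp add: algebra_simps)
        also have "\<dots> = right_op j (left_op i v) b"
          unfolding down up'
          using T 3 by (simp add: right_op_slots left_op_slots(3)[of j m i v]) (simp add: algebra_simps)
        finally show ?thesis .
      qed
    qed (simp add: left_op_slots right_op_slots)
  qed (simp add: left_op_slots right_op_slots)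
qed

text \<open>Length 0 gives zero although the slot (0, 0) is occupied by the identity. This matches
  \<open>\<zeta> j 0 = 0\<close> and makes the product rule with its term at length m - 1 valid for
  m = 1.\<close>

definition c_vec :: "nat \<Rightarrow> nat \<Rightarrow> coords" where
  "c_vec j m = (if m = 0 then 0 else unit_vec (slot j m))"

lemma left_op_unit_vec:
  assumes "letter j" "0 < m" "m < n"
  shows "left_op (3 - first_letter j m) (unit_vec (j, m))
    = c_vec j (m + 1) + (\<lambda>b. \<q> * c_vec j (m - 1) b)"
proof (rule ext)
  fix b
  let ?i = "3 - first_letter j m"
  have j0: "j \<noteq> 0" "j \<noteq> 3 - j" using assms by (auto simp: letter_def)
  have [simp]: "(1 + \<q>) * unit_vec (j, m) (0, l) = 0" for l using j0 by (simp add: unit_vec_def)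
  have succ: "?i = first_letter j (m + 1)" using assms by (simp add: first_letter_simps)
  have pred: "?i = first_letter j (m - 1)" using assms first_letter_pred by simp
  show "left_op ?i (unit_vec (j, m)) b = (c_vec j (m + 1) + (\<lambda>b. \<q> * c_vec j (m - 1) b)) b"
  proof (cases "b \<in> slots")
    case False
    then have "b \<noteq> slot j (m + 1)" "b \<noteq> slot j (m - 1)"
      using slot_in_slots[of j] assms by auto
    with False show ?thesis by (simp add: left_op_slots c_vec_def unit_vec_def)
  next
    case True
    then show ?thesis
    proof (cases rule: slots_cases)
      case 1
      then show ?thesis using assms j0 by (simp add: left_op_slots c_vec_def unit_vec_def slot_def)
    next
      case 2
      have "first_letter ?i n = j" if "n - 1 = m"
      proof -
        have "n = m + 1" using that assms by simp
        then show ?thesis unfolding succ using assms(1) by (simp only: first_letter_first_letter)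
      qed
      then show ?thesis using 2 assms j0
        by (auto simp: left_op_slots c_vec_def unit_vec_def slot_def)
    next
      case (3 k l)
      have k0: "k \<noteq> 0" using 3 by (auto simp: letter_def)
      show ?thesis
      proof (cases "k = j")
        case False
        then show ?thesis using 3 k0 assms
          by (simp add: left_op_slots c_vec_def unit_vec_def slot_def)
      next
        case True
        consider "l = m" | "l = m + 1" | "l + 1 = m" | "l \<noteq> m" "l \<noteq> m + 1" "l + 1 \<noteq> m" by blast
        then show ?thesis
        proof cases
          case 1
          then show ?thesis using True 3 k0 assms
            by (auto simp: left_op_slots c_vec_def unit_vec_def slot_def)
        next
          case 2
          then show ?thesis using True 3 k0 assms succ
            by (auto simp: left_op_slots c_vec_def unit_vec_def slot_def)
        next
          case a: 3
          then have m: "m = Suc l" by simp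
          have "first_letter j l = ?i" using pred by (simp add: m)
          moreover have "1 \<le> l" "l < n" "Suc l < n" "l - Suc 0 \<noteq> Suc l" using 3 assms m by auto
          ultimately show ?thesis using True 3(1,2) k0
            by (simp add: m left_op_slots c_vec_def unit_vec_def slot_def)
        next
          case 4
          then have "slot j (l - 1) \<noteq> (j, m)" "(j, l) \<noteq> slot j (m + 1)" "(j, l) \<noteq> slot j (m - 1)"
            using 3 by (auto simp: slot_def)
          then show ?thesis using True 3 k0 4
            by (simp add: left_op_slots c_vec_def unit_vec_def)
        qed
      qed
    qed
  qed
qed

lemma right_op_unit_vec:
  assumes "letter j" "0 < m" "m < n"
  shows "right_op j (unit_vec (3 - j, m)) = c_vec j (m + 1) + (\<lambda>b. \<q> * c_vec j (m - 1) b)"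
proof (rule ext)
  fix b
  have j0: "j \<noteq> 0" "j \<noteq> 3 - j" "3 - j \<noteq> 0" using assms by (auto simp: letter_def)
  show "right_op j (unit_vec (3 - j, m)) b = (c_vec j (m + 1) + (\<lambda>b. \<q> * c_vec j (m - 1) b)) b"
  proof (cases "b \<in> slots")
    case False
    then have "b \<noteq> slot j (m + 1)" "b \<noteq> slot j (m - 1)"
      using slot_in_slots[of j] assms by auto
    with False show ?thesis by (simp add: right_op_slots c_vec_def unit_vec_def)
  next
    case True
    then show ?thesis
    proof (cases rule: slots_cases)
      case 1
      then show ?thesis using assms j0 by (simp add: right_op_slots c_vec_def unit_vec_def slot_def)
    next
      case 2
      then show ?thesis using assms j0
        by (auto simp: right_op_slots c_vec_def unit_vec_def slot_def)
    next
      case (3 k l)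
      have k0: "k \<noteq> 0" using 3 by (auto simp: letter_def)
      show ?thesis
      proof (cases "k = j")
        case False
        then show ?thesis using 3 k0 assms
          by (simp add: right_op_slots c_vec_def unit_vec_def slot_def)
      next
        case True
        have slot_eq: "slot i l' = (i', m') \<longleftrightarrow> l' = m' \<and> i = i'"
            "(i', m') = slot i l' \<longleftrightarrow> l' = m' \<and> i = i'"
          if "0 < m'" "m' < n" for i i' l' m'
          using that by (auto simp: slot_def)
        note simps = right_op_slots c_vec_def unit_vec_def slot_eq
        consider "l = Suc m" | "m = Suc l" | "l \<noteq> Suc m" "m \<noteq> Suc l" by blast
        then show ?thesis
        proof cases
          case 1
          then show ?thesis using True 3 k0 assms j0 by (simp add: simps; linarith?)
        next
          case 2
          then show ?thesis using True 3 k0 assms j0 by (simp add: simps; linarith?)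
        next
          case a: 3
          then have "l - 1 \<noteq> m" "m - 1 \<noteq> l" using 3 assms by auto
          then show ?thesis using True 3 k0 assms(2,3) a j0 by (simp add: simps)
        qed
      qed
    qed
  qed
qed

lemma unit_op:
  assumes "letter j"
  shows "left_op j (unit_vec (0, 0)) = c_vec j (Suc 0)" "right_op j (unit_vec (0, 0)) = c_vec j (Suc 0)"
proof -
  have j0: "j \<noteq> 0" "j \<noteq> 3 - j" "3 - j \<noteq> 0" using assms by (auto simp: letter_def)
  have out: "b \<notin> slots \<Longrightarrow> b \<noteq> slot j (Suc 0)" for b using slot_in_slots[of j] n2 assms by auto
  have "left_op j (unit_vec (0, 0)) b = c_vec j (Suc 0) b
      \<and> right_op j (unit_vec (0, 0)) b = c_vec j (Suc 0) b" for b
  proof (cases "b \<in> slots")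
    case True
    then show ?thesis
      using n2 by (cases rule: slots_cases)
       (auto simp: left_op_slots right_op_slots c_vec_def unit_vec_def slot_def first_letter_def)
  qed (auto simp: left_op_slots right_op_slots c_vec_def unit_vec_def dest: out)
  then show "left_op j (unit_vec (0, 0)) = c_vec j (Suc 0)" "right_op j (unit_vec (0, 0)) = c_vec j (Suc 0)"
    by blast+
qed

text \<open>The first form mirrors the definition of \<open>c\<^sub>F\<close>. The second produces
  the same vectors by adding letters on the right, which makes the vector of the identity cyclic for
  the right operators.\<close>

lemma c_vec_rec:
  assumes "letter j" "Suc (Suc m) \<le> n"
  shows "c_vec j (Suc (Suc m)) = left_op (first_letter j m) (c_vec j (Suc m)) - (\<lambda>b. \<q> * c_vec j m b)"
    and "c_vec j (Suc (Suc m)) = right_op j (c_vec (3 - j) (Suc m)) - (\<lambda>b. \<q> * c_vec j m b)"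
  using assms left_op_unit_vec[of j "Suc m"] right_op_unit_vec[of j "Suc m"]
  by (auto simp: c_vec_def slot_def fun_eq_iff first_letter_simps)

section \<open>The regular representation and the vanishing of the Hecke relations\<close>

sublocale H: presented_path_algebra loop_quiver "hecke_relations n"
  using hecke_relations_closed[of n]
  by unfold_locales (auto simp: loop_quiver_def wf_digraph_def)

notation H.eqv (infix \<open>\<approx>\<close> 50)

text \<open>The regular representation: \<open>T\<^sub>i = \<xi> i - 1\<close> acts by \<open>left_op i - 1\<close>.\<close>

sublocale regular: arrow_action "\<lambda>c v b. c * v b" "\<lambda>i v. left_op i v - v"
  by unfold_locales (auto simp: fun_eq_iff algebra_simps op_linear)

definition regular_rep :: "free_elt \<Rightarrow> coords \<Rightarrow> coords" where
  "regular_rep f v = regular.path_act f (\<lambda>_. v) ()"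

lemma loop_one: "\<one>\<^sub>F = trivial_path ()"
  by (simp add: path_algebra_def loop_quiver_def trivial_path_def UNIV_unit)

lemma regular_rep_simps:
  "regular_rep \<one>\<^sub>F v = v"
  "regular_rep (\<xi> i) v = left_op i v"
  "regular_rep (f \<star> g) v = regular_rep f (regular_rep g v)"
  "regular_rep (f + g) v = regular_rep f v + regular_rep g v"
  "regular_rep (f - g) v = regular_rep f v - regular_rep g v"
  "regular_rep 0 v = 0"
  "regular_rep (c *\<^sub>F f) v = (\<lambda>b. c * regular_rep f v b)"
  "regular_rep f (v + w) = regular_rep f v + regular_rep f w"
  "regular_rep f 0 = 0"
  "regular_rep f (\<lambda>b. c * v b) = (\<lambda>b. c * regular_rep f v b)"
proof -
  show one: "regular_rep \<one>\<^sub>F v = v"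
    by (simp add: regular_rep_def loop_one regular.path_act_trivial)
  show add: "regular_rep (f + g) v = regular_rep f v + regular_rep g v" for f g v
    by (simp add: regular_rep_def regular.path_act_add)
  show "regular_rep (\<xi> i) v = left_op i v"
    by (simp add: \<xi>_def add one) (simp add: regular_rep_def regular.path_act_arrow loop_quiver_def)
  show "regular_rep (f \<star> g) v = regular_rep f (regular_rep g v)"
    by (simp add: regular_rep_def regular.path_act_mult)
  show "regular_rep (f - g) v = regular_rep f v - regular_rep g v"
    by (simp add: regular_rep_def regular.path_act_diff)
  show "regular_rep 0 v = 0" "regular_rep f 0 = 0"
    by (simp_all add: regular_rep_def)
  show "regular_rep (c *\<^sub>F f) v = (\<lambda>b. c * regular_rep f v b)"
    by (simp add: regular_rep_def regular.path_act_smult)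
  show "regular_rep f (v + w) = regular_rep f v + regular_rep f w"
    using regular.path_act_arg_add[of f "\<lambda>_. v" "\<lambda>_. w" "()"] by (simp add: regular_rep_def)
  show "regular_rep f (\<lambda>b. c * v b) = (\<lambda>b. c * regular_rep f v b)"
    using regular.path_act_arg_sc[of f c "\<lambda>_. v" "()"] by (simp add: regular_rep_def)
qed

lemma free_alg_induct [consumes 1, case_names add smult one xi]:
  assumes "f \<in> carrier free_alg"
    and add: "\<And>f g. f \<in> carrier free_alg \<Longrightarrow> g \<in> carrier free_alg \<Longrightarrow> P f \<Longrightarrow> P g \<Longrightarrow> P (f + g)"
    and smult: "\<And>c f. f \<in> carrier free_alg \<Longrightarrow> P f \<Longrightarrow> P (c *\<^sub>F f)"
    and one: "P \<one>\<^sub>F"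
    and xi: "\<And>i f. letter i \<Longrightarrow> f \<in> carrier free_alg \<Longrightarrow> P f \<Longrightarrow> P (\<xi> i \<star> f)"
  shows "P f"
proof -
  have "f \<in> carrier free_alg \<and> P f"
    using loop_quiver_wf(2) assms(1)
  proof (induction rule: path_algebra_induct)
    case zero
    then show ?case using smult[OF _ one, of 0] by (simp add: path_algebra_smult_module)
  next
    case (trivial v)
    then show ?case using one by (simp add: loop_one[symmetric])
  next
    case (arrow a f)
    then have a: "letter a" by (simp add: loop_quiver_def letter_def)
    have "X\<^sub>F a \<star> f = \<xi> a \<star> f + (- 1) *\<^sub>F f"
      using arrow by (simp add: \<xi>_def path_algebra_expand)
    then show ?case using arrow add[of "\<xi> a \<star> f" "(- 1) *\<^sub>F f"] a xi smult by auto
  qed (use add smult in auto)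
  then show ?thesis ..
qed

lemma regular_rep_right_op:
  assumes "f \<in> carrier free_alg" "letter j"
  shows "regular_rep f (right_op j v) = right_op j (regular_rep f v)"
  using assms(1)
  by (induction f rule: free_alg_induct)
     (simp_all only: regular_rep_simps op_linear left_op_right_op assms(2))

lemma regular_rep_c:
  assumes "letter j" "m \<le> n"
  shows "regular_rep (c\<^sub>F j m) (unit_vec (0, 0)) = c_vec j m"
  using assms
  by (induction j m rule: \<zeta>.induct)
     (simp_all add: c_simps regular_rep_simps unit_op c_vec_rec(1) c_vec_def[of _ 0])

text \<open>Coordinate functions may be nonzero outside \<open>slots\<close>, and the identity of
  the algebra preserves such values. The relations have to act as zero on all functions, so this
  part is split off and treated by itself.\<close>

lemma coords_expand:
  "v = (\<lambda>b. if b \<in> slots then 0 else v b) + (\<Sum>b\<in>slots. (\<lambda>b'. v b * unit_vec b b'))"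
proof (rule ext)
  fix b
  have "(\<Sum>b'\<in>slots. (\<lambda>b''. v b' * unit_vec b' b'')) b = (\<Sum>b'\<in>slots. v b' * unit_vec b' b)"
    by (induction rule: infinite_finite_induct[of _ slots]) simp_all
  also have "\<dots> = (\<Sum>b'\<in>slots. if b' = b then v b else 0)"
    by (intro sum.cong refl) (auto simp: unit_vec_def)
  also have "\<dots> = (if b \<in> slots then v b else 0)"
    by simp
  finally show "v b = ((\<lambda>b. if b \<in> slots then 0 else v b) + (\<Sum>b\<in>slots. (\<lambda>b'. v b * unit_vec b b'))) b"
    by simp
qed

lemma left_op_off_slots:
  assumes "letter i" "\<And>b. b \<in> slots \<Longrightarrow> v b = 0"
  shows "left_op i v = 0"
proof (rule ext)
  fix b
  have z: "v (slot j m) = 0" if "letter j" "m \<le> n" for j m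
    using assms(2) slot_in_slots that by blast
  show "left_op i v b = 0 b"
  proof (cases "b \<in> slots")
    case True
    then show ?thesis
    proof (cases rule: slots_cases)
      case 2
      then show ?thesis
        using z[of "first_letter i n" "n - 1"] z[of 1 n] assms(1) n2
        by (simp add: left_op_slots slot_simps)
    next
      case (3 j m)
      have "v (j, m) = 0" "v (slot j (m - 1)) = 0" "m + 1 < n \<Longrightarrow> v (j, m + 1) = 0"
        using z[of j m] z[of j "m - 1"] z[of j "m + 1"] 3 by (auto simp: slot_simps)
      then show ?thesis using 3 by (simp add: left_op_slots)
    qed (simp add: left_op_slots)
  qed (simp add: left_op_slots)
qed

text \<open>The operator of \<open>c 1 n - c 2 n\<close> commutes with the right operators and kills the cyclic
  vector \<open>unit_vec (0, 0)\<close>, hence it vanishes.\<close>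

lemma regular_rep_braid:
  "regular_rep (c\<^sub>F (first_letter 1 n) n - c\<^sub>F (first_letter 2 n) n) v = 0"
proof -
  let ?D = "c\<^sub>F (first_letter 1 n) n - c\<^sub>F (first_letter 2 n) n"
  have l: "letter (first_letter 1 n)" "letter (first_letter 2 n)" by simp_all
  have D: "?D \<in> carrier free_alg" using l by blast
  have unit: "regular_rep ?D (unit_vec (0, 0)) = 0"
    using n2 regular_rep_c[OF l(1) order_refl] regular_rep_c[OF l(2) order_refl]
    by (simp add: regular_rep_simps c_vec_def slot_simps del: One_nat_def)
  have right: "regular_rep ?D (right_op j w) = 0" if "regular_rep ?D w = 0" "letter j" for w j
    using regular_rep_right_op[OF D that(2), of w] that(1) op_linear(4)[of j 0 0]
    by (simp add: zero_fun_def)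
  have sc: "regular_rep ?D (\<lambda>b. a * w b) = 0" if "regular_rep ?D w = 0" for a w
    using regular_rep_simps(10)[of ?D a w] that by (simp add: zero_fun_def)
  have diff: "regular_rep ?D (w - w') = 0" if "regular_rep ?D w = 0" "regular_rep ?D w' = 0" for w w'
  proof -
    have "regular_rep ?D (w + (\<lambda>b. (- 1) * w' b)) = 0"
      using sc[OF that(2), of "- 1"] that(1) unfolding regular_rep_simps(8) by simp
    moreover have "w + (\<lambda>b. (- 1) * w' b) = w - w'" by auto
    ultimately show ?thesis by simp
  qed
  \<comment> \<open>The recursion \<open>c_vec_rec(2)\<close> reaches each of these vectors from the
    vector of the identity by right operators, scalings and differences, all of which preserve the
    kernel of \<open>?D\<close>.\<close>
  have c: "regular_rep ?D (c_vec j m) = 0" if "letter j" "m \<le> n" for j m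
    using that
  proof (induction m arbitrary: j rule: nat_less_induct)
    case (1 m)
    consider "m = 0" | "m = Suc 0" | k where "m = Suc (Suc k)" by (metis not0_implies_Suc)
    then show ?case
    proof cases
      case 1
      then have "c_vec j m = 0" by (simp add: c_vec_def)
      then show ?thesis using regular_rep_simps(9)[of ?D] by (simp only:)
    next
      case 2
      then show ?thesis using right[OF unit, of j] 1(2) by (simp only: unit_op(2))
    next
      case (3 k)
      have le: "Suc (Suc k) \<le> n" using 1(3) 3 by simp
      have "regular_rep ?D (c_vec (3 - j) (Suc k)) = 0" "regular_rep ?D (c_vec j k) = 0"
        by (rule 1(1)[rule_format]; use 1(2) 3 le in simp)+
      then show ?thesis unfolding 3 c_vec_rec(2)[OF 1(2) le] by (intro diff sc right 1(2))
    qed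
  qed
  have basis: "regular_rep ?D (unit_vec b) = 0" if "b \<in> slots" for b
    using that
  proof (cases rule: slots_cases)
    case 2
    then show ?thesis using c[of 1 n] n2 by (auto simp: c_vec_def slot_def)
  next
    case (3 j m)
    then show ?thesis using c[of j m] by (auto simp: c_vec_def slot_def)
  qed (use unit in simp)
  have sum: "regular_rep ?D (\<Sum>b\<in>S. (\<lambda>b'. v b * unit_vec b b')) = 0" if "S \<subseteq> slots" for S
    using finite_subset[OF that finite_slots] that
  proof (induction S rule: finite_induct)
    case (insert b S)
    then have "regular_rep ?D (\<lambda>b'. v b * unit_vec b b') = 0" by (intro sc basis) auto
    moreover have "regular_rep ?D (\<Sum>b\<in>S. (\<lambda>b'. v b * unit_vec b b')) = 0"
      by (rule insert.IH) (use insert.prems in blast)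
    ultimately show ?case
      by (simp only: sum.insert[OF insert.hyps] regular_rep_simps(8) add_0)
  qed (simp only: regular_rep_simps(9) sum.empty)
  \<comment> \<open>Each term of \<open>?D\<close> has a factor \<open>\<xi> j\<close> at its right
    end, which already annihilates values outside \<open>slots\<close>.\<close>
  have "regular_rep ?D (\<lambda>b. if b \<in> slots then 0 else v b) = 0"
    using l by (simp add: regular_rep_simps c\<^sub>F_def left_op_off_slots del: One_nat_def)
  then show ?thesis
    by (subst coords_expand) (simp only: regular_rep_simps(8) sum[OF subset_refl] add_0_left)
qed

lemma quad_I_subset: "quad.I \<subseteq> H.I"
  using quadratic_relations_subset[of n] H.eqv_relation H.I_ideal
  by (intro quad.I_minimal) (auto simp: H.eqv_def)

text \<open>The elements acting as zero form a two-sided ideal, so testing the defining relations is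
  enough. The quadratic ones are \<open>left_op_left_op\<close>. Modulo these the braid relation is
  the difference \<open>?D\<close>, which \<open>regular_rep_braid\<close> disposes of.\<close>

lemma regular_rep_ideal:
  assumes "f \<in> H.I"
  shows "regular_rep f v = 0"
proof -
  define J where "J = {f \<in> carrier free_alg. \<forall>v. regular_rep f v = 0}"
  have J: "ideal J free_alg"
  proof (rule path_algebra_idealI)
    have neg: "- f = (- 1) *\<^sub>F f" for f by (simp add: path_algebra_smult_module)
    show "- f \<in> J" if "f \<in> J" for f
      using that unfolding J_def neg by (simp add: regular_rep_simps zero_fun_def)
  qed (auto simp: J_def loop_quiver_wf regular_rep_simps)
  have quad: "quad.I \<subseteq> J"
  proof (rule quad.I_minimal[OF J])
    fix l r assume "(l, r) \<in> quadratic_relations"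
    then obtain i where i: "letter i" "l = X\<^sub>F i \<star> X\<^sub>F i" "r = (\<q> - 1) *\<^sub>F X\<^sub>F i + \<q> *\<^sub>F \<one>\<^sub>F"
      by (auto simp: quadratic_relations_def letter_def)
    have "X\<^sub>F i = \<xi> i - \<one>\<^sub>F" by (simp add: \<xi>_def)
    then have X: "regular_rep (X\<^sub>F i) v = left_op i v - v" for v
      by (simp add: regular_rep_simps)
    have "left_op i (- v) = - left_op i v" for v
      using op_linear(3)[of i "- 1" v] by (simp add: fun_Compl_def)
    then have minus: "left_op i (v - w) = left_op i v - left_op i w" for v w
      using op_linear(1)[of i v "- w"] by simp
    have "regular_rep (l - r) v = 0" for v
      unfolding i by (simp add: regular_rep_simps X minus left_op_left_op i(1))
        (simp add: fun_eq_iff algebra_simps)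
    then show "l - r \<in> J" using i by (auto simp: J_def)
  qed
  have "H.I \<subseteq> J"
  proof (rule H.I_minimal[OF J])
    fix l r assume "(l, r) \<in> hecke_relations n"
    then consider "(l, r) \<in> quadratic_relations" | "l = alt_prod 1 2 n" "r = alt_prod 2 1 n"
      unfolding hecke_relations_def quadratic_relations_def by auto
    then show "l - r \<in> J"
    proof cases
      case 1
      then show ?thesis using quad.eqv_relation quad by (auto simp: quad.eqv_def)
    next
      case 2
      let ?D = "c\<^sub>F (first_letter 1 n) n - c\<^sub>F (first_letter 2 n) n"
      have "?D - (l - r) \<in> J"
        using quad_braid[of n] quad n2 2 by (auto simp: quad.eqv_def)
      then have "regular_rep (?D - (l - r)) v = 0" for v by (simp add: J_def)
      then have "regular_rep (l - r) v = 0" for v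
        using regular_rep_braid[of v] unfolding regular_rep_simps(5)[of ?D] by simp
      moreover have "l - r \<in> carrier free_alg"
        using hecke_relations_closed[of n] \<open>(l, r) \<in> hecke_relations n\<close> by auto
      ultimately show ?thesis by (simp add: J_def)
    qed
  qed
  then show ?thesis using assms by (auto simp: J_def)
qed

section \<open>Coordinates, independence and spanning\<close>

definition coord :: "free_elt \<Rightarrow> coords" where
  "coord f = regular_rep f (unit_vec (0, 0))"

definition basis_elt :: "nat \<times> nat \<Rightarrow> free_elt" where
  "basis_elt = (\<lambda>(j, m). if m = 0 then \<one>\<^sub>F else c\<^sub>F (if m = n then 1 else j) m)"

lemma coord_simps:
  "coord \<one>\<^sub>F = unit_vec (0, 0)"
  "coord 0 = 0"
  "coord (f + g) = coord f + coord g"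
  "coord (f - g) = coord f - coord g"
  "coord (a *\<^sub>F f) = (\<lambda>b. a * coord f b)"
  "coord (\<xi> i \<star> f) = left_op i (coord f)"
  by (simp_all add: coord_def regular_rep_simps)

text \<open>On the vector of the identity, \<open>\<xi> j\<close> acts like the right operator of
  \<open>j\<close>, and the right operator can then be moved past the action of
  \<open>f\<close>.\<close>

lemma coord_mult_xi:
  assumes "letter j" "f \<in> carrier free_alg"
  shows "coord (f \<star> \<xi> j) = right_op j (coord f)"
  using assms by (simp add: coord_def regular_rep_simps unit_op[symmetric])
    (simp add: unit_op regular_rep_right_op[symmetric])

lemma coord_eqv: "f \<approx> g \<Longrightarrow> coord f = coord g"
  using regular_rep_ideal[of "f - g"] by (simp add: H.eqv_def coord_def regular_rep_simps)

lemma coord_c: "letter j \<Longrightarrow> m \<le> n \<Longrightarrow> coord (c\<^sub>F j m) = c_vec j m"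
  by (simp add: coord_def regular_rep_c)

lemma coord_basis_elt: "b \<in> slots \<Longrightarrow> coord (basis_elt b) = unit_vec b"
  using n2 by (erule_tac slots_cases) (auto simp: basis_elt_def coord_simps coord_c c_vec_def slot_def)

lemma basis_elt_closed [simp, intro]: "b \<in> slots \<Longrightarrow> basis_elt b \<in> carrier free_alg"
  by (erule slots_cases) (auto simp: basis_elt_def)

lemma xi_xi: "letter i \<Longrightarrow> \<xi> i \<star> \<xi> i \<approx> (1 + \<q>) *\<^sub>F \<xi> i"
proof -
  assume i: "letter i"
  have "\<xi> i \<star> \<xi> i - (1 + \<q>) *\<^sub>F \<xi> i = X\<^sub>F i \<star> X\<^sub>F i - ((\<q> - 1) *\<^sub>F X\<^sub>F i + \<q> *\<^sub>F \<one>\<^sub>F)"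
    using i by (simp add: \<xi>_def path_algebra_expand)
  then show ?thesis
    using quad_X_X[OF i] quad_I_subset by (auto simp: H.eqv_def quad.eqv_def)
qed

lemma c_xi: "letter j \<Longrightarrow> c\<^sub>F j m \<star> \<xi> j \<approx> (1 + \<q>) *\<^sub>F c\<^sub>F j m"
proof -
  assume j: "letter j"
  have "c\<^sub>F j m \<star> \<xi> j = \<zeta> j m \<star> (\<xi> j \<star> \<xi> j)" by (simp add: c\<^sub>F_def path_algebra_mult_assoc)
  also have "\<dots> \<approx> \<zeta> j m \<star> ((1 + \<q>) *\<^sub>F \<xi> j)" using j by (intro H.eqv_mult_left xi_xi) auto
  finally show ?thesis by (simp add: c\<^sub>F_def path_algebra_mult_smult)
qed

text \<open>The right-hand counterpart \<open>c_xi\<close> is visible from the factor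
  \<open>\<xi> j\<close>, but on the left the recursion is needed: its leading term starts with the
  letter in question, and so does the word two letters shorter.\<close>

lemma xi_c:
  assumes "letter j" "m \<ge> 1"
  shows "\<xi> (first_letter j m) \<star> c\<^sub>F j m \<approx> (1 + \<q>) *\<^sub>F c\<^sub>F j m"
  using assms
proof (induction j m rule: \<zeta>.induct)
  case (2 j)
  then show ?case by (simp add: c_simps first_letter_simps xi_xi)
next
  case (3 j m)
  let ?i = "first_letter j m"
  have i: "letter ?i" using 3 by simp
  have IH: "\<xi> ?i \<star> c\<^sub>F j m \<approx> (1 + \<q>) *\<^sub>F c\<^sub>F j m"
    using 3 by (cases "m = 0") (simp_all add: c_simps path_algebra_smult_module)
  have "\<xi> ?i \<star> c\<^sub>F j (Suc (Suc m)) = (\<xi> ?i \<star> \<xi> ?i) \<star> c\<^sub>F j (Suc m) - \<q> *\<^sub>F (\<xi> ?i \<star> c\<^sub>F j m)"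
    using 3 by (simp add: c_simps path_algebra_expand)
  also have "\<dots> \<approx> ((1 + \<q>) *\<^sub>F \<xi> ?i) \<star> c\<^sub>F j (Suc m) - \<q> *\<^sub>F ((1 + \<q>) *\<^sub>F c\<^sub>F j m)"
    using 3 i by (intro H.eqv_diff H.eqv_smult H.eqv_mult_right xi_xi IH) auto
  also have "\<dots> = (1 + \<q>) *\<^sub>F c\<^sub>F j (Suc (Suc m))"
    unfolding c_simps(3)[OF \<open>letter j\<close>] by (simp add: path_algebra_expand algebra_simps)
  finally show ?case by (simp add: first_letter_simps)
qed simp

lemma xi_c_other:
  assumes "letter j" "m \<ge> 1"
  shows "\<xi> (3 - first_letter j m) \<star> c\<^sub>F j m = c\<^sub>F j (m + 1) + \<q> *\<^sub>F c\<^sub>F j (m - 1)"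
proof -
  obtain k where "m = Suc k" using assms by (cases m) auto
  then show ?thesis using assms by (simp add: c_simps first_letter_simps)
qed

lemma c_top: "letter i \<Longrightarrow> letter j \<Longrightarrow> c\<^sub>F i n \<approx> c\<^sub>F j n"
proof -
  have "(alt_prod 1 2 n, alt_prod 2 1 n) \<in> hecke_relations n" by (simp add: hecke_relations_def)
  then have "alt_prod 1 2 n - alt_prod 2 1 n \<in> H.I" using H.eqv_relation by (simp add: H.eqv_def)
  then have "c\<^sub>F (first_letter 1 n) n - c\<^sub>F (first_letter 2 n) n \<in> H.I"
    using quad_braid[of n] quad_I_subset n2 H.I_add[of "c\<^sub>F (first_letter 1 n) n - c\<^sub>F (first_letter 2 n) n
       - (alt_prod 1 2 n - alt_prod 2 1 n)" "alt_prod 1 2 n - alt_prod 2 1 n"]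
    by (auto simp: quad.eqv_def)
  then have "c\<^sub>F (first_letter 1 n) n \<approx> c\<^sub>F (first_letter 2 n) n" by (simp add: H.eqv_def)
  moreover have "first_letter 1 n = 1 \<and> first_letter 2 n = 2 \<or> first_letter 1 n = 2 \<and> first_letter 2 n = 1"
    by (auto simp: first_letter_def)
  ultimately have "c\<^sub>F 1 n \<approx> c\<^sub>F 2 n" using H.eqv_sym by auto
  moreover assume "letter i" "letter j"
  ultimately show ?thesis using H.eqv_sym by (auto simp: letter_def)
qed

abbreviation spanned :: "free_elt \<Rightarrow> bool" where
  "spanned \<equiv> H.in_span basis_elt slots"

lemma spanned_basis: "b \<in> slots \<Longrightarrow> spanned (basis_elt b)"
  by (rule H.in_span_base[OF finite_slots])

lemma spanned_c: assumes "letter j" "m \<le> n" shows "spanned (c\<^sub>F j m)"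
proof -
  consider "m = 0" | "m = n" | "1 \<le> m" "m < n" using assms by linarith
  then show ?thesis
  proof cases
    case 1
    then show ?thesis by (simp add: c\<^sub>F_def H.in_span_zero)
  next
    case 2
    have "spanned (c\<^sub>F 1 n)" using spanned_basis[of "(0, n)"] n2 by (simp add: basis_elt_def slots_def)
    from H.in_span_eqv[OF this c_top[OF assms(1) letter_simps(1)]] show ?thesis using 2 by simp
  next
    case 3
    then show ?thesis using spanned_basis[of "(j, m)"] assms
      by (auto simp: basis_elt_def slots_def letter_def)
  qed
qed

text \<open>For lengths below n the product rule stays within lengths up to n. At length n,
  multiplying by the wrong letter would lead to length n + 1, so the top element is first replaced
  by the congruent one whose word starts with \<open>i\<close>.\<close>

lemma spanned_xi_basis:
  assumes "letter i" "b \<in> slots"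
  shows "spanned (\<xi> i \<star> basis_elt b)"
proof -
  have c: "spanned (\<xi> i \<star> c\<^sub>F j m)" if "letter j" "1 \<le> m" "m < n \<or> first_letter j m = i" "m \<le> n" for j m
  proof (cases "first_letter j m = i")
    case True
    then show ?thesis
      using xi_c[of j m] that H.in_span_eqv[OF H.in_span_smult[OF spanned_c]] by auto
  next
    case False
    then have "i = 3 - first_letter j m" using letter_cases[of "first_letter j m" i] assms that by auto
    then show ?thesis
      using xi_c_other[of j m] that H.in_span_add[OF spanned_c H.in_span_smult[OF spanned_c]] by auto
  qed
  show ?thesis using assms(2)
  proof (cases rule: slots_cases)
    case 1
    then show ?thesis using spanned_c[of i 1] assms n2 by (simp add: basis_elt_def c_simps)
  next
    case 2
    let ?p = "first_letter i n"
    have "spanned (\<xi> i \<star> c\<^sub>F ?p n)"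
      using c[of ?p n] assms n2 by (simp add: first_letter_first_letter)
    moreover have "\<xi> i \<star> c\<^sub>F 1 n \<approx> \<xi> i \<star> c\<^sub>F ?p n"
      using assms by (intro H.eqv_mult_left c_top) auto
    ultimately show ?thesis using 2 n2 H.in_span_eqv by (auto simp: basis_elt_def)
  next
    case (3 j m)
    then show ?thesis using c[of j m] by (simp add: basis_elt_def)
  qed
qed

lemma spanned_all: "f \<in> carrier free_alg \<Longrightarrow> spanned f"
proof (induction f rule: free_alg_induct)
  case one
  show ?case using spanned_basis[of "(0, 0)"] by (simp add: basis_elt_def slots_def)
next
  case (xi i f)
  then obtain v where v: "f \<approx> (\<Sum>b\<in>slots. v b *\<^sub>F basis_elt b)" by (auto simp: H.in_span_def)
  have "\<xi> i \<star> f \<approx> \<xi> i \<star> (\<Sum>b\<in>slots. v b *\<^sub>F basis_elt b)"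
    using xi by (intro H.eqv_mult_left v) auto
  also have "\<dots> = (\<Sum>b\<in>slots. v b *\<^sub>F (\<xi> i \<star> basis_elt b))"
    by (simp add: path_algebra_mult_sum_right path_algebra_mult_smult)
  finally show ?case
    by (rule H.in_span_eqv[rotated]) (intro H.in_span_sum H.in_span_smult spanned_xi_basis xi(1))
qed (auto intro: H.in_span_add H.in_span_smult)

text \<open>Taking coordinates recovers the coefficients of a combination, so the spanning family is
  linearly independent in the quotient.\<close>

lemma coord_sum_basis:
  assumes "f \<approx> (\<Sum>b\<in>slots. v b *\<^sub>F basis_elt b)" "b \<in> slots"
  shows "coord f b = v b"
proof -
  have "coord (\<Sum>b\<in>S. v b *\<^sub>F basis_elt b) b' = (\<Sum>b\<in>S. v b * unit_vec b b')" if "S \<subseteq> slots" for S b'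
    using finite_subset[OF that finite_slots] that
    by (induction S rule: finite_induct) (simp_all add: coord_simps coord_basis_elt)
  then have "coord f b = (\<Sum>b'\<in>slots. v b' * unit_vec b' b)"
    using coord_eqv[OF assms(1)] by auto
  also have "\<dots> = (\<Sum>b'\<in>slots. if b' = b then v b else 0)"
    by (intro sum.cong refl) (auto simp: unit_vec_def)
  also have "\<dots> = v b" using assms(2) by simp
  finally show ?thesis .
qed

lemma eqv_coord_sum:
  assumes "f \<in> carrier free_alg"
  shows "f \<approx> (\<Sum>b\<in>slots. coord f b *\<^sub>F basis_elt b)"
proof -
  obtain v where v: "f \<approx> (\<Sum>b\<in>slots. v b *\<^sub>F basis_elt b)"
    using spanned_all[OF assms] by (auto simp: H.in_span_def)
  then show ?thesis using coord_sum_basis[OF v] by simp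
qed

end

section \<open>The elements \<open>x\<^sub>I\<close>\<close>

fun alt_word :: "nat \<Rightarrow> nat \<Rightarrow> nat list" where
  "alt_word i 0 = []"
| "alt_word i (Suc m) = i # alt_word (3 - i) m"

lemma alt_word_lists: "letter i \<Longrightarrow> alt_word i m \<in> lists {1, 2}"
  by (induction i m rule: alt_word.induct) (auto simp: letter_def)

lemma length_alt_word [simp]: "length (alt_word i m) = m"
  by (induction i m rule: alt_word.induct) auto

lemma word_prod_Cons: "word_prod n (i # is) = simple_refl i \<otimes>\<^bsub>dihedral n\<^esub> word_prod n is"
  by (simp add: word_prod_def)

lemma word_prod_Nil: "word_prod n [] = (0, False)"
  by (simp add: word_prod_def dihedral_def)

text \<open>The product of the two generators is the rotation by -1 when generator 1 stands on the
  left, and by 1 otherwise, so an alternating word rotates by half its length; a remaining letter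
  makes it a reflection.\<close>

lemma word_prod_alt_word:
  assumes "letter i"
  shows "word_prod n (alt_word i m) =
    (if even m then (if i = 1 then - int (m div 2) else int (m div 2)) mod int n
     else (if i = 1 then - int (m div 2) else int (m div 2) + 1) mod int n, odd m)"
  using assms
proof (induction i m rule: alt_word.induct)
  case (2 i m)
  have IH: "word_prod n (alt_word (3 - i) m) =
    (if even m then (if 3 - i = 1 then - int (m div 2) else int (m div 2)) mod int n
     else (if 3 - i = 1 then - int (m div 2) else int (m div 2) + 1) mod int n, odd m)"
    using 2 by simp
  have "i = 1 \<or> i = 2" using 2 by (simp add: letter_def)
  moreover have "int (Suc m div 2) = (if even m then int (m div 2) else int (m div 2) + 1)"
    by (auto elim!: evenE oddE)
  ultimately show ?case
    unfolding alt_word.simps word_prod_Cons IH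
    by (cases "even m") (auto simp: simple_refl_def dihedral_def mod_simps algebra_simps)
qed (simp add: word_prod_Nil)

lemma word_prod_closed:
  assumes "n \<ge> 2" "is \<in> lists {1, 2}"
  shows "word_prod n is \<in> carrier (dihedral n)"
  using assms(2)
proof (induction "is")
  case (Cons i "is")
  then show ?case using assms(1) by (cases "word_prod n is") (auto simp: word_prod_Cons dihedral_def simple_refl_def)
qed (use assms(1) in \<open>simp add: word_prod_Nil dihedral_def\<close>)

lemma simple_refl_cancel:
  assumes "w \<in> carrier (dihedral n)"
  shows "simple_refl i \<otimes>\<^bsub>dihedral n\<^esub> (simple_refl i \<otimes>\<^bsub>dihedral n\<^esub> w) = w"
  using assms by (cases w) (auto simp: dihedral_def simple_refl_def mod_simps)

text \<open>A word that does not alternate has two equal neighbours, which cancel in the group.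
  Consequently reduced words alternate.\<close>

lemma alt_word_or_shorter:
  assumes "n \<ge> 2" "is \<in> lists {1, 2}"
  shows "(\<exists>i. letter i \<and> is = alt_word i (length is)) \<or>
    (\<exists>js\<in>lists {1, 2}. length js < length is \<and> word_prod n js = word_prod n is)"
  using assms(2)
proof (induction "is")
  case Nil
  then show ?case by (auto intro!: exI[of _ 1])
next
  case (Cons i "is")
  have i: "letter i" and is_lists: "is \<in> lists {1, 2}" using Cons by (auto simp: letter_def)
  from Cons.IH show ?case
  proof (elim disjE exE bexE conjE)
    fix js assume "js \<in> lists {1, 2}" "length js < length is" "word_prod n js = word_prod n is"
    then show ?case using Cons
      by (intro disjI2 bexI[of _ "i # js"]) (auto simp: word_prod_Cons)
  next
    fix k assume k: "letter k" "is = alt_word k (length is)"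
    show ?case
    proof (cases "is")
      case Nil
      then show ?thesis using i by auto
    next
      case (Cons l ls)
      have l: "l = k" "ls = alt_word (3 - k) (length ls)" using k(2) by (simp_all add: Cons)
      have ls: "ls \<in> lists {1, 2}" using is_lists Cons by simp
      show ?thesis
      proof (cases "i = k")
        case True
        then have "word_prod n (i # is) = word_prod n ls"
          using l Cons simple_refl_cancel[OF word_prod_closed[OF assms(1) ls]]
          by (simp add: word_prod_Cons)
        then show ?thesis using ls Cons by (intro disjI2 bexI[of _ ls]) auto
      next
        case False
        then have "k = 3 - i" using letter_cases[OF i k(1)] by auto
        then have "i # is = alt_word i (length (i # is))" using k(2) by simp
        then show ?thesis using i by blast
      qed
    qed
  qed
qed

definition free_prod :: "nat list \<Rightarrow> free_elt" where
  "free_prod is = foldr (\<lambda>i f. X\<^sub>F i \<star> f) is \<one>\<^sub>F"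

lemma free_prod_alt_word: "letter i \<Longrightarrow> free_prod (alt_word i m) = t\<^sub>F i m"
  by (induction i m rule: alt_word.induct) (simp_all add: free_prod_def t_0 t_Suc)

context dihedral_hecke
begin

section \<open>Reduced words and the standard basis elements\<close>

definition word_index :: "(nat \<times> nat) set" where
  "word_index = insert (1, 0) (insert (1, n) ({1, 2} \<times> {1..<n}))"

definition alt_elt :: "nat \<times> nat \<Rightarrow> int \<times> bool" where
  "alt_elt = (\<lambda>(i, m). word_prod n (alt_word i m))"

text \<open>Every element is reached by an alternating word starting with 2 or with 1, according to
  the direction of rotation that needs fewer letters; a tie occurs only at length n and is resolved
  in favour of 1.\<close>

lemma alt_elt_surj: "carrier (dihedral n) \<subseteq> alt_elt ` word_index"
proof
  fix w assume "w \<in> carrier (dihedral n)"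
  then obtain k e where w: "w = (int k, e)" "k < n"
    by (auto simp: dihedral_def) (metis nat_0_le nat_less_iff zero_le_imp_eq_int)
  have neg: "- int (n - k) mod int n = int k"
  proof -
    have "- int (n - k) = int k + (- 1) * int n" using w(2) by simp
    then show ?thesis using w(2) by (simp only: mod_mult_self1) simp
  qed
  have mem: "alt_elt (i, m) \<in> alt_elt ` word_index" if "letter i" "1 \<le> m" "m < n \<or> (i, m) = (1, n)" for i m
    using that by (intro imageI) (auto simp: word_index_def letter_def)
  show "w \<in> alt_elt ` word_index"
  proof (cases e)
    case False
    consider "k = 0" | "1 \<le> k" "2 * k < n" | "n \<le> 2 * k" by linarith
    then show ?thesis
    proof cases
      case 1
      then have "alt_elt (1, 0) = w" using False w by (simp add: alt_elt_def word_prod_Nil)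
      then show ?thesis by (auto simp: word_index_def)
    next
      case 2
      have "alt_elt (2, 2 * k) = w" using False w 2 by (simp add: alt_elt_def word_prod_alt_word)
      then show ?thesis using mem[of 2 "2 * k"] 2 by simp
    next
      case 3
      have "alt_elt (1, 2 * (n - k)) = w"
        using False w neg by (simp add: alt_elt_def word_prod_alt_word)
      then show ?thesis using mem[of 1 "2 * (n - k)"] 3 w(2) by (cases "2 * (n - k) = n") auto
    qed
  next
    case True
    consider "k = 0" | "1 \<le> k" "2 * k - 1 < n" | "n \<le> 2 * k - 1" by linarith
    then show ?thesis
    proof cases
      case 1
      then have "alt_elt (1, 1) = w" using True w by (simp add: alt_elt_def word_prod_alt_word del: One_nat_def)
      then show ?thesis using mem[of 1 1] n2 by simp
    next
      case 2
      have "(2 * k - 1) div 2 = k - 1" "odd (2 * k - 1)" using 2 by auto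
      then have "alt_elt (2, 2 * k - 1) = w"
        using True w 2 by (simp add: alt_elt_def word_prod_alt_word of_nat_diff)
      then show ?thesis using mem[of 2 "2 * k - 1"] 2 by simp
    next
      case 3
      have "alt_elt (1, 2 * (n - k) + 1) = w"
        using True w neg by (simp add: alt_elt_def word_prod_alt_word del: One_nat_def alt_word.simps)
      then show ?thesis using mem[of 1 "2 * (n - k) + 1"] 3 w(2) by (cases "2 * (n - k) + 1 = n") auto
    qed
  qed
qed

lemma alt_elt_image: "alt_elt ` word_index = carrier (dihedral n)"
proof
  show "alt_elt ` word_index \<subseteq> carrier (dihedral n)"
    using word_prod_closed[OF n2 alt_word_lists] word_prod_closed[OF n2, of "[]"]
    by (auto simp: alt_elt_def word_index_def letter_def simp del: One_nat_def)
qed (rule alt_elt_surj)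

lemma finite_word_index [simp]: "finite word_index"
  by (simp add: word_index_def)

text \<open>There are 2 n index pairs and 2 n group elements, so surjectivity forces
  injectivity.\<close>

lemma alt_elt_inj: "inj_on alt_elt word_index"
proof (rule eq_card_imp_inj_on)
  have "card word_index = 2 * n"
    using n2 by (auto simp: word_index_def card_cartesian_product)
  moreover have "card (carrier (dihedral n)) = 2 * n"
    using dihedral_group(2)[of n] n2 by (simp add: order_def)
  ultimately show "card (alt_elt ` word_index) = card word_index" by (simp add: alt_elt_image)
qed simp

lemma word_prod_top: "word_prod n (alt_word 2 n) = word_prod n (alt_word 1 n)"
proof -
  have "(int (n div 2)) mod int n = (- int (n div 2)) mod int n" if "even n"
  proof -
    have "int (n div 2) = - int (n div 2) + 1 * int n" using that by (auto elim!: evenE)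
    then show ?thesis by (metis mod_mult_self1)
  qed
  moreover have "(int (n div 2) + 1) mod int n = (- int (n div 2)) mod int n" if "odd n"
  proof -
    have "int (n div 2) + 1 = - int (n div 2) + 1 * int n" using that by (auto elim!: oddE)
    then show ?thesis by (metis mod_mult_self1)
  qed
  ultimately show ?thesis by (simp add: word_prod_alt_word)
qed

lemma t_top: "t\<^sub>F 2 n \<approx> t\<^sub>F 1 n"
proof -
  have "(alt_prod 1 2 n, alt_prod 2 1 n) \<in> hecke_relations n" by (simp add: hecke_relations_def)
  then show ?thesis
    using H.eqv_sym[OF H.eqv_relation] by (simp add: t\<^sub>F_def numeral_2_eq_2 numeral_3_eq_3)
qed

lemma T_gen_foldr:
  assumes "is \<in> lists {1, 2}"
  shows "free_prod is \<in> carrier free_alg \<and>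
    foldr (\<lambda>i h. T_gen n i \<otimes>\<^bsub>hecke n\<^esub> h) is \<one>\<^bsub>hecke n\<^esub> = H.cls (free_prod is)"
  using assms
proof (induction "is")
  case Nil
  then show ?case by (simp add: free_prod_def hecke_def H.QA_simps)
next
  case (Cons i "is")
  have "letter i" using Cons by (auto simp: letter_def)
  then show ?case using Cons
    by (auto simp: free_prod_def T_gen_def hecke_def H.cls_def[symmetric] H.QA_mult)
qed

text \<open>The reduced word chosen in the definition of \<open>T\<^sub>H\<close> alternates and has
  at most n letters. By injectivity it is the word of the index, except possibly at length n, where
  it may start with the other letter and the braid relation identifies the two products.\<close>

lemma T_alt_elt:
  assumes "(i, m) \<in> word_index"
  shows "T\<^sub>H n (alt_elt (i, m)) = H.cls (t\<^sub>F i m)"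
proof -
  define w where "w = alt_elt (i, m)"
  have im: "letter i" "m \<le> n" using assms by (auto simp: word_index_def letter_def)
  define P where "P js \<longleftrightarrow> js \<in> lists {1, 2} \<and> word_prod n js = w" for js
  have Pim: "P (alt_word i m)" using im alt_word_lists[of i m] by (simp add: P_def w_def alt_elt_def)
  obtain js where "P js" "\<forall>ks. P ks \<longrightarrow> length js \<le> length ks"
    using ex_has_least_nat[of P "alt_word i m" length] Pim by blast
  then have "reduced_word n js w" by (auto simp: reduced_word_def P_def)
  then have red: "reduced_word n (SOME is. reduced_word n is w) w" by (rule someI)
  define us where "us = (SOME is. reduced_word n is w)"
 from red have "reduced_word n us w" by (simp only: us_def)
  then have us: "us \<in> lists {1, 2}" "word_prod n us = w"
    "\<And>js. js \<in> lists {1, 2} \<Longrightarrow> word_prod n js = w \<Longrightarrow> length us \<le> length js"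
    unfolding reduced_word_def by blast+
  have len: "length us \<le> n"
    using us(3)[of "alt_word i m"] Pim im by (simp add: P_def)
  obtain k where k: "letter k" "us = alt_word k (length us)"
    using alt_word_or_shorter[OF n2 us(1)] us(2,3) by fastforce
  have T: "T\<^sub>H n w = H.cls (t\<^sub>F k (length us))"
    using T_gen_foldr[OF us(1)] free_prod_alt_word[OF k(1), of "length us"] k(2)
    by (simp add: T\<^sub>H_def us_def[symmetric])
  have w: "w = word_prod n (alt_word k (length us))" using us(2) k(2) by simp
  consider "length us = 0" | "length us = n" | "1 \<le> length us" "length us < n"
    using len by linarith
  then show ?thesis
  proof cases
    case 1
    have "alt_elt (1, 0) = alt_elt (i, m)" using w 1 by (simp add: w_def[symmetric]) (simp add: alt_elt_def)
    then have "(i, m) = (1, 0)" using inj_onD[OF alt_elt_inj] assms by (metis insertI1 word_index_def)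
    then show ?thesis using T 1 by (simp add: w_def t_0)
  next
    case 2
    have "k = 1 \<or> k = 2" using k(1) by (simp add: letter_def)
    then have "w = word_prod n (alt_word 1 n)"
      using w word_prod_top unfolding 2 by (elim disjE) (simp_all only:)
    then have "alt_elt (1, n) = alt_elt (i, m)" unfolding w_def by (simp add: alt_elt_def)
    then have im: "(i, m) = (1, n)"
      using inj_onD[OF alt_elt_inj] assms by (metis insertI1 insertI2 word_index_def)
    have "H.cls (t\<^sub>F k n) = H.cls (t\<^sub>F 1 n)"
      using k(1) t_top by (auto simp: letter_def H.cls_eq_iff)
    then show ?thesis using T 2 im by (simp add: w_def)
  next
    case 3
    have "alt_elt (k, length us) = alt_elt (i, m)" using w by (simp add: w_def[symmetric]) (simp add: alt_elt_def)
    moreover have "(k, length us) \<in> word_index" using 3 k(1) by (auto simp: word_index_def letter_def)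
    ultimately have "(i, m) = (k, length us)" using inj_onD[OF alt_elt_inj] assms by metis
    then show ?thesis using T by (simp add: w_def)
  qed
qed

text \<open>The last branch is meant for the full set {1, 2}: at length n, the elements below an
  alternating word are the whole group, so \<open>c\<^sub>F 1 n\<close> represents the sum of all
  T_w.\<close>

definition x_rep :: "nat set \<Rightarrow> free_elt" where
  "x_rep K = (if K = {} then \<one>\<^sub>F else if K = {1} then \<xi> 1 else if K = {2} then \<xi> 2 else c\<^sub>F 1 n)"

section \<open>Parabolic subgroups and their sums\<close>

lemma parabolic_empty: "parabolic n {} = {alt_elt (1, 0)}"
proof -
  interpret group "dihedral n" using dihedral_group n2 by simp
  show ?thesis
    by (simp add: parabolic_def alt_elt_def word_prod_def generate_empty)
qed

lemma alt_elt_letter: "letter i \<Longrightarrow> alt_elt (i, 1) = simple_refl i"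
  using n2 by (auto simp: letter_def alt_elt_def word_prod_alt_word simple_refl_def simp del: One_nat_def alt_word.simps)

lemma parabolic_letter:
  assumes "letter i"
  shows "parabolic n {i} = {alt_elt (1, 0), alt_elt (i, 1)}"
proof -
  interpret group "dihedral n" using dihedral_group n2 by simp
  have one: "alt_elt (1, 0) = \<one>\<^bsub>dihedral n\<^esub>" by (simp add: alt_elt_def word_prod_def)
  have s: "simple_refl i \<in> carrier (dihedral n)"
    using n2 assms by (auto simp: simple_refl_def dihedral_def)
  have ss: "simple_refl i \<otimes>\<^bsub>dihedral n\<^esub> simple_refl i = \<one>\<^bsub>dihedral n\<^esub>"
    using simple_refl_cancel[of "\<one>\<^bsub>dihedral n\<^esub>" n i] s by simp
  have "generate (dihedral n) {simple_refl i} = {\<one>\<^bsub>dihedral n\<^esub>, simple_refl i}"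
  proof
    have "x \<in> {\<one>\<^bsub>dihedral n\<^esub>, simple_refl i}" if "x \<in> generate (dihedral n) {simple_refl i}" for x
      using that
    proof (induction rule: generate.induct)
      case (inv h)
      then show ?case using inv_equality[OF ss s s] by simp
    next
      case (eng h1 h2)
      then show ?case using s ss by auto
    qed auto
    then show "generate (dihedral n) {simple_refl i} \<subseteq> {\<one>\<^bsub>dihedral n\<^esub>, simple_refl i}" by blast
    show "{\<one>\<^bsub>dihedral n\<^esub>, simple_refl i} \<subseteq> generate (dihedral n) {simple_refl i}"
      by (auto intro: generate.one generate.incl)
  qed
  then show ?thesis by (simp add: parabolic_def one alt_elt_letter[OF assms] del: One_nat_def)
qed

lemma parabolic_full: "parabolic n {1, 2} = alt_elt ` word_index"
proof -
  interpret group "dihedral n" using dihedral_group n2 by simp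
  have s: "simple_refl ` {1, 2} \<subseteq> carrier (dihedral n)"
    using n2 by (auto simp: simple_refl_def dihedral_def)
  have word: "word_prod n is \<in> generate (dihedral n) (simple_refl ` {1, 2})" if "is \<in> lists {1, 2}" for "is"
    using that
  proof (induction "is")
    case Nil
    then show ?case by (simp add: word_prod_def generate.one)
  next
    case (Cons i "is")
    then have "simple_refl i \<in> generate (dihedral n) (simple_refl ` {1, 2})"
      by (intro generate.incl) auto
    then show ?case using Cons unfolding word_prod_Cons by (intro generate.eng) auto
  qed
  show ?thesis unfolding alt_elt_image parabolic_def
  proof
    show "generate (dihedral n) (simple_refl ` {1, 2}) \<subseteq> carrier (dihedral n)"
      by (rule generate_incl[OF s])
    show "carrier (dihedral n) \<subseteq> generate (dihedral n) (simple_refl ` {1, 2})"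
      unfolding alt_elt_image[symmetric]
      using word[OF alt_word_lists] word[of "[]"] by (auto simp: alt_elt_def word_index_def letter_def simp del: One_nat_def)
  qed
qed

lemma x_H_image:
  assumes "parabolic n K = alt_elt ` S" "S \<subseteq> word_index"
  shows "x\<^sub>H n K = H.cls (\<Sum>(i, m)\<in>S. t\<^sub>F i m)"
proof -
  interpret QA: ring H.QA by (rule H.QA_ring)
  have closed: "t\<^sub>F i m \<in> carrier free_alg" if "(i, m) \<in> S" for i m
    using that assms(2) by (auto simp: word_index_def letter_def)
  have T: "T\<^sub>H n (alt_elt p) = H.cls (case p of (i, m) \<Rightarrow> t\<^sub>F i m)" if "p \<in> S" for p
    using T_alt_elt assms(2) that by (cases p) auto
  have "x\<^sub>H n K = (\<Oplus>\<^bsub>H.QA\<^esub>p\<in>S. T\<^sub>H n (alt_elt p))"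
    unfolding x\<^sub>H_def assms(1) hecke_def
    by (rule QA.finsum_reindex) (use T closed inj_on_subset[OF alt_elt_inj assms(2)] in \<open>auto simp: H.QA_simps\<close>)
  also have "\<dots> = (\<Oplus>\<^bsub>H.QA\<^esub>p\<in>S. H.cls (case p of (i, m) \<Rightarrow> t\<^sub>F i m))"
    by (rule QA.finsum_cong') (use T closed in \<open>auto simp: H.QA_simps\<close>)
  also have "\<dots> = H.cls (\<Sum>(i, m)\<in>S. t\<^sub>F i m)"
    by (rule H.finsum_cls) (use closed in auto)
  finally show ?thesis .
qed

lemma x_H_eq:
  assumes "K \<subseteq> {1, 2}"
  shows "x\<^sub>H n K = H.cls (x_rep K)"
proof -
  consider "K = {}" | i where "letter i" "K = {i}" | "K = {1, 2}"
    using assms unfolding Pow_iff[symmetric] by (auto simp: letter_def Pow_insert)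
  then show ?thesis
  proof cases
    case 1
    then show ?thesis using x_H_image[of K "{(1, 0)}"] parabolic_empty
      by (simp add: word_index_def x_rep_def t_0)
  next
    case (2 i)
    then have "x\<^sub>H n K = H.cls (\<Sum>(i, m)\<in>{(1, 0), (i, 1)}. t\<^sub>F i m)"
      using n2 by (intro x_H_image) (auto simp: parabolic_letter word_index_def letter_def simp del: One_nat_def)
    then show ?thesis using 2
      by (auto simp: x_rep_def t_0 t_1 \<xi>_def letter_def)
  next
    case 3
    \<comment> \<open>The word of length n ending in \<open>?j\<close> starts with 1, as does the
      word that \<open>word_index\<close> keeps for the longest element.\<close>
    let ?j = "first_letter 1 n"
    have "(\<Sum>(i, m)\<in>word_index. t\<^sub>F i m) = t\<^sub>F 1 n + lower_sum n"
      using n2 unfolding word_index_def lower_sum_def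
      by (subst sum.insert, simp, simp, subst sum.insert, simp, simp)
         (simp add: t_0 sum.cartesian_product[symmetric] sum.distrib add_ac)
    also have "\<dots> \<approx> c\<^sub>F ?j n"
      using quad_c[of ?j n] n2 quad_I_subset quad.eqv_sym[of "c\<^sub>F ?j n"]
      by (auto simp: first_letter_first_letter H.eqv_def quad.eqv_def simp del: One_nat_def)
    also have "\<dots> \<approx> c\<^sub>F 1 n" by (intro c_top) auto
    finally have "H.cls (\<Sum>(i, m)\<in>word_index. t\<^sub>F i m) = H.cls (c\<^sub>F 1 n)"
      by (simp add: H.cls_eq_iff)
    moreover have "x_rep K = c\<^sub>F 1 n"
      using 3 by (auto simp: x_rep_def doubleton_eq_iff)
    ultimately show ?thesis
      using x_H_image[of K word_index] parabolic_full 3 by simp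
  qed
qed

end

section \<open>The Hasse quiver acting on the modules \<open>x\<^sub>I H\<close>\<close>

abbreviation hasse_mult (infixl \<open>\<cdot>\<close> 70) where "f \<cdot> g \<equiv> f \<otimes>\<^bsub>Qq\<^esub> g"
abbreviation hasse_smult (infixr \<open>*\<^sub>Q\<close> 75) where "c *\<^sub>Q f \<equiv> c \<odot>\<^bsub>Qq\<^esub> f"
abbreviation \<delta>\<^sub>1 :: "nat \<Rightarrow> hasse_elt" where "\<delta>\<^sub>1 i \<equiv> \<delta>\<^sub>Q {i} {}"
abbreviation \<upsilon>\<^sub>1 :: "nat \<Rightarrow> hasse_elt" where "\<upsilon>\<^sub>1 i \<equiv> \<upsilon>\<^sub>Q {} {i}"
abbreviation \<delta>\<^sub>2 :: "nat \<Rightarrow> hasse_elt" where "\<delta>\<^sub>2 i \<equiv> \<delta>\<^sub>Q {1, 2} {i}"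
abbreviation \<upsilon>\<^sub>2 :: "nat \<Rightarrow> hasse_elt" where "\<upsilon>\<^sub>2 i \<equiv> \<upsilon>\<^sub>Q {i} {1, 2}"

abbreviation Lambda :: "nat set set" (\<open>\<Lambda>\<close>) where "\<Lambda> \<equiv> Pow {1, 2}"

lemma hasse_quiver_wf: "finite (verts hasse_quiver)" "wf_digraph hasse_quiver"
  by (auto simp: hasse_quiver_def wf_digraph_def)

lemma hasse_simps [simp]: "head hasse_quiver = arrow_head" "tail hasse_quiver = arrow_tail"
  by (simp_all add: hasse_quiver_def)

lemma hasse_verts: "verts hasse_quiver = \<Lambda>"
  by (auto simp: hasse_quiver_def Pow_insert)

lemma hasse_arcs_cases:
  assumes "a \<in> arcs hasse_quiver"
  obtains i where "letter i" "a = Delta {i} {}" | i where "letter i" "a = Upsilon {} {i}"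
    | i where "letter i" "a = Delta {1, 2} {i}" | i where "letter i" "a = Upsilon {i} {1, 2}"
  using assms unfolding hasse_quiver_def letter_def by auto

lemma arrows_closed [simp, intro]:
  assumes "letter i"
  shows "\<delta>\<^sub>1 i \<in> carrier Qq" "\<upsilon>\<^sub>1 i \<in> carrier Qq" "\<delta>\<^sub>2 i \<in> carrier Qq" "\<upsilon>\<^sub>2 i \<in> carrier Qq"
proof -
  have arcs: "Delta {i} {} \<in> arcs hasse_quiver" "Upsilon {} {i} \<in> arcs hasse_quiver"
    "Delta {1, 2} {i} \<in> arcs hasse_quiver" "Upsilon {i} {1, 2} \<in> arcs hasse_quiver"
    using assms by (auto simp: hasse_quiver_def letter_def)
  show "\<delta>\<^sub>1 i \<in> carrier Qq" "\<upsilon>\<^sub>1 i \<in> carrier Qq" "\<delta>\<^sub>2 i \<in> carrier Qq" "\<upsilon>\<^sub>2 i \<in> carrier Qq"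
    by (rule arcs[THEN arrow_elt_closed[OF hasse_quiver_wf(2)]])+
qed

lemmas arrows_closed_Suc [simp, intro] = arrows_closed(3,4)[unfolded One_nat_def]

lemma e_closed [simp, intro]: "v \<in> \<Lambda> \<Longrightarrow> e\<^sub>Q v \<in> carrier Qq"
  by (rule trivial_path_closed) (simp add: hasse_verts)

lemma e_closed' [simp, intro]: "e\<^sub>Q {} \<in> carrier Qq" "letter i \<Longrightarrow> e\<^sub>Q {i} \<in> carrier Qq" "e\<^sub>Q {1, 2} \<in> carrier Qq"
  by (rule e_closed; auto simp: letter_def)+

lemma e_mult: "e\<^sub>Q u \<cdot> e\<^sub>Q v = (if u = v then e\<^sub>Q v else 0)"
  by (simp add: trivial_path_def path_algebra_mult_single path_term_def)

lemma arrow_e: "arrow_elt hasse_quiver a \<cdot> e\<^sub>Q v = (if v = arrow_tail a then arrow_elt hasse_quiver a else 0)"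
  by (simp add: trivial_path_def arrow_elt_def path_algebra_mult_single path_term_def)

lemma e_arrow: "e\<^sub>Q v \<cdot> arrow_elt hasse_quiver a = (if v = arrow_head a then arrow_elt hasse_quiver a else 0)"
  by (simp add: trivial_path_def arrow_elt_def path_algebra_mult_single path_term_def)

lemma e_arrow_mult: "e\<^sub>Q (arrow_head a) \<cdot> (arrow_elt hasse_quiver a \<cdot> f) = arrow_elt hasse_quiver a \<cdot> f"
  by (simp add: path_algebra_mult_assoc[symmetric] e_arrow)

text \<open>The analogue of \<open>\<zeta> j m\<close> in the path algebra, a combination of paths from \<open>{j}\<close> to
  \<open>{first_letter j m}\<close>.\<close>

fun \<zeta>\<^sub>Q :: "nat \<Rightarrow> nat \<Rightarrow> hasse_elt" where
  "\<zeta>\<^sub>Q j 0 = 0"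
| "\<zeta>\<^sub>Q j (Suc 0) = e\<^sub>Q {j}"
| "\<zeta>\<^sub>Q j (Suc (Suc m)) = \<delta>\<^sub>1 (first_letter j m) \<cdot> (\<upsilon>\<^sub>1 (3 - first_letter j m) \<cdot> \<zeta>\<^sub>Q j (Suc m)) - \<q> *\<^sub>Q \<zeta>\<^sub>Q j m"

lemma \<zeta>\<^sub>Q_closed [simp, intro]: "letter j \<Longrightarrow> \<zeta>\<^sub>Q j m \<in> carrier Qq"
  by (induction j m rule: \<zeta>\<^sub>Q.induct) auto

lemma e_\<zeta>\<^sub>Q: "letter j \<Longrightarrow> e\<^sub>Q {first_letter j m} \<cdot> \<zeta>\<^sub>Q j m = \<zeta>\<^sub>Q j m"
proof (induction j m rule: \<zeta>\<^sub>Q.induct)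
  case (2 j)
  then show ?case by (simp add: e_mult first_letter_simps)
next
  case (3 j m)
  then show ?case
    using e_arrow_mult[of "Delta {first_letter j m} {}"]
    by (simp add: first_letter_simps path_algebra_mult_diff path_algebra_mult_smult)
qed simp

subsection \<open>The refined braid relations\<close>

lemma \<chi>_closed: "letter i \<Longrightarrow> \<chi>\<^sub>Q i \<in> carrier Qq"
  by (simp add: \<chi>\<^sub>Q_def)

lemma \<chi>_alt_closed: "letter s \<Longrightarrow> \<chi>\<^sub>Q_alt s (3 - s) m \<in> carrier Qq"
proof (induction m arbitrary: s)
  case (Suc m)
  then show ?case using Suc.IH[of "3 - s"] by (simp add: \<chi>_closed)
qed simp

text \<open>The definition adds factors on the right, whereas the recursion of
  \<open>\<zeta>\<^sub>Q\<close> extends paths at their end, that is, on the left.\<close>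

lemma \<chi>_alt_Suc_left:
  assumes "letter s"
  shows "\<chi>\<^sub>Q_alt s (3 - s) (Suc m) = \<chi>\<^sub>Q (first_letter s m) \<cdot> \<chi>\<^sub>Q_alt s (3 - s) m"
  using assms
proof (induction m arbitrary: s)
  case 0
  then show ?case
    using e_arrow_mult[of "Upsilon {} {3 - s}"]
    by (simp add: first_letter_simps \<chi>\<^sub>Q_def path_algebra_mult_assoc arrow_e)
next
  case (Suc m)
  have t: "letter (3 - s)" "3 - (3 - s) = s" using Suc.prems by auto
  have "\<chi>\<^sub>Q_alt s (3 - s) (Suc (Suc m)) = \<chi>\<^sub>Q_alt (3 - s) (3 - (3 - s)) (Suc m) \<cdot> \<chi>\<^sub>Q (3 - s)"
    using t by simp
  also have "\<dots> = \<chi>\<^sub>Q (first_letter (3 - s) m) \<cdot> (\<chi>\<^sub>Q_alt (3 - s) s m \<cdot> \<chi>\<^sub>Q (3 - s))"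
    unfolding Suc.IH[OF t(1)] by (simp only: path_algebra_mult_assoc t)
  also have "first_letter (3 - s) m = first_letter s (Suc m)"
    using Suc.prems by (simp add: first_letter_other first_letter_simps)
  finally show ?case by simp
qed

text \<open>The alternating path of length \<open>2 (l - 1)\<close> starting at \<open>{s}\<close>.\<close>

definition alt_path :: "nat \<Rightarrow> nat \<Rightarrow> hasse_elt" where
  "alt_path s l = (if l = 0 then 0 else if l = 1 then e\<^sub>Q {s} else
     \<delta>\<^sub>1 (first_letter s l) \<cdot> \<chi>\<^sub>Q_alt s (3 - s) (l - 2) \<cdot> \<upsilon>\<^sub>1 s)"

lemma alt_path_Suc:
  assumes "letter s" "l \<ge> 1"
  shows "alt_path s (Suc l) = \<delta>\<^sub>1 (first_letter s (Suc l)) \<cdot> (\<upsilon>\<^sub>1 (3 - first_letter s (Suc l)) \<cdot> alt_path s l)"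
proof (cases "l = 1")
  case True
  then show ?thesis using assms(1)
    by (simp add: alt_path_def first_letter_simps path_algebra_mult_assoc arrow_e e_arrow)
next
  case False
  then obtain k where l: "l = Suc (Suc k)" using assms(2) by (metis One_nat_def not0_implies_Suc not_one_le_zero)
  have f: "first_letter s (Suc k) = 3 - first_letter s k"
    "3 - (3 - first_letter s k) = first_letter s k" using assms(1) by (simp_all add: first_letter_simps)
  show ?thesis unfolding l alt_path_def
    by (simp add: \<chi>_alt_Suc_left[OF assms(1)] f \<chi>\<^sub>Q_def path_algebra_mult_assoc first_letter_simps
        del: \<chi>\<^sub>Q_alt.simps letter_first)
qed

text \<open>For the nonzero coefficients this is Pascal's rule. The case distinction is forced by
  truncated subtraction: \<open>b_coeff m (Suc m)\<close> evaluates to 1 instead of 0.\<close>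

lemma b_coeff_rec:
  assumes "1 \<le> l" "l \<le> m"
  shows "b_coeff (Suc (Suc m)) (Suc l) = b_coeff (Suc m) l - (if l < m then \<q> * b_coeff m (Suc l) else 0)"
proof (cases "even (m + l)")
  case True
  then have odd: "odd (Suc m - l)" "Suc (Suc m) - Suc l = Suc m - l" "l < m \<Longrightarrow> odd (m - Suc l)"
    using assms by (auto simp: Suc_diff_le)
  then show ?thesis by (simp add: b_coeff_def)
next
  case False
  then have "even (m - l - 1)" "l < m" using assms by (auto simp: le_less)
  from this(1) obtain k where "m - l - 1 = 2 * k" by (rule evenE)
  then have m: "m = l + 2 * k + 1" using \<open>l < m\<close> by simp
  obtain l' where l': "l = Suc l'" using assms by (cases l) auto
  have "b_coeff (Suc (Suc m)) (Suc l) = of_nat ((Suc l + Suc k - 1) choose l) * (- \<q>) ^ Suc k"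
    unfolding b_coeff_def m by (simp add: Let_def)
  moreover have "b_coeff (Suc m) l = of_nat ((l + Suc k - 1) choose (l - 1)) * (- \<q>) ^ Suc k"
    unfolding b_coeff_def m by (simp add: Let_def)
  moreover have "b_coeff m (Suc l) = of_nat ((Suc l + k - 1) choose l) * (- \<q>) ^ k"
    unfolding b_coeff_def m by (simp add: Let_def)
  moreover have "(Suc l + Suc k - 1) choose l = ((l + Suc k - 1) choose (l - 1)) + ((Suc l + k - 1) choose l)"
    by (simp add: l')
  ultimately show ?thesis using \<open>l < m\<close> by (simp add: algebra_simps)
qed

text \<open>Kept apart from \<open>b_coeff_rec\<close>: the coefficient with lower index 0 would
  have to vanish, but \<open>b_coeff (Suc m) 0\<close> does not when \<open>m\<close> is
  odd.\<close>

lemma b_coeff_rec_1: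
  assumes "1 \<le> m"
  shows "b_coeff (Suc (Suc m)) 1 = - \<q> * b_coeff m 1"
proof (cases "odd m")
  case True
  then obtain k where m: "m = 2 * k + 1" by (auto elim: oddE)
  show ?thesis unfolding m b_coeff_def by (simp add: Let_def)
next
  case False
  then obtain k where m: "m = 2 * Suc k" using assms
    by (metis evenE nat.exhaust mult_0_right not_one_le_zero)
  show ?thesis unfolding m b_coeff_def by simp
qed

lemma b_coeff_parity: "l \<le> m \<Longrightarrow> odd (m + l) \<Longrightarrow> b_coeff m l = 0"
  by (simp add: b_coeff_def)

lemma b_coeff_self: "b_coeff m m = 1"
  by (simp add: b_coeff_def)

text \<open>Unfolding the recursion of \<open>\<zeta>\<^sub>Q\<close> into single alternating paths
  yields the recursion \<open>b_coeff_rec\<close> for the coefficients; this is where the constants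
  b_j^n come from.\<close>

lemma \<zeta>\<^sub>Q_eq_sum:
  assumes "letter s"
  shows "\<zeta>\<^sub>Q s m = (\<Sum>l=1..m. b_coeff m l *\<^sub>Q alt_path s l)"
  using assms
proof (induction s m rule: \<zeta>\<^sub>Q.induct)
  case (2 s)
  then show ?case by (simp add: b_coeff_self[of "Suc 0"] alt_path_def path_algebra_smult_module)
next
  case (3 s m)
  let ?i = "first_letter s m"
  \<comment> \<open>The letter prescribed by the recursion depends on m, the one continuing the path
    on l. They agree if l and Suc m have the same parity, and otherwise the coefficient is
    zero.\<close>
  have step: "\<delta>\<^sub>1 ?i \<cdot> (\<upsilon>\<^sub>1 (3 - ?i) \<cdot> (b_coeff (Suc m) l *\<^sub>Q alt_path s l)) = b_coeff (Suc m) l *\<^sub>Q alt_path s (Suc l)"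
    if "1 \<le> l" "l \<le> Suc m" for l
  proof (cases "odd (Suc m + l)")
    case True
    then show ?thesis using that by (simp add: b_coeff_parity path_algebra_smult_module)
  next
    case False
    then have "first_letter s (Suc l) = ?i" by (auto simp: first_letter_def)
    then show ?thesis using alt_path_Suc[OF 3(3) that(1)] by (simp add: path_algebra_mult_smult)
  qed
  have shift: "sum g {1..Suc k} = g 1 + (\<Sum>l=1..k. g (Suc l))" for g :: "nat \<Rightarrow> hasse_elt" and k
    by (induction k) (simp_all add: add_ac)
  have diff: "(\<Sum>l=1..m. b_coeff (Suc (Suc m)) (Suc l) *\<^sub>Q alt_path s (Suc l))
    = (\<Sum>l=1..m. b_coeff (Suc m) l *\<^sub>Q alt_path s (Suc l))
      - (\<Sum>l=1..m. (if l < m then \<q> * b_coeff m (Suc l) else 0) *\<^sub>Q alt_path s (Suc l))"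
    unfolding sum_subtractf[symmetric]
    by (rule sum.cong[OF refl]) (simp add: b_coeff_rec path_algebra_smult_module)
  have "\<zeta>\<^sub>Q s (Suc (Suc m)) = (\<Sum>l=1..Suc m. b_coeff (Suc m) l *\<^sub>Q alt_path s (Suc l))
      - \<q> *\<^sub>Q (\<Sum>l=1..m. b_coeff m l *\<^sub>Q alt_path s l)"
    using 3 step by (simp add: path_algebra_mult_sum_right del: sum.cl_ivl_Suc)
  also have "(\<Sum>l=1..Suc m. b_coeff (Suc m) l *\<^sub>Q alt_path s (Suc l)) =
      (\<Sum>l=1..m. b_coeff (Suc m) l *\<^sub>Q alt_path s (Suc l)) + alt_path s (Suc (Suc m))"
    by (simp add: b_coeff_self path_algebra_smult_module)
  also have "\<q> *\<^sub>Q (\<Sum>l=1..m. b_coeff m l *\<^sub>Q alt_path s l)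
      = (if m = 0 then 0 else (\<q> * b_coeff m 1) *\<^sub>Q alt_path s 1)
        + (\<Sum>l=1..m. (if l < m then \<q> * b_coeff m (Suc l) else 0) *\<^sub>Q alt_path s (Suc l))"
  proof (cases m)
    case (Suc k)
    have "(\<Sum>l=1..Suc k. (if l < Suc k then \<q> * b_coeff (Suc k) (Suc l) else 0) *\<^sub>Q alt_path s (Suc l))
       = (\<Sum>l=1..k. (\<q> * b_coeff (Suc k) (Suc l)) *\<^sub>Q alt_path s (Suc l))"
      by (simp add: path_algebra_smult_module)
    moreover have "(\<Sum>l=1..Suc k. b_coeff (Suc k) l *\<^sub>Q alt_path s l) = b_coeff (Suc k) 1 *\<^sub>Q alt_path s 1
      + (\<Sum>l=1..k. b_coeff (Suc k) (Suc l) *\<^sub>Q alt_path s (Suc l))"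
      by (rule shift)
    ultimately show ?thesis
      unfolding Suc by (simp add: path_algebra_smult_module path_algebra_smult_sum del: sum.cl_ivl_Suc)
  qed (simp add: path_algebra_smult_module)
  also have "(\<Sum>l=1..m. b_coeff (Suc m) l *\<^sub>Q alt_path s (Suc l)) + alt_path s (Suc (Suc m)) -
      ((if m = 0 then 0 else (\<q> * b_coeff m 1) *\<^sub>Q alt_path s 1)
        + (\<Sum>l=1..m. (if l < m then \<q> * b_coeff m (Suc l) else 0) *\<^sub>Q alt_path s (Suc l)))
    = (if m = 0 then 0 else b_coeff (Suc (Suc m)) 1 *\<^sub>Q alt_path s 1)
      + (\<Sum>l=1..m. b_coeff (Suc (Suc m)) (Suc l) *\<^sub>Q alt_path s (Suc l)) + alt_path s (Suc (Suc m))"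
    unfolding diff using b_coeff_rec_1[of m] by (simp add: path_algebra_smult_module algebra_simps)
  also have "\<dots> = (\<Sum>l=1..Suc (Suc m). b_coeff (Suc (Suc m)) l *\<^sub>Q alt_path s l)"
  proof -
    have "(if m = 0 then 0 else b_coeff (Suc (Suc m)) 1 *\<^sub>Q alt_path s 1) = b_coeff (Suc (Suc m)) 1 *\<^sub>Q alt_path s 1"
      by (simp add: b_coeff_def path_algebra_smult_module)
    then show ?thesis
      by (subst shift) (simp add: b_coeff_self path_algebra_smult_module add_ac)
  qed
  finally show ?case .
qed simp

lemma finsum_Qq:
  assumes "\<And>i. i \<in> S \<Longrightarrow> f i \<in> carrier Qq"
  shows "finsum Qq f S = (\<Sum>i\<in>S. f i)"
proof -
  interpret Q: ring Qq by (rule Qq_ring)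
  show ?thesis using assms
    by (induction S rule: infinite_finite_induct) (simp_all add: Q.finsum_infinite Pi_def)
qed

lemma braid_sum:
  assumes "letter s"
  shows "\<delta>\<^sub>1 i \<cdot> (\<Oplus>\<^bsub>Qq\<^esub>j\<in>{r..n}. b_coeff n j *\<^sub>Q \<chi>\<^sub>Q_alt s (3 - s) (j - 2)) \<cdot> \<upsilon>\<^sub>1 s
    = (\<Sum>j=r..n. b_coeff n j *\<^sub>Q (\<delta>\<^sub>1 i \<cdot> \<chi>\<^sub>Q_alt s (3 - s) (j - 2) \<cdot> \<upsilon>\<^sub>1 s))"
  using \<chi>_alt_closed[OF assms]
  by (subst finsum_Qq) (auto simp: path_algebra_mult_sum_left path_algebra_mult_sum_right path_algebra_mult_smult)

lemma refined_braid_eq_even: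
  assumes "letter s" "even n" "n \<ge> 2"
  shows "\<delta>\<^sub>1 (3 - s) \<cdot> (\<Oplus>\<^bsub>Qq\<^esub>j\<in>{2..n}. b_coeff n j *\<^sub>Q \<chi>\<^sub>Q_alt s (3 - s) (j - 2)) \<cdot> \<upsilon>\<^sub>1 s = \<zeta>\<^sub>Q s n"
proof -
  have "\<zeta>\<^sub>Q s n = b_coeff n 1 *\<^sub>Q alt_path s 1 + (\<Sum>j=2..n. b_coeff n j *\<^sub>Q alt_path s j)"
    unfolding \<zeta>\<^sub>Q_eq_sum[OF assms(1)] using assms(3)
    by (subst sum.atLeast_Suc_atMost) (simp_all add: numeral_2_eq_2)
  also have "\<dots> = (\<Sum>j=2..n. b_coeff n j *\<^sub>Q alt_path s j)"
    using assms by (simp add: b_coeff_parity path_algebra_smult_module)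
  also have "\<dots> = (\<Sum>j=2..n. b_coeff n j *\<^sub>Q (\<delta>\<^sub>1 (3 - s) \<cdot> \<chi>\<^sub>Q_alt s (3 - s) (j - 2) \<cdot> \<upsilon>\<^sub>1 s))"
  proof (rule sum.cong[OF refl])
    fix j assume "j \<in> {2..n}"
    then show "b_coeff n j *\<^sub>Q alt_path s j = b_coeff n j *\<^sub>Q (\<delta>\<^sub>1 (3 - s) \<cdot> \<chi>\<^sub>Q_alt s (3 - s) (j - 2) \<cdot> \<upsilon>\<^sub>1 s)"
      using assms by (cases "even j") (auto simp: alt_path_def first_letter_def b_coeff_parity path_algebra_smult_module)
  qed
  finally show ?thesis using braid_sum[OF assms(1)] by simp
qed

lemma refined_braid_eq_odd:
  assumes "letter s" "odd n" "n \<ge> 2"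
  shows "(\<delta>\<^sub>1 s \<cdot> (\<Oplus>\<^bsub>Qq\<^esub>j\<in>{3..n}. b_coeff n j *\<^sub>Q \<chi>\<^sub>Q_alt s (3 - s) (j - 2)) \<cdot> \<upsilon>\<^sub>1 s)
    + ((- \<q>) ^ ((n - 1) div 2) *\<^sub>Q e\<^sub>Q {s}) = \<zeta>\<^sub>Q s n"
proof -
  have "\<zeta>\<^sub>Q s n = b_coeff n 1 *\<^sub>Q alt_path s 1 + (b_coeff n 2 *\<^sub>Q alt_path s 2 + (\<Sum>j=3..n. b_coeff n j *\<^sub>Q alt_path s j))"
    unfolding \<zeta>\<^sub>Q_eq_sum[OF assms(1)] using assms(3)
    by (subst sum.atLeast_Suc_atMost, simp, subst sum.atLeast_Suc_atMost) (simp_all add: numeral_2_eq_2 numeral_3_eq_3)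
  also have "b_coeff n 2 = 0"
    using assms by (simp add: b_coeff_parity)
  also have "b_coeff n 1 *\<^sub>Q alt_path s 1 = (- \<q>) ^ ((n - 1) div 2) *\<^sub>Q e\<^sub>Q {s}"
    using assms by (simp add: b_coeff_def alt_path_def Let_def)
  also have "(\<Sum>j=3..n. b_coeff n j *\<^sub>Q alt_path s j)
     = (\<Sum>j=3..n. b_coeff n j *\<^sub>Q (\<delta>\<^sub>1 s \<cdot> \<chi>\<^sub>Q_alt s (3 - s) (j - 2) \<cdot> \<upsilon>\<^sub>1 s))"
  proof (rule sum.cong[OF refl])
    fix j assume "j \<in> {3..n}"
    then show "b_coeff n j *\<^sub>Q alt_path s j = b_coeff n j *\<^sub>Q (\<delta>\<^sub>1 s \<cdot> \<chi>\<^sub>Q_alt s (3 - s) (j - 2) \<cdot> \<upsilon>\<^sub>1 s)"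
      using assms by (cases "odd j") (auto simp: alt_path_def first_letter_def b_coeff_parity path_algebra_smult_module)
  qed
  finally show ?thesis using braid_sum[OF assms(1)] by (simp add: path_algebra_smult_module)
qed

text \<open>The two parities become one family. For even n the word of length n ending in
  \<open>s\<close> starts with the other letter and b_1 vanishes; for odd n it starts with
  \<open>s\<close>, and the trivial path in \<open>\<zeta>\<^sub>Q s n\<close> is the extra term
  with coefficient (-q)^((n-1)/2).\<close>

lemma refined_braid_relations_eq:
  assumes "n \<ge> 2"
  shows "refined_braid_relations n = {(\<upsilon>\<^sub>2 (first_letter s n) \<cdot> \<delta>\<^sub>2 s, \<zeta>\<^sub>Q s n) | s. letter s}"
proof -
  have pairs: "{F s t | s t. (s, t) \<in> {(1, 2), (2, 1)}} = {F s (3 - s) | s. letter s}"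
    for F :: "nat \<Rightarrow> nat \<Rightarrow> hasse_elt \<times> hasse_elt"
  proof -
    have "{F s t | s t. (s, t) \<in> {(1, 2), (2, 1)}} = {F 1 2, F 2 1}" by blast
    also have "\<dots> = {F 1 (3 - 1), F 2 (3 - 2)}" by (simp add: numeral_2_eq_2 numeral_3_eq_3)
    also have "\<dots> = {F s (3 - s) | s. letter s}" unfolding letter_def by blast
    finally show ?thesis .
  qed
  show ?thesis
  proof (cases "even n")
    case True
    then have "refined_braid_relations n = {(\<upsilon>\<^sub>2 (3 - s) \<cdot> \<delta>\<^sub>2 s,
         \<delta>\<^sub>1 (3 - s) \<cdot> (\<Oplus>\<^bsub>Qq\<^esub>j\<in>{2..n}. b_coeff n j *\<^sub>Q \<chi>\<^sub>Q_alt s (3 - s) (j - 2)) \<cdot> \<upsilon>\<^sub>1 s) | s. letter s}"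
      unfolding refined_braid_relations_def by (simp only: if_True pairs)
    also have "\<dots> = {(\<upsilon>\<^sub>2 (first_letter s n) \<cdot> \<delta>\<^sub>2 s, \<zeta>\<^sub>Q s n) | s. letter s}"
      using True refined_braid_eq_even[OF _ True assms]
      by (intro Collect_cong ex_cong1) (auto simp: first_letter_def)
    finally show ?thesis .
  next
    case False
    then have "refined_braid_relations n = {(\<upsilon>\<^sub>2 s \<cdot> \<delta>\<^sub>2 s,
        (\<delta>\<^sub>1 s \<cdot> (\<Oplus>\<^bsub>Qq\<^esub>j\<in>{3..n}. b_coeff n j *\<^sub>Q \<chi>\<^sub>Q_alt s (3 - s) (j - 2)) \<cdot> \<upsilon>\<^sub>1 s)
         + ((- \<q>) ^ ((n - 1) div 2) *\<^sub>Q e\<^sub>Q {s})) | s. letter s}"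
      unfolding refined_braid_relations_def by (simp only: if_False pairs path_algebra_simps)
    also have "\<dots> = {(\<upsilon>\<^sub>2 (first_letter s n) \<cdot> \<delta>\<^sub>2 s, \<zeta>\<^sub>Q s n) | s. letter s}"
      using False refined_braid_eq_odd[OF _ False assms]
      by (intro Collect_cong ex_cong1) (auto simp: first_letter_def)
    finally show ?thesis .
  qed
qed

lemma hasse_relations_cases:
  assumes "n \<ge> 2" "(l, r) \<in> hasse_relations n"
  obtains i where "letter i" "l = \<delta>\<^sub>1 i \<cdot> \<upsilon>\<^sub>1 i" "r = (1 + \<q>) *\<^sub>Q e\<^sub>Q {i}"
    | i where "letter i" "l = \<delta>\<^sub>2 i \<cdot> \<upsilon>\<^sub>2 i" "r = (\<Sum>k<n. \<q> ^ k) *\<^sub>Q e\<^sub>Q {1, 2}"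
    | "l = \<upsilon>\<^sub>1 1 \<cdot> \<upsilon>\<^sub>2 1" "r = \<upsilon>\<^sub>1 2 \<cdot> \<upsilon>\<^sub>2 2"
    | "l = \<delta>\<^sub>2 1 \<cdot> \<delta>\<^sub>1 1" "r = \<delta>\<^sub>2 2 \<cdot> \<delta>\<^sub>1 2"
    | s where "letter s" "l = \<upsilon>\<^sub>2 (first_letter s n) \<cdot> \<delta>\<^sub>2 s" "r = \<zeta>\<^sub>Q s n"
proof -
  have "i \<in> {1, 2} \<longleftrightarrow> letter i" for i by (auto simp: letter_def)
  note unf = hasse_relations_def refined_braid_relations_eq[OF assms(1)] quasi_idempotent_relations_def
    sandwich_relations_def this
  show thesis
    using assms(2) that unfolding unf by blast
qed

lemma hasse_relation_rules:
  assumes "n \<ge> 2"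
  shows "letter i \<Longrightarrow> (\<delta>\<^sub>1 i \<cdot> \<upsilon>\<^sub>1 i, (1 + \<q>) *\<^sub>Q e\<^sub>Q {i}) \<in> hasse_relations n"
    "letter i \<Longrightarrow> (\<delta>\<^sub>2 i \<cdot> \<upsilon>\<^sub>2 i, (\<Sum>k<n. \<q> ^ k) *\<^sub>Q e\<^sub>Q {1, 2}) \<in> hasse_relations n"
    "(\<upsilon>\<^sub>1 1 \<cdot> \<upsilon>\<^sub>2 1, \<upsilon>\<^sub>1 2 \<cdot> \<upsilon>\<^sub>2 2) \<in> hasse_relations n"
    "(\<delta>\<^sub>2 1 \<cdot> \<delta>\<^sub>1 1, \<delta>\<^sub>2 2 \<cdot> \<delta>\<^sub>1 2) \<in> hasse_relations n"
    "letter s \<Longrightarrow> (\<upsilon>\<^sub>2 (first_letter s n) \<cdot> \<delta>\<^sub>2 s, \<zeta>\<^sub>Q s n) \<in> hasse_relations n"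
proof -
  have "i \<in> {1, 2} \<longleftrightarrow> letter i" for i by (auto simp: letter_def)
  note unf = hasse_relations_def refined_braid_relations_eq[OF assms(1)] quasi_idempotent_relations_def
    sandwich_relations_def this
  show "letter i \<Longrightarrow> (\<delta>\<^sub>1 i \<cdot> \<upsilon>\<^sub>1 i, (1 + \<q>) *\<^sub>Q e\<^sub>Q {i}) \<in> hasse_relations n"
    "letter i \<Longrightarrow> (\<delta>\<^sub>2 i \<cdot> \<upsilon>\<^sub>2 i, (\<Sum>k<n. \<q> ^ k) *\<^sub>Q e\<^sub>Q {1, 2}) \<in> hasse_relations n"
    "(\<upsilon>\<^sub>1 1 \<cdot> \<upsilon>\<^sub>2 1, \<upsilon>\<^sub>1 2 \<cdot> \<upsilon>\<^sub>2 2) \<in> hasse_relations n"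
    "(\<delta>\<^sub>2 1 \<cdot> \<delta>\<^sub>1 1, \<delta>\<^sub>2 2 \<cdot> \<delta>\<^sub>1 2) \<in> hasse_relations n"
    "letter s \<Longrightarrow> (\<upsilon>\<^sub>2 (first_letter s n) \<cdot> \<delta>\<^sub>2 s, \<zeta>\<^sub>Q s n) \<in> hasse_relations n"
    unfolding unf by blast+
qed

context dihedral_hecke
begin

text \<open>Upsilon is the inclusion of one right ideal in a larger one. Delta sends generator to
  generator: \<open>\<xi> i\<close> is the image of the identity, and
  \<open>\<zeta> i n \<star> \<xi> i\<close> is \<open>c\<^sub>F i n\<close>, the generator at {1,
  2} up to congruence.\<close>

fun arrow_map :: "arrow \<Rightarrow> free_elt \<Rightarrow> free_elt" where
  "arrow_map (Delta K J) f =
    (if J = {} then if K = {1} then \<xi> 1 else \<xi> 2 else if J = {1} then \<zeta> 1 n else \<zeta> 2 n) \<star> f"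
| "arrow_map (Upsilon K J) f = f"

lemma arrow_map_Delta:
  assumes "letter i"
  shows "arrow_map (Delta {i} {}) f = \<xi> i \<star> f" "arrow_map (Delta {1, 2} {i}) f = \<zeta> i n \<star> f"
  using assms by (auto simp: letter_def)

sublocale Q: presented_path_algebra hasse_quiver "hasse_relations n"
  by (rule presented_path_algebra.intro) (use hasse_relations_closed[of n] hasse_quiver_wf in auto)

notation Q.eqv (infix \<open>\<simeq>\<close> 50)

sublocale hasse: arrow_action "\<lambda>c f. c *\<^sub>F f" arrow_map
proof
  fix a x y show "arrow_map a (x + y) = arrow_map a x + arrow_map a y"
    by (cases a) (simp_all add: path_algebra_mult_add_right)
next
  fix a c x show "arrow_map a (c *\<^sub>F x) = c *\<^sub>F arrow_map a x"
    by (cases a) (simp_all add: path_algebra_mult_smult)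
qed (simp_all add: path_algebra_smult_module)

abbreviation act where "act \<equiv> hasse.path_act"

lemma act_arrow_mult: "act (arrow_elt hasse_quiver a \<cdot> f) m k =
    (if k = arrow_head a then arrow_map a (act f m (arrow_tail a)) else 0)"
  by (simp add: hasse.path_act_mult hasse.path_act_arrow)

lemma arrow_map_eqv: "a \<in> arcs hasse_quiver \<Longrightarrow> f \<approx> g \<Longrightarrow> arrow_map a f \<approx> arrow_map a g"
  by (cases a) (auto intro!: H.eqv_mult_left)

lemma arrow_map_mult: "arrow_map a (f \<star> h) = arrow_map a f \<star> h"
  by (cases a) (simp_all add: path_algebra_mult_assoc)

lemma act_mult_right: "act f (\<lambda>u. m u \<star> h) k = act f m k \<star> h"
proof -
  have fold: "fold arrow_map p (g \<star> h) = fold arrow_map p g \<star> h" for p g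
    by (induction p arbitrary: g) (simp_all add: arrow_map_mult)
  show ?thesis
    by (auto simp: hasse.path_act_def hasse.single_act_def fold path_algebra_mult_sum_left
        path_algebra_mult_smult intro!: sum.cong split: prod.splits)
qed

lemma act_eqv:
  assumes "f \<in> carrier Qq" "\<And>u. u \<in> \<Lambda> \<Longrightarrow> m u \<approx> m' u"
  shows "act f m k \<approx> act f m' k"
  using hasse_quiver_wf(2) assms(1)
proof (induction f arbitrary: k rule: path_algebra_induct)
  case (trivial v)
  then show ?case using assms(2) by (auto simp: hasse.path_act_trivial hasse_verts)
next
  case (arrow a f)
  then show ?case by (auto simp: act_arrow_mult intro!: arrow_map_eqv)
qed (auto simp: hasse.path_act_add hasse.path_act_smult intro: H.eqv_add H.eqv_smult)

section \<open>The right ideals at the vertices and the relations on them\<close>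

lemma x_rep_simps: "x_rep {} = \<one>\<^sub>F" "letter i \<Longrightarrow> x_rep {i} = \<xi> i" "x_rep {1, 2} = c\<^sub>F 1 n"
  by (auto simp: x_rep_def letter_def doubleton_eq_iff)

lemma vertex_cases:
  assumes "K \<in> \<Lambda>"
  obtains "K = {}" | i where "letter i" "K = {i}" | "K = {1, 2}"
  using assms unfolding letter_def by (auto simp: Pow_insert)

lemma x_rep_closed [simp, intro]: "x_rep K \<in> carrier free_alg"
  by (auto simp: x_rep_def)

definition module_at :: "nat set \<Rightarrow> free_elt \<Rightarrow> bool" where
  "module_at K f \<longleftrightarrow> (\<exists>h\<in>carrier free_alg. f \<approx> x_rep K \<star> h)"

lemma module_at_closed: "module_at K f \<Longrightarrow> f \<in> carrier free_alg"
  unfolding module_at_def by (meson H.eqv_carrier path_algebra_mult_closed x_rep_closed)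

lemma module_at_zero: "module_at K 0"
  unfolding module_at_def by (intro bexI[of _ 0]) auto

lemma module_at_add: "module_at K f \<Longrightarrow> module_at K g \<Longrightarrow> module_at K (f + g)"
  unfolding module_at_def
proof (elim bexE)
  fix h h' assume "h \<in> carrier free_alg" "f \<approx> x_rep K \<star> h" "h' \<in> carrier free_alg" "g \<approx> x_rep K \<star> h'"
  then show "\<exists>h\<in>carrier free_alg. f + g \<approx> x_rep K \<star> h"
    by (intro bexI[of _ "h + h'"]) (auto simp: path_algebra_mult_add_right H.eqv_add)
qed

lemma module_at_smult: "module_at K f \<Longrightarrow> module_at K (c *\<^sub>F f)"
  unfolding module_at_def
proof (elim bexE)
  fix h assume "h \<in> carrier free_alg" "f \<approx> x_rep K \<star> h"
  then show "\<exists>h\<in>carrier free_alg. c *\<^sub>F f \<approx> x_rep K \<star> h"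
    by (intro bexI[of _ "c *\<^sub>F h"]) (auto simp: path_algebra_mult_smult H.eqv_smult)
qed

lemma module_at_empty: "f \<in> carrier free_alg \<Longrightarrow> module_at {} f"
  unfolding module_at_def by (intro bexI[of _ f]) (auto simp: x_rep_simps)

text \<open>By definition \<open>c\<^sub>F j m\<close> has a right factor \<open>\<xi> j\<close>.
  The inclusion of the ideal at {1, 2} in the ideal at {i} requires a factor on the left.\<close>

lemma c_left_factor:
  assumes "letter j"
  shows "\<exists>d\<in>carrier free_alg. c\<^sub>F j m = \<xi> (first_letter j m) \<star> d"
  using assms
proof (induction j m rule: \<zeta>.induct)
  case (1 j)
  then show ?case by (intro bexI[of _ 0]) (auto simp: c_simps)
next
  case (2 j)
  then show ?case by (intro bexI[of _ "\<one>\<^sub>F"]) (auto simp: c_simps first_letter_simps)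
next
  case (3 j m)
  then obtain d where "d \<in> carrier free_alg" "c\<^sub>F j m = \<xi> (first_letter j m) \<star> d" by blast
  with 3(3) show ?case
    by (intro bexI[of _ "c\<^sub>F j (Suc m) - \<q> *\<^sub>F d"])
       (auto simp: c_simps first_letter_simps path_algebra_mult_diff path_algebra_mult_smult)
qed

lemma module_at_arrow:
  assumes "a \<in> arcs hasse_quiver" "module_at (arrow_tail a) f"
  shows "module_at (arrow_head a) (arrow_map a f)"
  using assms(1)
proof (cases rule: hasse_arcs_cases)
  case (1 i)
  then show ?thesis using module_at_closed[OF assms(2)] unfolding module_at_def
    by (intro bexI[of _ f]) (simp_all add: arrow_map_Delta x_rep_simps del: arrow_map.simps)
next
  case (2 i)
  then show ?thesis using module_at_closed[OF assms(2)] by (simp add: module_at_empty)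
next
  case (3 i)
  then obtain h where h: "h \<in> carrier free_alg" "f \<approx> \<xi> i \<star> h"
    using assms(2) by (auto simp: module_at_def x_rep_simps)
  have "\<zeta> i n \<star> f \<approx> \<zeta> i n \<star> (\<xi> i \<star> h)" using h 3 by (intro H.eqv_mult_left) auto
  also have "\<dots> = c\<^sub>F i n \<star> h" by (simp add: c\<^sub>F_def path_algebra_mult_assoc)
  also have "\<dots> \<approx> c\<^sub>F 1 n \<star> h" using h 3 by (intro H.eqv_mult_right c_top) auto
  finally have "arrow_map a f \<approx> x_rep (arrow_head a) \<star> h"
    using 3 by (simp add: arrow_map_Delta x_rep_simps(3) del: arrow_map.simps One_nat_def)
  then show ?thesis using h unfolding module_at_def by blast
next
  case (4 i)
  then obtain h where h: "h \<in> carrier free_alg" "f \<approx> c\<^sub>F 1 n \<star> h"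
    using assms(2) x_rep_simps(3) by (auto simp: module_at_def simp del: One_nat_def)
  \<comment> \<open>Among the two congruent top elements this selects the one whose word starts with
    \<open>i\<close>, so that \<open>\<xi> i\<close> can be split off on the left.\<close>
  let ?j = "first_letter i n"
  have j: "letter ?j" "first_letter ?j n = i" using 4 by (auto simp: first_letter_first_letter)
  then obtain d where d: "d \<in> carrier free_alg" "c\<^sub>F ?j n = \<xi> i \<star> d"
    using c_left_factor[of ?j n] by auto
  note h(2)
  also have "c\<^sub>F 1 n \<star> h \<approx> c\<^sub>F ?j n \<star> h" using h j by (intro H.eqv_mult_right c_top) auto
  also have "\<dots> = \<xi> i \<star> (d \<star> h)" by (simp add: d path_algebra_mult_assoc)
  finally have "arrow_map a f \<approx> x_rep (arrow_head a) \<star> (d \<star> h)"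
    using 4 by (simp add: x_rep_simps)
  then show ?thesis unfolding module_at_def using h d by blast
qed

definition vec :: "(nat set \<Rightarrow> free_elt) \<Rightarrow> bool" where
  "vec m \<longleftrightarrow> (\<forall>K\<in>\<Lambda>. module_at K (m K))"

lemma vec_act:
  assumes "f \<in> carrier Qq" "vec m"
  shows "vec (act f m)"
  unfolding vec_def using hasse_quiver_wf(2) assms(1)
proof (induction f rule: path_algebra_induct)
  case (trivial v)
  then show ?case using assms(2) by (auto simp: hasse.path_act_trivial vec_def module_at_zero)
next
  case (arrow a f)
  then have "arrow_tail a \<in> \<Lambda>"
    by (auto elim!: hasse_arcs_cases simp: letter_def)
  then show ?case using arrow by (auto simp: act_arrow_mult module_at_zero module_at_arrow)
qed (auto simp: hasse.path_act_add hasse.path_act_smult module_at_zero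
    intro: module_at_add module_at_smult)

lemma xi_top: "letter i \<Longrightarrow> \<xi> i \<star> c\<^sub>F 1 n \<approx> (1 + \<q>) *\<^sub>F c\<^sub>F 1 n"
proof -
  assume i: "letter i"
  let ?j = "first_letter i n"
  have j: "letter ?j" "first_letter ?j n = i" using i by (auto simp: first_letter_first_letter)
  have "\<xi> i \<star> c\<^sub>F 1 n \<approx> \<xi> i \<star> c\<^sub>F ?j n" using i by (intro H.eqv_mult_left c_top) auto
  also have "\<dots> \<approx> (1 + \<q>) *\<^sub>F c\<^sub>F ?j n" using xi_c[OF j(1), of n] n2 j by simp
  also have "\<dots> \<approx> (1 + \<q>) *\<^sub>F c\<^sub>F 1 n" using i by (intro H.eqv_smult c_top) auto
  finally show ?thesis .
qed

lemma sum_q_rec: "(1 + \<q>) * (\<Sum>k<Suc m. \<q> ^ k) - \<q> * (\<Sum>k<m. \<q> ^ k) = (\<Sum>k<Suc (Suc m). \<q> ^ k)"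
  by (simp add: algebra_simps sum_distrib_left sum.distrib)

text \<open>Each \<open>\<xi> i\<close> acts on the top element as 1 + q, so the recursion of
  \<open>\<zeta>\<close> turns into the recursion \<open>sum_q_rec\<close> of the
  q-integers.\<close>

lemma zeta_top: "letter j \<Longrightarrow> \<zeta> j m \<star> c\<^sub>F 1 n \<approx> (\<Sum>k<m. \<q> ^ k) *\<^sub>F c\<^sub>F 1 n"
proof (induction j m rule: \<zeta>.induct)
  case (3 j m)
  let ?i = "first_letter j m"
  have i: "letter ?i" using 3 by simp
  have "\<zeta> j (Suc (Suc m)) \<star> c\<^sub>F 1 n = \<xi> ?i \<star> (\<zeta> j (Suc m) \<star> c\<^sub>F 1 n) - \<q> *\<^sub>F (\<zeta> j m \<star> c\<^sub>F 1 n)"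
    by (simp add: path_algebra_expand)
  also have "\<dots> \<approx> \<xi> ?i \<star> ((\<Sum>k<Suc m. \<q> ^ k) *\<^sub>F c\<^sub>F 1 n) - \<q> *\<^sub>F ((\<Sum>k<m. \<q> ^ k) *\<^sub>F c\<^sub>F 1 n)"
    using 3 i by (intro H.eqv_diff H.eqv_mult_left H.eqv_smult) blast+
  also have "\<dots> = (\<Sum>k<Suc m. \<q> ^ k) *\<^sub>F (\<xi> ?i \<star> c\<^sub>F 1 n) - \<q> *\<^sub>F ((\<Sum>k<m. \<q> ^ k) *\<^sub>F c\<^sub>F 1 n)"
    by (simp only: path_algebra_mult_smult)
  also have "\<dots> \<approx> (\<Sum>k<Suc m. \<q> ^ k) *\<^sub>F ((1 + \<q>) *\<^sub>F c\<^sub>F 1 n) - \<q> *\<^sub>F ((\<Sum>k<m. \<q> ^ k) *\<^sub>F c\<^sub>F 1 n)"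
    using i by (intro H.eqv_diff H.eqv_smult H.eqv_refl xi_top)
  also have "\<dots> = (\<Sum>k<Suc (Suc m). \<q> ^ k) *\<^sub>F c\<^sub>F 1 n"
    unfolding sum_q_rec[symmetric] by (simp only: path_algebra_smult_module(3,8) mult.commute)
  finally show ?case .
qed (simp_all add: path_algebra_smult_module)

lemma act_\<zeta>\<^sub>Q:
  assumes "letter j" "m {j} \<in> carrier free_alg"
  shows "act (\<zeta>\<^sub>Q j l) m k = (if k = {first_letter j l} then \<zeta> j l \<star> m {j} else 0)"
  using assms
proof (induction j l arbitrary: k rule: \<zeta>\<^sub>Q.induct)
  case (2 j)
  then show ?case by (simp add: hasse.path_act_trivial first_letter_simps)
next
  case (3 j l)
  let ?i = "first_letter j l"
  have i: "letter ?i" using 3 by simp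
  have "act (\<zeta>\<^sub>Q j (Suc (Suc l))) m k = (if k = {?i} then \<xi> ?i \<star> act (\<zeta>\<^sub>Q j (Suc l)) m {3 - ?i} else 0)
     - \<q> *\<^sub>F act (\<zeta>\<^sub>Q j l) m k"
    using i by (simp add: hasse.path_act_diff hasse.path_act_smult act_arrow_mult arrow_map_Delta
        del: arrow_map.simps(1))
  also have "\<dots> = (if k = {?i} then \<xi> ?i \<star> (\<zeta> j (Suc l) \<star> m {j}) - \<q> *\<^sub>F (\<zeta> j l \<star> m {j}) else 0)"
    using 3 by (simp add: first_letter_simps path_algebra_smult_module)
  finally show ?case by (simp add: first_letter_simps path_algebra_expand)
qed simp

text \<open>The quasi-idempotent relations hold only on the right ideals: \<open>\<xi> i\<close>
  acts as 1 + q on multiples of \<open>\<xi> i\<close>, and \<open>\<zeta> i n\<close> acts as a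
  q-integer on multiples of the top element. Of the sandwich relations, the upsilon one compares
  inclusions and the delta one is \<open>c_top\<close>; the refined braid relation holds since
  \<open>\<zeta>\<^sub>Q\<close> acts as \<open>\<zeta>\<close>.\<close>

lemma act_relation:
  assumes "(l, r) \<in> hasse_relations n" "vec m" "k \<in> \<Lambda>"
  shows "act l m k \<approx> act r m k"
  using n2 assms(1)
proof (cases rule: hasse_relations_cases)
  case (1 i)
  have "module_at {i} (m {i})" using assms(2) 1 by (auto simp: vec_def letter_def)
  then obtain h where h: "h \<in> carrier free_alg" "m {i} \<approx> \<xi> i \<star> h"
    using 1 by (auto simp: module_at_def x_rep_simps)
  have "\<xi> i \<star> m {i} \<approx> \<xi> i \<star> (\<xi> i \<star> h)" using h 1 by (intro H.eqv_mult_left) auto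
  also have "\<dots> = (\<xi> i \<star> \<xi> i) \<star> h" by (simp add: path_algebra_mult_assoc)
  also have "\<dots> \<approx> ((1 + \<q>) *\<^sub>F \<xi> i) \<star> h" using h 1 by (intro H.eqv_mult_right xi_xi) auto
  also have "\<dots> = (1 + \<q>) *\<^sub>F (\<xi> i \<star> h)" by (simp only: path_algebra_mult_smult)
  also have "\<dots> \<approx> (1 + \<q>) *\<^sub>F m {i}" using h by (intro H.eqv_smult) (rule H.eqv_sym)
  finally show ?thesis using 1
    by (simp add: act_arrow_mult hasse.path_act_arrow arrow_map_Delta hasse.path_act_smult
        hasse.path_act_trivial path_algebra_smult_module(6) del: arrow_map.simps(1))
next
  case (2 i)
  have "module_at {1, 2} (m {1, 2})" using assms(2) by (auto simp: vec_def)
  then obtain h where h: "h \<in> carrier free_alg" "m {1, 2} \<approx> c\<^sub>F 1 n \<star> h"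
    by (auto simp: module_at_def x_rep_simps(3) simp del: One_nat_def)
  have "\<zeta> i n \<star> m {1, 2} \<approx> \<zeta> i n \<star> (c\<^sub>F 1 n \<star> h)" using h 2 by (intro H.eqv_mult_left) auto
  also have "\<dots> = (\<zeta> i n \<star> c\<^sub>F 1 n) \<star> h" by (simp add: path_algebra_mult_assoc)
  also have "\<dots> \<approx> ((\<Sum>k<n. \<q> ^ k) *\<^sub>F c\<^sub>F 1 n) \<star> h" using h 2 by (intro H.eqv_mult_right zeta_top) auto
  also have "\<dots> = (\<Sum>k<n. \<q> ^ k) *\<^sub>F (c\<^sub>F 1 n \<star> h)" by (simp only: path_algebra_mult_smult)
  also have "\<dots> \<approx> (\<Sum>k<n. \<q> ^ k) *\<^sub>F m {1, 2}" using h by (intro H.eqv_smult) (rule H.eqv_sym)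
  finally show ?thesis using 2
    by (simp add: act_arrow_mult hasse.path_act_arrow arrow_map_Delta hasse.path_act_smult
        hasse.path_act_trivial path_algebra_smult_module(6) del: arrow_map.simps(1) One_nat_def)
next
  case 3
  then show ?thesis by (simp add: act_arrow_mult hasse.path_act_arrow)
next
  case 4
  have m: "m {} \<in> carrier free_alg" using assms(2) module_at_closed by (auto simp: vec_def)
  have "\<zeta> 1 n \<star> (\<xi> 1 \<star> m {}) \<approx> \<zeta> 2 n \<star> (\<xi> 2 \<star> m {})"
    unfolding path_algebra_mult_assoc[symmetric] c\<^sub>F_def[symmetric]
    using m by (intro H.eqv_mult_right c_top) auto
  then show ?thesis using 4
    by (simp add: act_arrow_mult hasse.path_act_arrow arrow_map_Delta del: arrow_map.simps(1) One_nat_def)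
next
  case (5 s)
  have "m {s} \<in> carrier free_alg" using assms(2) 5 module_at_closed by (auto simp: vec_def letter_def)
  then show ?thesis using 5
    by (simp add: act_arrow_mult hasse.path_act_arrow arrow_map_Delta act_\<zeta>\<^sub>Q del: arrow_map.simps(1) One_nat_def)
qed

definition null :: "hasse_elt \<Rightarrow> bool" where
  "null f \<longleftrightarrow> (\<forall>m. vec m \<longrightarrow> (\<forall>k\<in>\<Lambda>. act f m k \<approx> 0))"

lemma null_ideal: "ideal {f \<in> carrier Qq. null f} Qq"
proof (rule path_algebra_idealI)
  show "- f \<in> {f \<in> carrier Qq. null f}" if "f \<in> {f \<in> carrier Qq. null f}" for f
  proof -
    have "act (- f) m k \<approx> 0" if "vec m" "k \<in> \<Lambda>" for m k
      using H.eqv_smult[of "act f m k" 0 "- 1"] that \<open>f \<in> _\<close>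
        hasse.path_act_diff[of 0 f m k] by (simp add: null_def path_algebra_smult_module)
    then show ?thesis using that by (simp add: null_def)
  qed
  show "f + g \<in> {f \<in> carrier Qq. null f}" if "f \<in> {f \<in> carrier Qq. null f}" "g \<in> {f \<in> carrier Qq. null f}" for f g
    using that H.eqv_add[of _ 0 _ 0] by (simp add: null_def hasse.path_act_add)
  show "g \<cdot> f \<in> {f \<in> carrier Qq. null f}" if f: "f \<in> {f \<in> carrier Qq. null f}" and g: "g \<in> carrier Qq" for f g
  proof -
    have "act (g \<cdot> f) m k \<approx> 0" if "vec m" for m k
    proof -
      have "act f m u \<approx> 0" if "u \<in> \<Lambda>" for u
        using f \<open>vec m\<close> that by (auto simp: null_def)
      then show ?thesis
        using act_eqv[OF g, of "act f m" "\<lambda>_. 0" k] by (simp add: hasse.path_act_mult)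
    qed
    then show ?thesis using f g by (simp add: null_def)
  qed
  show "f \<cdot> g \<in> {f \<in> carrier Qq. null f}" if "f \<in> {f \<in> carrier Qq. null f}" "g \<in> carrier Qq" for f g
    using that vec_act by (auto simp: null_def hasse.path_act_mult)
qed (auto simp: hasse_quiver_wf null_def)

lemma null_relations: "f \<in> Q.I \<Longrightarrow> null f"
proof -
  have "l - r \<in> {f \<in> carrier Qq. null f}" if "(l, r) \<in> hasse_relations n" for l r
    using act_relation[OF that] that hasse_relations_closed[of n]
    by (auto simp: null_def hasse.path_act_diff H.eqv_def)
  then have "Q.I \<subseteq> {f \<in> carrier Qq. null f}" by (intro Q.I_minimal null_ideal)
  then show "f \<in> Q.I \<Longrightarrow> null f" by blast
qed

section \<open>A spanning set of the presented algebra\<close>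

lemma hasse_eqv:
  assumes "f \<in> carrier Qq"
  shows "letter i \<Longrightarrow> \<delta>\<^sub>1 i \<cdot> (\<upsilon>\<^sub>1 i \<cdot> f) \<simeq> (1 + \<q>) *\<^sub>Q (e\<^sub>Q {i} \<cdot> f)"
    and "letter i \<Longrightarrow> \<delta>\<^sub>2 i \<cdot> (\<upsilon>\<^sub>2 i \<cdot> f) \<simeq> (\<Sum>k<n. \<q> ^ k) *\<^sub>Q (e\<^sub>Q {1, 2} \<cdot> f)"
    and "letter i \<Longrightarrow> letter j \<Longrightarrow> \<upsilon>\<^sub>1 i \<cdot> (\<upsilon>\<^sub>2 i \<cdot> f) \<simeq> \<upsilon>\<^sub>1 j \<cdot> (\<upsilon>\<^sub>2 j \<cdot> f)"
    and "letter i \<Longrightarrow> letter j \<Longrightarrow> \<delta>\<^sub>2 i \<cdot> (\<delta>\<^sub>1 i \<cdot> f) \<simeq> \<delta>\<^sub>2 j \<cdot> (\<delta>\<^sub>1 j \<cdot> f)"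
    and "letter j \<Longrightarrow> \<upsilon>\<^sub>2 (first_letter j n) \<cdot> (\<delta>\<^sub>2 j \<cdot> f) \<simeq> \<zeta>\<^sub>Q j n \<cdot> f"
proof -
  note R = Q.eqv_mult_right[OF Q.eqv_relation assms, unfolded path_algebra_mult_smult path_algebra_mult_assoc]
  note rules = hasse_relation_rules[OF n2]
  show "letter i \<Longrightarrow> \<delta>\<^sub>1 i \<cdot> (\<upsilon>\<^sub>1 i \<cdot> f) \<simeq> (1 + \<q>) *\<^sub>Q (e\<^sub>Q {i} \<cdot> f)"
    using R[OF rules(1)] by (simp add: path_algebra_mult_assoc path_algebra_mult_smult)
  show "letter i \<Longrightarrow> \<delta>\<^sub>2 i \<cdot> (\<upsilon>\<^sub>2 i \<cdot> f) \<simeq> (\<Sum>k<n. \<q> ^ k) *\<^sub>Q (e\<^sub>Q {1, 2} \<cdot> f)"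
    using R[OF rules(2)] by (simp add: path_algebra_mult_assoc path_algebra_mult_smult)
  show "letter j \<Longrightarrow> \<upsilon>\<^sub>2 (first_letter j n) \<cdot> (\<delta>\<^sub>2 j \<cdot> f) \<simeq> \<zeta>\<^sub>Q j n \<cdot> f"
    using R[OF rules(5)] by (simp add: path_algebra_mult_assoc)
  have "\<upsilon>\<^sub>1 1 \<cdot> (\<upsilon>\<^sub>2 1 \<cdot> f) \<simeq> \<upsilon>\<^sub>1 2 \<cdot> (\<upsilon>\<^sub>2 2 \<cdot> f)" "\<delta>\<^sub>2 1 \<cdot> (\<delta>\<^sub>1 1 \<cdot> f) \<simeq> \<delta>\<^sub>2 2 \<cdot> (\<delta>\<^sub>1 2 \<cdot> f)"
    using R[OF rules(3)] R[OF rules(4)] by (simp_all add: path_algebra_mult_assoc)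
  then show "letter i \<Longrightarrow> letter j \<Longrightarrow> \<upsilon>\<^sub>1 i \<cdot> (\<upsilon>\<^sub>2 i \<cdot> f) \<simeq> \<upsilon>\<^sub>1 j \<cdot> (\<upsilon>\<^sub>2 j \<cdot> f)"
    "letter i \<Longrightarrow> letter j \<Longrightarrow> \<delta>\<^sub>2 i \<cdot> (\<delta>\<^sub>1 i \<cdot> f) \<simeq> \<delta>\<^sub>2 j \<cdot> (\<delta>\<^sub>1 j \<cdot> f)"
    using Q.eqv_sym by (auto simp: letter_def)
qed

text \<open>The sandwich relation moves the ascent to the side from which the path came down, and
  the resulting detour through the empty set contributes 1 + q. This leaves the recursion of the
  q-integers.\<close>

lemma delta_\<zeta>\<^sub>Q: "letter j \<Longrightarrow> \<delta>\<^sub>2 (first_letter j m) \<cdot> \<zeta>\<^sub>Q j m \<simeq> (\<Sum>k<m. \<q> ^ k) *\<^sub>Q \<delta>\<^sub>2 j"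
proof (induction j m rule: \<zeta>\<^sub>Q.induct)
  case (2 j)
  then show ?case by (simp add: arrow_e first_letter_simps path_algebra_smult_module)
next
  case (3 j m)
  let ?i = "first_letter j m"
  let ?z = "\<zeta>\<^sub>Q j (Suc m)"
  have i: "letter ?i" "first_letter j (Suc m) = 3 - ?i" using 3 by (simp_all add: first_letter_simps)
  have z: "?z \<in> carrier Qq" "e\<^sub>Q {3 - ?i} \<cdot> ?z = ?z"
    using 3(3) e_\<zeta>\<^sub>Q[of j "Suc m"] i(2) by auto
  have uz: "\<upsilon>\<^sub>1 (3 - ?i) \<cdot> ?z \<in> carrier Qq" using i(1) z(1) by auto
  have "\<delta>\<^sub>2 ?i \<cdot> (\<delta>\<^sub>1 ?i \<cdot> (\<upsilon>\<^sub>1 (3 - ?i) \<cdot> ?z)) \<simeq> \<delta>\<^sub>2 (3 - ?i) \<cdot> (\<delta>\<^sub>1 (3 - ?i) \<cdot> (\<upsilon>\<^sub>1 (3 - ?i) \<cdot> ?z))"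
    using i by (intro hasse_eqv(4) uz) auto
  also have "\<dots> \<simeq> \<delta>\<^sub>2 (3 - ?i) \<cdot> ((1 + \<q>) *\<^sub>Q (e\<^sub>Q {3 - ?i} \<cdot> ?z))"
    using i z by (intro Q.eqv_mult_left hasse_eqv(1)) auto
  also have "\<dots> = (1 + \<q>) *\<^sub>Q (\<delta>\<^sub>2 (3 - ?i) \<cdot> ?z)"
    by (simp only: z path_algebra_mult_smult)
  also have "\<dots> \<simeq> (1 + \<q>) *\<^sub>Q ((\<Sum>k<Suc m. \<q> ^ k) *\<^sub>Q \<delta>\<^sub>2 j)"
    using 3(1)[OF 3(3)] unfolding i(2) by (rule Q.eqv_smult)
  finally have top: "\<delta>\<^sub>2 ?i \<cdot> (\<delta>\<^sub>1 ?i \<cdot> (\<upsilon>\<^sub>1 (3 - ?i) \<cdot> ?z)) \<simeq> (1 + \<q>) *\<^sub>Q ((\<Sum>k<Suc m. \<q> ^ k) *\<^sub>Q \<delta>\<^sub>2 j)" .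
  have "\<delta>\<^sub>2 ?i \<cdot> \<zeta>\<^sub>Q j (Suc (Suc m))
      = \<delta>\<^sub>2 ?i \<cdot> (\<delta>\<^sub>1 ?i \<cdot> (\<upsilon>\<^sub>1 (3 - ?i) \<cdot> ?z)) - \<q> *\<^sub>Q (\<delta>\<^sub>2 ?i \<cdot> \<zeta>\<^sub>Q j m)"
    by (simp only: \<zeta>\<^sub>Q.simps path_algebra_mult_diff path_algebra_mult_smult)
  also have "\<dots> \<simeq> (1 + \<q>) *\<^sub>Q ((\<Sum>k<Suc m. \<q> ^ k) *\<^sub>Q \<delta>\<^sub>2 j) - \<q> *\<^sub>Q ((\<Sum>k<m. \<q> ^ k) *\<^sub>Q \<delta>\<^sub>2 j)"
    by (intro Q.eqv_diff Q.eqv_smult top 3(2) 3(3))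
  also have "\<dots> = (\<Sum>k<Suc (Suc m). \<q> ^ k) *\<^sub>Q \<delta>\<^sub>2 j"
    unfolding sum_q_rec[symmetric] by (simp only: path_algebra_smult_module(3,8))
  finally show ?case by (simp only: first_letter_simps)
qed (simp add: path_algebra_smult_module)

text \<open>\<open>down j J\<close> is the arrow or trivial path from \<open>J\<close> to \<open>{j}\<close>, for \<open>J = \<emptyset>\<close> or \<open>J = {j}\<close>;
  \<open>to_top J\<close> is a shortest path from \<open>J\<close> to \<open>{1, 2}\<close>.\<close>

definition down :: "nat \<Rightarrow> nat set \<Rightarrow> hasse_elt" where
  "down j J = (if J = {} then \<delta>\<^sub>1 j else e\<^sub>Q {j})"

definition to_top :: "nat set \<Rightarrow> hasse_elt" where
  "to_top J = (if J = {} then \<delta>\<^sub>2 1 \<cdot> \<delta>\<^sub>1 1 else if J = {1} then \<delta>\<^sub>2 1 else if J = {2} then \<delta>\<^sub>2 2 else e\<^sub>Q {1, 2})"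

definition from_top :: "nat set \<Rightarrow> hasse_elt \<Rightarrow> hasse_elt" where
  "from_top K f = (if K = {} then \<upsilon>\<^sub>1 1 \<cdot> (\<upsilon>\<^sub>2 1 \<cdot> f) else if K = {1} then \<upsilon>\<^sub>2 1 \<cdot> f
    else if K = {2} then \<upsilon>\<^sub>2 2 \<cdot> f else f)"

text \<open>\<open>lift (K, J, b)\<close> is an element of \<open>e\<^sub>K Q e\<^sub>J\<close> whose action maps \<open>x\<^sub>J\<close> to \<open>basis_elt b\<close>.\<close>

definition lift :: "nat set \<times> nat set \<times> nat \<times> nat \<Rightarrow> hasse_elt" where
  "lift = (\<lambda>(K, J, j, m). if m = 0 then e\<^sub>Q {} else if m = n then from_top K (to_top J)
     else if K = {} then \<upsilon>\<^sub>1 (first_letter j m) \<cdot> (\<zeta>\<^sub>Q j m \<cdot> down j J) else \<zeta>\<^sub>Q j m \<cdot> down j J)"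

text \<open>\<open>K\<close> has to lie in the left descent set and \<open>J\<close> in the right
  descent set of the group element of the slot. The longest element has all descents, hence no
  condition for \<open>m = n\<close>; the set {1, 2} admits no other slot.\<close>

definition compatible :: "nat set \<Rightarrow> nat set \<Rightarrow> nat \<times> nat \<Rightarrow> bool" where
  "compatible K J = (\<lambda>(j, m). m = n \<or> m = 0 \<and> K = {} \<and> J = {} \<or>
     0 < m \<and> m < n \<and> (K = {} \<or> K = {first_letter j m}) \<and> (J = {} \<or> J = {j}))"

definition lift_index :: "(nat set \<times> nat set \<times> nat \<times> nat) set" where
  "lift_index = {(K, J, b). K \<in> \<Lambda> \<and> J \<in> \<Lambda> \<and> b \<in> slots \<and> compatible K J b}"

lemma finite_lift_index: "finite lift_index"
  by (rule finite_subset[of _ "\<Lambda> \<times> \<Lambda> \<times> slots"]) (auto simp: lift_index_def)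

lemma from_top_simps:
  "from_top {} f = \<upsilon>\<^sub>1 1 \<cdot> (\<upsilon>\<^sub>2 1 \<cdot> f)" "letter i \<Longrightarrow> from_top {i} f = \<upsilon>\<^sub>2 i \<cdot> f" "from_top {1, 2} f = f"
  by (auto simp: from_top_def letter_def doubleton_eq_iff)

lemma to_top_simps:
  "to_top {} = \<delta>\<^sub>2 1 \<cdot> \<delta>\<^sub>1 1" "letter i \<Longrightarrow> to_top {i} = \<delta>\<^sub>2 i" "to_top {1, 2} = e\<^sub>Q {1, 2}"
  by (auto simp: to_top_def letter_def doubleton_eq_iff)

lemma lift_index_cases:
  assumes "(K, J, b) \<in> lift_index"
  obtains (unit) "b = (0, 0)" "K = {}" "J = {}"
    | (top) "b = (0, n)"
    | (inner) j m where "b = (j, m)" "letter j" "1 \<le> m" "m < n" "K = {} \<or> K = {first_letter j m}"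
        "J = {} \<or> J = {j}"
proof -
  have b: "b \<in> slots" "compatible K J b" using assms by (auto simp: lift_index_def)
  from b(1) show thesis
    by (cases rule: slots_cases) (use b(2) n2 that in \<open>auto simp: compatible_def\<close>)
qed

lemma lift_simps:
  "lift (K, J, 0, 0) = e\<^sub>Q {}"
  "lift (K, J, 0, n) = from_top K (to_top J)"
  "1 \<le> m \<Longrightarrow> m < n \<Longrightarrow> lift ({}, J, j, m) = \<upsilon>\<^sub>1 (first_letter j m) \<cdot> (\<zeta>\<^sub>Q j m \<cdot> down j J)"
  "1 \<le> m \<Longrightarrow> m < n \<Longrightarrow> lift ({i}, J, j, m) = \<zeta>\<^sub>Q j m \<cdot> down j J"
  using n2 by (simp_all add: lift_def)

lemma down_closed [simp, intro]: "letter j \<Longrightarrow> down j J \<in> carrier Qq"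
  by (simp add: down_def)

lemma to_top_closed [simp, intro]: "to_top J \<in> carrier Qq"
  by (auto simp: to_top_def simp del: One_nat_def)

lemma e_to_top: "e\<^sub>Q {1, 2} \<cdot> to_top J = to_top J"
  using e_arrow_mult[of "Delta {1, 2} {1}"]
  by (auto simp: to_top_def e_arrow e_mult simp del: One_nat_def)

lemma delta_down:
  assumes "letter j" "J = {} \<or> J = {j}"
  shows "\<delta>\<^sub>2 j \<cdot> down j J \<simeq> to_top J"
  using assms(2)
proof
  assume J: "J = {}"
  have "\<delta>\<^sub>2 j \<cdot> (\<delta>\<^sub>1 j \<cdot> e\<^sub>Q {}) \<simeq> \<delta>\<^sub>2 1 \<cdot> (\<delta>\<^sub>1 1 \<cdot> e\<^sub>Q {})"
    using assms(1) by (intro hasse_eqv(4)) auto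
  then show ?thesis unfolding J by (simp add: down_def to_top_def arrow_e del: One_nat_def)
next
  assume "J = {j}"
  then show ?thesis using assms(1) by (simp add: down_def to_top_simps arrow_e)
qed

lemma e_lift:
  assumes "(K, J, b) \<in> lift_index"
  shows "e\<^sub>Q K \<cdot> lift (K, J, b) = lift (K, J, b)"
  using assms
proof (cases rule: lift_index_cases)
  case unit
  then show ?thesis by (simp add: lift_simps e_mult)
next
  case top
  have "K \<in> \<Lambda>" using assms by (simp add: lift_index_def)
  then show ?thesis
    using e_arrow_mult[of "Upsilon {} {1}"]
    by (cases rule: vertex_cases)
      (simp_all add: top lift_simps from_top_simps(1,2) from_top_simps(3)[unfolded One_nat_def]
        e_to_top[unfolded One_nat_def] e_arrow_mult[of "Upsilon {_} {Suc 0, 2}", simplified])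
next
  case (inner j m)
  then show ?thesis
    using e_arrow_mult[of "Upsilon {} {first_letter j m}"]
    by (auto simp: lift_simps path_algebra_mult_assoc[symmetric] e_\<zeta>\<^sub>Q e_arrow)
qed

lemma lift_e:
  assumes "(K, J, b) \<in> lift_index"
  shows "lift (K, J, b) \<cdot> e\<^sub>Q J = lift (K, J, b)"
  using assms
proof (cases rule: lift_index_cases)
  case unit
  then show ?thesis by (simp add: lift_simps e_mult)
next
  case top
  have "J \<in> \<Lambda>" using assms by (simp add: lift_index_def)
  then have J: "to_top J \<cdot> e\<^sub>Q J = to_top J"
    by (cases rule: vertex_cases)
       (auto simp: to_top_simps(1,2) to_top_simps(3)[unfolded One_nat_def] arrow_e e_mult path_algebra_mult_assoc)
  have "from_top K f \<cdot> e\<^sub>Q J = from_top K (f \<cdot> e\<^sub>Q J)" for f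
    by (simp add: from_top_def path_algebra_mult_assoc)
  then show ?thesis by (simp add: top lift_simps J)
next
  case (inner j m)
  then have "down j J \<cdot> e\<^sub>Q J = down j J" by (auto simp: down_def arrow_e e_mult)
  then show ?thesis using inner(3-5)
    by (auto simp: inner(1) lift_simps path_algebra_mult_assoc)
qed

lemma lift_closed: "(K, J, b) \<in> lift_index \<Longrightarrow> lift (K, J, b) \<in> carrier Qq"
proof -
  assume "(K, J, b) \<in> lift_index"
  then show ?thesis
  proof (cases rule: lift_index_cases)
    case unit
    then show ?thesis by (simp add: lift_simps)
  next
    case top
    then show ?thesis by (auto simp: lift_simps from_top_def simp del: One_nat_def)
  next
    case (inner j m)
    then show ?thesis using inner(3-5) by (auto simp: lift_simps)
  qed
qed

abbreviation spanned_by_lifts :: "hasse_elt \<Rightarrow> bool" where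
  "spanned_by_lifts \<equiv> Q.in_span lift lift_index"

lemma spanned_lift: "p \<in> lift_index \<Longrightarrow> spanned_by_lifts (lift p)"
  by (rule Q.in_span_base[OF finite_lift_index])

lemma top_in_lift_index: "K \<in> \<Lambda> \<Longrightarrow> J \<in> \<Lambda> \<Longrightarrow> (K, J, 0, n) \<in> lift_index"
  by (simp add: lift_index_def slots_def compatible_def)

lemma spanned_top: "K \<in> \<Lambda> \<Longrightarrow> J \<in> \<Lambda> \<Longrightarrow> spanned_by_lifts (from_top K (to_top J))"
  using spanned_lift[OF top_in_lift_index, of K J] by (simp only: lift_simps)

lemma letter_verts: "letter i \<Longrightarrow> {i} \<in> \<Lambda>"
  by (auto simp: letter_def)

text \<open>Length n is included on purpose: there the refined braid relation replaces the
  alternating paths by a path through {1, 2}, which keeps all lengths bounded.\<close>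

lemma spanned_\<zeta>\<^sub>Q:
  assumes "letter j" "m \<le> n" "J = {} \<or> J = {j}"
  shows "spanned_by_lifts (\<zeta>\<^sub>Q j m \<cdot> down j J)"
proof -
  let ?i = "first_letter j m"
  have i: "letter ?i" using assms by simp
  have J: "J \<in> \<Lambda>" using assms by (auto simp: letter_def)
  consider "m = 0" | "m = n" | "1 \<le> m" "m < n" using assms(2) by linarith
  then show ?thesis
  proof cases
    case 1
    then show ?thesis by (simp add: Q.in_span_zero)
  next
    case 2
    have "\<zeta>\<^sub>Q j n \<cdot> down j J \<simeq> \<upsilon>\<^sub>2 (first_letter j n) \<cdot> (\<delta>\<^sub>2 j \<cdot> down j J)"
      using assms(1) by (intro Q.eqv_sym[OF hasse_eqv(5)]) auto
    also have "\<dots> \<simeq> \<upsilon>\<^sub>2 (first_letter j n) \<cdot> to_top J"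
      using assms by (intro Q.eqv_mult_left delta_down) auto
    finally show ?thesis
      using 2 i spanned_top[OF letter_verts[OF i] J] Q.in_span_eqv by (simp add: from_top_simps)
  next
    case 3
    then have "({?i}, J, j, m) \<in> lift_index"
      using assms i J letter_verts[OF i] by (auto simp: lift_index_def slots_def compatible_def letter_def)
    then show ?thesis using spanned_lift[of "({?i}, J, j, m)"] 3 by (simp add: lift_simps)
  qed
qed

text \<open>An arrow from the empty set to {i} either follows a descent from {i}, giving 1 + q, or
  lengthens the word by the recursion of \<open>\<zeta>\<^sub>Q\<close>. Descending from {i} gives a
  lift again. Ascending to {1, 2} leaves a multiple of \<open>to_top J\<close>, and descending from
  {1, 2} concerns only the top slot.\<close>

lemma spanned_arrow_lift:
  assumes a: "a \<in> arcs hasse_quiver" and p: "(arrow_tail a, J, b) \<in> lift_index"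
  shows "spanned_by_lifts (arrow_elt hasse_quiver a \<cdot> lift (arrow_tail a, J, b))"
proof -
  have J: "J \<in> \<Lambda>" using p by (simp add: lift_index_def)
  from a show ?thesis
  proof (cases rule: hasse_arcs_cases)
    case (1 i)
    from p have "({}, J, b) \<in> lift_index" using 1 by simp
    then have "spanned_by_lifts (\<delta>\<^sub>1 i \<cdot> lift ({}, J, b))"
    proof (cases rule: lift_index_cases)
      case unit
      have "spanned_by_lifts (\<zeta>\<^sub>Q i 1 \<cdot> down i {})" using 1 n2 by (intro spanned_\<zeta>\<^sub>Q) auto
      then show ?thesis using unit by (simp add: lift_simps arrow_e down_def e_arrow)
    next
      case top
      have "\<delta>\<^sub>1 i \<cdot> (\<upsilon>\<^sub>1 1 \<cdot> (\<upsilon>\<^sub>2 1 \<cdot> to_top J)) \<simeq> \<delta>\<^sub>1 i \<cdot> (\<upsilon>\<^sub>1 i \<cdot> (\<upsilon>\<^sub>2 i \<cdot> to_top J))"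
        using 1 by (intro Q.eqv_mult_left hasse_eqv(3)) auto
      also have "\<dots> \<simeq> (1 + \<q>) *\<^sub>Q (e\<^sub>Q {i} \<cdot> (\<upsilon>\<^sub>2 i \<cdot> to_top J))"
        using 1 by (intro hasse_eqv(1)) auto
      also have "\<dots> = (1 + \<q>) *\<^sub>Q from_top {i} (to_top J)"
        using 1 e_arrow_mult[of "Upsilon {i} {1, 2}"] by (simp add: from_top_simps)
      finally have "\<delta>\<^sub>1 i \<cdot> lift ({}, J, b) \<simeq> (1 + \<q>) *\<^sub>Q from_top {i} (to_top J)"
        by (simp only: top lift_simps from_top_simps)
      then show ?thesis
        using 1 J letter_verts by (intro Q.in_span_eqv[OF Q.in_span_smult[OF spanned_top]]) auto
    next
      case (inner j m)
      let ?i = "first_letter j m"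
      have lift: "lift ({}, J, b) = \<upsilon>\<^sub>1 ?i \<cdot> (\<zeta>\<^sub>Q j m \<cdot> down j J)" using inner by (simp add: lift_simps)
      have z: "\<zeta>\<^sub>Q j m \<cdot> down j J \<in> carrier Qq" using inner by auto
      show ?thesis
      proof (cases "?i = i")
        case True
        have "\<delta>\<^sub>1 i \<cdot> lift ({}, J, b) \<simeq> (1 + \<q>) *\<^sub>Q (e\<^sub>Q {i} \<cdot> (\<zeta>\<^sub>Q j m \<cdot> down j J))"
          unfolding lift True using 1 z by (intro hasse_eqv(1)) auto
        also have "e\<^sub>Q {i} \<cdot> (\<zeta>\<^sub>Q j m \<cdot> down j J) = \<zeta>\<^sub>Q j m \<cdot> down j J"
          using e_\<zeta>\<^sub>Q[of j m] inner True by (simp add: path_algebra_mult_assoc[symmetric])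
        finally show ?thesis
          using inner by (intro Q.in_span_eqv[OF Q.in_span_smult[OF spanned_\<zeta>\<^sub>Q]]) auto
      next
        case False
        obtain l where m: "m = Suc l" using inner by (cases m) auto
        have i: "i = first_letter j l" "?i = 3 - first_letter j l"
          using letter_cases[of ?i i] False 1 inner by (auto simp: m first_letter_simps)
        have "\<delta>\<^sub>1 i \<cdot> lift ({}, J, b) = \<zeta>\<^sub>Q j (Suc m) \<cdot> down j J + \<q> *\<^sub>Q (\<zeta>\<^sub>Q j l \<cdot> down j J)"
          unfolding lift i by (simp add: m path_algebra_expand)
        then show ?thesis
          using inner m by (simp del: \<zeta>\<^sub>Q.simps) (intro Q.in_span_add Q.in_span_smult spanned_\<zeta>\<^sub>Q; simp)
      qed
    qed
    then show ?thesis by (simp add: 1)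
  next
    case (2 i)
    from p have p': "({i}, J, b) \<in> lift_index" using 2 by simp
    then have "spanned_by_lifts (\<upsilon>\<^sub>1 i \<cdot> lift ({i}, J, b))"
    proof (cases rule: lift_index_cases)
      case top
      have "\<upsilon>\<^sub>1 i \<cdot> lift ({i}, J, b) \<simeq> from_top {} (to_top J)"
        unfolding top lift_simps from_top_simps(1) from_top_simps(2)[OF 2(1)]
        using 2 by (intro hasse_eqv(3)) auto
      then show ?thesis using J by (intro Q.in_span_eqv[OF spanned_top]) auto
    next
      case (inner j m)
      have "i = first_letter j m" using inner by auto
      moreover have "({}, J, j, m) \<in> lift_index"
        using inner J by (auto simp: lift_index_def slots_def compatible_def letter_def)
      ultimately show ?thesis
        using spanned_lift[of "({}, J, j, m)"] inner by (simp add: lift_simps)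
    qed simp
    then show ?thesis by (simp add: 2)
  next
    case (3 i)
    from p have p': "({i}, J, b) \<in> lift_index" using 3 by simp
    have top12: "spanned_by_lifts (to_top J)"
      using spanned_top[of "{1, 2}" J] J by (simp only: from_top_simps) simp
    from p' have "spanned_by_lifts (\<delta>\<^sub>2 i \<cdot> lift ({i}, J, b))"
    proof (cases rule: lift_index_cases)
      case top
      have "\<delta>\<^sub>2 i \<cdot> lift ({i}, J, b) \<simeq> (\<Sum>k<n. \<q> ^ k) *\<^sub>Q (e\<^sub>Q {1, 2} \<cdot> to_top J)"
        unfolding top lift_simps from_top_simps(2)[OF 3(1)]
        using 3 by (intro hasse_eqv(2)) auto
      then show ?thesis unfolding e_to_top
        by (rule Q.in_span_eqv[OF Q.in_span_smult[OF top12]])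
    next
      case (inner j m)
      have i: "i = first_letter j m" using inner by auto
      have "\<delta>\<^sub>2 i \<cdot> lift ({i}, J, b) = (\<delta>\<^sub>2 (first_letter j m) \<cdot> \<zeta>\<^sub>Q j m) \<cdot> down j J"
        using inner by (simp add: i lift_simps path_algebra_mult_assoc)
      also have "\<dots> \<simeq> ((\<Sum>k<m. \<q> ^ k) *\<^sub>Q \<delta>\<^sub>2 j) \<cdot> down j J"
        using inner by (intro Q.eqv_mult_right delta_\<zeta>\<^sub>Q) auto
      also have "\<dots> = (\<Sum>k<m. \<q> ^ k) *\<^sub>Q (\<delta>\<^sub>2 j \<cdot> down j J)" by (simp only: path_algebra_mult_smult)
      also have "\<dots> \<simeq> (\<Sum>k<m. \<q> ^ k) *\<^sub>Q to_top J"
        using inner by (intro Q.eqv_smult delta_down) auto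
      finally show ?thesis by (rule Q.in_span_eqv[OF Q.in_span_smult[OF top12]])
    qed simp
    then show ?thesis by (simp add: 3)
  next
    case (4 i)
    from p have p': "({1, 2}, J, b) \<in> lift_index" using 4 by simp
    then have "spanned_by_lifts (\<upsilon>\<^sub>2 i \<cdot> lift ({1, 2}, J, b))"
    proof (cases rule: lift_index_cases)
      case top
      have "\<upsilon>\<^sub>2 i \<cdot> lift ({1, 2}, J, b) = from_top {i} (to_top J)"
        unfolding top lift_simps from_top_simps(3) from_top_simps(2)[OF 4(1)] ..
      then show ?thesis using spanned_top[OF letter_verts[OF 4(1)] J] by simp
    next
      case (inner j m)
      have "{1, 2} \<noteq> {first_letter j m}"
        using doubleton_eq_iff[of 1 2 "first_letter j m" "first_letter j m"] by auto
      then show ?thesis using inner by auto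
    qed simp
    then show ?thesis by (simp add: 4)
  qed
qed

lemma spanned_by_lifts_all: "f \<in> carrier Qq \<Longrightarrow> spanned_by_lifts f"
  using hasse_quiver_wf(2)
proof (induction f rule: path_algebra_induct)
  case (trivial v)
  then have "v \<in> \<Lambda>" by (simp add: hasse_verts)
  then show ?case
  proof (cases rule: vertex_cases)
    case 1
    have "({}, {}, 0, 0) \<in> lift_index" by (simp add: lift_index_def slots_def compatible_def)
    then show ?thesis using spanned_lift[of "({}, {}, 0, 0)"] 1 by (simp add: lift_simps)
  next
    case (2 i)
    have "spanned_by_lifts (\<zeta>\<^sub>Q i 1 \<cdot> down i {i})" using 2 n2 by (intro spanned_\<zeta>\<^sub>Q) auto
    then show ?thesis using 2 by (simp add: down_def e_mult)
  next
    case 3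
    have "from_top {1, 2} (to_top {1, 2}) = e\<^sub>Q v"
      unfolding from_top_simps(3) to_top_simps(3) 3 ..
    then show ?thesis using spanned_top[of "{1, 2}" "{1, 2}"] by simp
  qed
next
  case (arrow a f)
  then obtain v where v: "f \<simeq> (\<Sum>p\<in>lift_index. v p *\<^sub>Q lift p)" by (auto simp: Q.in_span_def)
  have aQ: "arrow_elt hasse_quiver a \<in> carrier Qq"
    using arrow(1) by (intro arrow_elt_closed hasse_quiver_wf)
  have "arrow_elt hasse_quiver a \<cdot> f \<simeq> arrow_elt hasse_quiver a \<cdot> (\<Sum>p\<in>lift_index. v p *\<^sub>Q lift p)"
    by (intro Q.eqv_mult_left v aQ)
  also have "\<dots> = (\<Sum>p\<in>lift_index. v p *\<^sub>Q (arrow_elt hasse_quiver a \<cdot> lift p))"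
    by (simp add: path_algebra_mult_sum_right path_algebra_mult_smult)
  finally have eq: "arrow_elt hasse_quiver a \<cdot> f \<simeq> (\<Sum>p\<in>lift_index. v p *\<^sub>Q (arrow_elt hasse_quiver a \<cdot> lift p))" .
  have "spanned_by_lifts (arrow_elt hasse_quiver a \<cdot> lift p)" if "p \<in> lift_index" for p
  proof -
    obtain K J b where p: "p = (K, J, b)" by (metis prod.exhaust)
    show ?thesis
    proof (cases "K = arrow_tail a")
      case True
      then show ?thesis using spanned_arrow_lift[OF arrow(1)] that p by simp
    next
      case False
      have "arrow_elt hasse_quiver a \<cdot> lift p = (arrow_elt hasse_quiver a \<cdot> e\<^sub>Q K) \<cdot> lift p"
        using e_lift that p by (simp add: path_algebra_mult_assoc)
      also have "\<dots> = 0" using False by (simp add: arrow_e)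
      finally show ?thesis by (simp add: Q.in_span_zero)
    qed
  qed
  then show ?case by (intro Q.in_span_eqv[OF _ eq] Q.in_span_sum Q.in_span_smult)
qed (auto intro: Q.in_span_add Q.in_span_smult Q.in_span_zero)

section \<open>Action of the lifts on generators, and faithfulness\<close>

definition x_at :: "nat set \<Rightarrow> nat set \<Rightarrow> free_elt" where
  "x_at J = (\<lambda>K. if K = J then x_rep J else 0)"

lemma vec_x_at: "vec (x_at J)"
  unfolding vec_def x_at_def
  by (auto simp: module_at_zero) (auto simp: module_at_def intro!: bexI[of _ "\<one>\<^sub>F"])

lemma act_down:
  assumes "letter j" "J = {} \<or> J = {j}"
  shows "act (down j J) (x_at J) {j} = \<xi> j"
  using assms by (auto simp: down_def hasse.path_act_arrow hasse.path_act_trivial arrow_map_Delta x_at_def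
    x_rep_simps simp del: arrow_map.simps(1))

lemma act_to_top:
  assumes "J \<in> \<Lambda>"
  shows "act (to_top J) (x_at J) {1, 2} \<approx> c\<^sub>F 1 n"
  using assms
proof (cases rule: vertex_cases)
  case 1
  have "act (to_top J) (x_at J) {1, 2} = \<zeta> 1 n \<star> (\<xi> 1 \<star> \<one>\<^sub>F)"
    by (simp add: 1 to_top_simps(1) act_arrow_mult hasse.path_act_arrow arrow_map_Delta x_at_def x_rep_simps
       del: arrow_map.simps(1) One_nat_def)
  then show ?thesis by (simp add: c\<^sub>F_def del: One_nat_def)
next
  case (2 i)
  then have "act (to_top J) (x_at J) {1, 2} = c\<^sub>F i n"
    by (simp add: to_top_simps(2) hasse.path_act_arrow arrow_map_Delta x_at_def x_rep_simps c\<^sub>F_def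
       del: arrow_map.simps(1) One_nat_def)
  then show ?thesis using c_top 2 by simp
next
  case 3
  have "act (to_top J) (x_at J) {1, 2} = c\<^sub>F 1 n"
    unfolding 3 to_top_simps(3) by (simp add: hasse.path_act_trivial x_at_def x_rep_simps(3) del: One_nat_def)
  then show ?thesis by simp
qed

lemma act_lift_same:
  assumes p: "(K, J, b) \<in> lift_index"
  shows "act (lift (K, J, b)) (x_at J) K \<approx> basis_elt b"
  using p
proof (cases rule: lift_index_cases)
  case unit
  then show ?thesis by (simp add: lift_simps hasse.path_act_trivial x_at_def x_rep_simps basis_elt_def)
next
  case top
  have J: "J \<in> \<Lambda>" and K: "K \<in> \<Lambda>" using p by (simp_all add: lift_index_def)
  from K have "act (from_top K f) m K = act f m {1, 2}" for f m
    by (cases rule: vertex_cases)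
       (simp_all add: from_top_simps(1,2) from_top_simps(3)[unfolded One_nat_def] act_arrow_mult)
  then show ?thesis using act_to_top[OF J] n2 by (simp add: top lift_simps basis_elt_def)
next
  case (inner j m)
  let ?m = "act (down j J) (x_at J)"
  have m: "?m {j} = \<xi> j" using act_down inner by auto
  have "act (\<zeta>\<^sub>Q j m \<cdot> down j J) (x_at J) {first_letter j m} = c\<^sub>F j m"
    using act_\<zeta>\<^sub>Q[of j ?m m] inner by (simp add: hasse.path_act_mult m c\<^sub>F_def)
  then have "act (lift (K, J, b)) (x_at J) K = c\<^sub>F j m"
    using inner(3-5) by (auto simp: inner(1) lift_simps act_arrow_mult)
  then show ?thesis using inner by (simp add: basis_elt_def)
qed

lemma act_lift:
  assumes p: "(K, J, b) \<in> lift_index"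
  shows "act (lift (K, J, b)) (x_at J') k \<approx> (if k = K \<and> J' = J then basis_elt b else 0)"
proof (cases "k = K \<and> J' = J")
  case True
  then show ?thesis using act_lift_same[OF p] by simp
next
  case False
  have "act (lift (K, J, b)) (x_at J') k = act (e\<^sub>Q K \<cdot> (lift (K, J, b) \<cdot> e\<^sub>Q J)) (x_at J') k"
    using e_lift[OF p] lift_e[OF p] by simp
  also have "\<dots> = 0"
  proof (cases "J' = J")
    case True
    then show ?thesis using False by (simp add: hasse.path_act_mult hasse.path_act_trivial)
  next
    case False
    then have "act (e\<^sub>Q J) (x_at J') = (\<lambda>_. 0)" by (auto simp: hasse.path_act_trivial x_at_def)
    then show ?thesis
      unfolding path_algebra_mult_assoc[symmetric] by (subst hasse.path_act_mult) simp
  qed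
  finally show ?thesis using False by auto
qed

text \<open>Evaluation at \<open>x_at J\<close> and projection to the component \<open>K\<close>
  isolate the lifts for this pair of vertices, and those have distinct basis elements as
  images.\<close>

lemma act_lift_sum:
  assumes "K \<in> \<Lambda>" "J \<in> \<Lambda>"
  shows "act (\<Sum>p\<in>lift_index. v p *\<^sub>Q lift p) (x_at J) K \<approx>
    (\<Sum>b\<in>slots. (if compatible K J b then v (K, J, b) else 0) *\<^sub>F basis_elt b)"
proof -
  have "act (\<Sum>p\<in>lift_index. v p *\<^sub>Q lift p) (x_at J) K = (\<Sum>p\<in>lift_index. v p *\<^sub>F act (lift p) (x_at J) K)"
    by (simp add: hasse.path_act_sum hasse.path_act_smult)
  also have "\<dots> \<approx> (\<Sum>p\<in>lift_index. v p *\<^sub>F (if fst p = K \<and> fst (snd p) = J then basis_elt (snd (snd p)) else 0))"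
  proof (intro H.eqv_sum H.eqv_smult)
    fix p assume "p \<in> lift_index"
    then show "act (lift p) (x_at J) K \<approx> (if fst p = K \<and> fst (snd p) = J then basis_elt (snd (snd p)) else 0)"
      using act_lift[of "fst p" "fst (snd p)" "snd (snd p)" J K] by (simp add: eq_commute)
  qed
  also have "\<dots> = (\<Sum>p\<in>(\<lambda>b. (K, J, b)) ` {b \<in> slots. compatible K J b}. v p *\<^sub>F basis_elt (snd (snd p)))"
    using finite_lift_index assms
    by (intro sum.mono_neutral_cong_right) (auto simp: lift_index_def path_algebra_smult_module)
  also have "\<dots> = (\<Sum>b\<in>{b \<in> slots. compatible K J b}. v (K, J, b) *\<^sub>F basis_elt b)"
    by (subst sum.reindex) (auto simp: inj_on_def)
  also have "\<dots> = (\<Sum>b\<in>slots. (if compatible K J b then v (K, J, b) else 0) *\<^sub>F basis_elt b)"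
    by (intro sum.mono_neutral_cong_left) (auto simp: path_algebra_smult_module)
  finally show ?thesis .
qed

lemma null_iff:
  assumes f: "f \<in> carrier Qq"
  shows "null f \<longleftrightarrow> f \<in> Q.I"
proof
  assume null: "null f"
  obtain v where v: "f \<simeq> (\<Sum>p\<in>lift_index. v p *\<^sub>Q lift p)"
    using spanned_by_lifts_all[OF f] by (auto simp: Q.in_span_def)
  have "v p = 0" if p: "p \<in> lift_index" for p
  proof -
    obtain K J b where pe: "p = (K, J, b)" by (metis prod.exhaust)
    have p': "K \<in> \<Lambda>" "J \<in> \<Lambda>" "b \<in> slots" "compatible K J b"
      using p by (simp_all add: pe lift_index_def)
    have "null (f - (\<Sum>p\<in>lift_index. v p *\<^sub>Q lift p))"
      using v null_relations by (simp add: Q.eqv_def)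
    then have "act f (x_at J) K - act (\<Sum>p\<in>lift_index. v p *\<^sub>Q lift p) (x_at J) K \<approx> 0"
      using p' vec_x_at by (simp add: null_def hasse.path_act_diff)
    then have "act f (x_at J) K \<approx> act (\<Sum>p\<in>lift_index. v p *\<^sub>Q lift p) (x_at J) K"
      by (simp add: H.eqv_def)
    also have "\<dots> \<approx> (\<Sum>b\<in>slots. (if compatible K J b then v (K, J, b) else 0) *\<^sub>F basis_elt b)"
      by (rule act_lift_sum) fact+
    finally have "0 \<approx> (\<Sum>b\<in>slots. (if compatible K J b then v (K, J, b) else 0) *\<^sub>F basis_elt b)"
      using null p' vec_x_at H.eqv_sym H.eqv_trans unfolding null_def by blast
    from coord_sum_basis[OF this p'(3)] show ?thesis
      using p' by (simp add: pe coord_simps)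
  qed
  then have "(\<Sum>p\<in>lift_index. v p *\<^sub>Q lift p) = 0"
    by (intro sum.neutral) (simp add: path_algebra_smult_module)
  then show "f \<in> Q.I" using v by (simp add: Q.eqv_def)
qed (rule null_relations)

section \<open>The isomorphism\<close>

(* Otherwise simp turns the 1 in Lambda = Pow {1, 2} into Suc 0 and rules about Lambda no longer match. *)
declare One_nat_def [simp del]

section \<open>Coordinates of images of the generators\<close>

lemma module_at_subset:
  assumes "K \<in> \<Lambda>" "i \<in> K" "module_at K f"
  shows "letter i \<and> module_at {i} f"
proof -
  have i: "letter i" using assms by (auto simp: letter_def)
  from assms(1) show ?thesis
  proof (cases rule: vertex_cases)
    case 3
    have "Upsilon {i} {1, 2} \<in> arcs hasse_quiver" using i by (auto simp: hasse_quiver_def letter_def)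
    from module_at_arrow[OF this, of f] show ?thesis using i assms(3) 3 by simp
  qed (use assms i in auto)
qed

lemma coord_zero_left:
  assumes "letter i" "module_at {i} z"
  shows "coord z (0, 0) = 0"
    "letter j \<Longrightarrow> 1 \<le> m \<Longrightarrow> m < n \<Longrightarrow> first_letter j m \<noteq> i \<Longrightarrow> coord z (j, m) = 0"
proof -
  obtain h where "z \<approx> \<xi> i \<star> h" using assms by (auto simp: module_at_def x_rep_simps)
  then have "coord z = left_op i (coord h)" using coord_eqv by (auto simp: coord_simps)
  then show "coord z (0, 0) = 0"
    "letter j \<Longrightarrow> 1 \<le> m \<Longrightarrow> m < n \<Longrightarrow> first_letter j m \<noteq> i \<Longrightarrow> coord z (j, m) = 0"
    by (simp_all add: left_op_slots)
qed

text \<open>\<open>right_op i\<close> returns zero at the identity and at words below the top that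
  do not end in \<open>i\<close>, so 1 + q times the coordinate is zero there. Now 1 + q is nonzero
  and Z[q] is an integral domain.\<close>

lemma coord_zero_right:
  assumes "letter i" "z \<in> carrier free_alg" "z \<star> \<xi> i \<approx> (1 + \<q>) *\<^sub>F z"
  shows "coord z (0, 0) = 0"
    "letter j \<Longrightarrow> 1 \<le> m \<Longrightarrow> m < n \<Longrightarrow> j \<noteq> i \<Longrightarrow> coord z (j, m) = 0"
proof -
  have nz: "1 + \<q> \<noteq> 0" by (simp add: \<q>_def one_pCons)
  have "right_op i (coord z) = (\<lambda>b. (1 + \<q>) * coord z b)"
    using coord_eqv[OF assms(3)] coord_mult_xi[OF assms(1,2)] by (simp only: coord_simps(5))
  then have eq: "right_op i (coord z) b = (1 + \<q>) * coord z b" for b by simp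
  show "coord z (0, 0) = 0" using eq[of "(0, 0)"] nz by (simp only: right_op_slots) simp
  show "coord z (j, m) = 0" if "letter j" "1 \<le> m" "m < n" "j \<noteq> i"
  proof -
    have "right_op i (coord z) (j, m) = 0" using that by (simp add: right_op_slots)
    then show ?thesis using eq[of "(j, m)"] nz by simp
  qed
qed

lemma x_rep_xi:
  assumes "J \<in> \<Lambda>" "i \<in> J"
  shows "x_rep J \<star> \<xi> i \<approx> (1 + \<q>) *\<^sub>F x_rep J"
proof -
  have i: "letter i" using assms by (auto simp: letter_def)
  from assms(1) show ?thesis
  proof (cases rule: vertex_cases)
    case (2 j)
    then show ?thesis using assms(2) xi_xi[OF i] by (simp add: x_rep_simps)
  next
    case 3
    have "c\<^sub>F 1 n \<star> \<xi> i \<approx> c\<^sub>F i n \<star> \<xi> i" using i by (intro H.eqv_mult_right c_top) auto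
    also have "\<dots> \<approx> (1 + \<q>) *\<^sub>F c\<^sub>F i n" by (rule c_xi[OF i])
    also have "\<dots> \<approx> (1 + \<q>) *\<^sub>F c\<^sub>F 1 n" using i by (intro H.eqv_smult c_top) auto
    finally show ?thesis unfolding 3 x_rep_simps(3) .
  qed (use assms in auto)
qed

text \<open>If a slot below the top is not compatible, some element of \<open>K\<close> is not its
  first letter or some element of \<open>J\<close> is not its last letter; each possibility forces
  the coordinate to vanish.\<close>

lemma coord_incompatible:
  assumes K: "K \<in> \<Lambda>" and J: "J \<in> \<Lambda>" and b: "b \<in> slots" "\<not> compatible K J b"
    and left: "module_at K z" and right: "\<And>i. i \<in> J \<Longrightarrow> z \<star> \<xi> i \<approx> (1 + \<q>) *\<^sub>F z"
  shows "coord z b = 0"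
proof -
  have z: "z \<in> carrier free_alg" using left by (rule module_at_closed)
  have L: "letter i" "module_at {i} z" if "i \<in> K" for i
    using module_at_subset[OF K that left] by auto
  have J': "letter i" if "i \<in> J" for i using J that by (auto simp: letter_def)
  from b(1) show ?thesis
  proof (cases rule: slots_cases)
    case 1
    then have "K \<noteq> {} \<or> J \<noteq> {}" using b(2) by (auto simp: compatible_def)
    then show ?thesis
      using coord_zero_left(1)[OF L] coord_zero_right(1)[OF J' z right] 1 by blast
  next
    case 2
    then show ?thesis using b(2) by (simp add: compatible_def)
  next
    case (3 j m)
    then have "K \<noteq> {} \<and> K \<noteq> {first_letter j m} \<or> J \<noteq> {} \<and> J \<noteq> {j}"
      using b(2) by (simp add: compatible_def)
    then have "\<not> K \<subseteq> {first_letter j m} \<or> \<not> J \<subseteq> {j}" by (simp add: subset_singleton_iff)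
    then have "(\<exists>i\<in>K. first_letter j m \<noteq> i) \<or> (\<exists>i\<in>J. j \<noteq> i)"
      unfolding subset_eq by (metis singletonI)
    then show ?thesis
      using coord_zero_left(2)[OF L 3(2-4)] coord_zero_right(2)[OF J' z right 3(2-4)] 3(1) by blast
  qed
qed

section \<open>From representatives to the direct sum and its endomorphisms\<close>

definition module_sum :: "(nat set \<Rightarrow> free_elt set) set" where
  "module_sum = dsum (\<Lambda>) (\<lambda>I. {x\<^sub>H n I \<otimes>\<^bsub>hecke n\<^esub> h | h. h \<in> carrier (hecke n)})"

definition of_vec :: "(nat set \<Rightarrow> free_elt) \<Rightarrow> nat set \<Rightarrow> free_elt set" where
  "of_vec m = (\<lambda>K\<in>\<Lambda>. H.cls (m K))"

lemma hecke_eq: "hecke n = H.QA"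
  by (simp add: hecke_def)

lemma cls_module_at:
  assumes "K \<in> \<Lambda>"
  shows "{x\<^sub>H n K \<otimes>\<^bsub>hecke n\<^esub> h | h. h \<in> carrier (hecke n)} = H.cls ` {f. module_at K f}"
proof -
  have "{x\<^sub>H n K \<otimes>\<^bsub>hecke n\<^esub> h | h. h \<in> carrier (hecke n)} = {H.cls (x_rep K \<star> h) | h. h \<in> carrier free_alg}"
  proof -
    have x: "x\<^sub>H n K \<otimes>\<^bsub>hecke n\<^esub> H.cls h = H.cls (x_rep K \<star> h)" if "h \<in> carrier free_alg" for h
      using that x_H_eq[of K] assms by (simp add: hecke_eq H.QA_mult)
    have C: "carrier (hecke n) = H.cls ` carrier free_alg" by (simp only: hecke_eq H.QA_simps)
    have "(\<lambda>h. x\<^sub>H n K \<otimes>\<^bsub>hecke n\<^esub> h) ` carrier (hecke n) = (\<lambda>h. H.cls (x_rep K \<star> h)) ` carrier free_alg"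
      unfolding C image_image by (rule image_cong[OF refl x])
    then show ?thesis by (simp only: Setcompr_eq_image)
  qed
  also have "\<dots> = H.cls ` {f. module_at K f}"
  proof safe
    fix h assume "h \<in> carrier free_alg"
    then have "module_at K (x_rep K \<star> h)" unfolding module_at_def by (intro bexI[of _ h]) auto
    then show "H.cls (x_rep K \<star> h) \<in> H.cls ` {f. module_at K f}" by blast
  next
    fix f assume "module_at K f"
    then show "\<exists>h. H.cls f = H.cls (x_rep K \<star> h) \<and> h \<in> carrier free_alg"
      by (auto simp: module_at_def H.cls_eq_iff)
  qed
  finally show ?thesis .
qed

lemma of_vec_in: "vec m \<Longrightarrow> of_vec m \<in> module_sum"
  unfolding module_sum_def dsum_def of_vec_def vec_def using cls_module_at by auto

lemma module_sum_cases:
  assumes "u \<in> module_sum"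
  obtains m where "vec m" "u = of_vec m"
proof -
  have "\<forall>K\<in>\<Lambda>. \<exists>f. module_at K f \<and> u K = H.cls f"
  proof
    fix K assume K: "K \<in> \<Lambda>"
    then have "u K \<in> {x\<^sub>H n K \<otimes>\<^bsub>hecke n\<^esub> h | h. h \<in> carrier (hecke n)}"
      using assms unfolding module_sum_def dsum_def by (intro PiE_mem[of u \<Lambda>])
    then show "\<exists>f. module_at K f \<and> u K = H.cls f" unfolding cls_module_at[OF K] by blast
  qed
  then obtain m where m: "\<forall>K\<in>\<Lambda>. module_at K (m K) \<and> u K = H.cls (m K)" by metis
  have "u = of_vec m"
    unfolding of_vec_def using assms m by (intro ext) (auto simp: module_sum_def dsum_def PiE_def extensional_def)
  then show thesis using that[of m] m by (simp add: vec_def)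
qed

lemma of_vec_eq_iff: "of_vec m = of_vec m' \<longleftrightarrow> (\<forall>K\<in>\<Lambda>. m K \<approx> m' K)"
proof
  assume eq: "of_vec m = of_vec m'"
  show "\<forall>K\<in>\<Lambda>. m K \<approx> m' K"
  proof
    fix K :: "nat set" assume K: "K \<in> \<Lambda>"
    have "of_vec m K = of_vec m' K" by (simp only: eq)
    then show "m K \<approx> m' K" using K by (simp add: of_vec_def H.cls_eq_iff)
  qed
next
  assume "\<forall>K\<in>\<Lambda>. m K \<approx> m' K"
  then show "of_vec m = of_vec m'"
    unfolding of_vec_def by (intro restrict_ext) (simp add: H.cls_eq_iff)
qed

lemma vec_closed: "vec m \<Longrightarrow> K \<in> \<Lambda> \<Longrightarrow> m K \<in> carrier free_alg"
  unfolding vec_def using module_at_closed by blast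

lemma vec_add: "vec m \<Longrightarrow> vec m' \<Longrightarrow> vec (\<lambda>K. m K + m' K)"
  unfolding vec_def using module_at_add by blast

lemma vec_mult: "vec m \<Longrightarrow> h \<in> carrier free_alg \<Longrightarrow> vec (\<lambda>K. m K \<star> h)"
  unfolding vec_def
proof
  fix K assume "\<forall>K\<in>\<Lambda>. module_at K (m K)" "K \<in> \<Lambda>" "h \<in> carrier free_alg"
  then obtain g where "g \<in> carrier free_alg" "m K \<approx> x_rep K \<star> g" by (auto simp: module_at_def)
  then show "module_at K (m K \<star> h)" unfolding module_at_def
    using H.eqv_mult_right[of "m K" "x_rep K \<star> g" h] \<open>h \<in> carrier free_alg\<close>
    by (intro bexI[of _ "g \<star> h"]) (auto simp: path_algebra_mult_assoc)
qed

lemma of_vec_add: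
  assumes "vec m" "vec m'"
  shows "(\<lambda>K\<in>\<Lambda>. of_vec m K \<oplus>\<^bsub>hecke n\<^esub> of_vec m' K) = of_vec (\<lambda>K. m K + m' K)"
  unfolding of_vec_def hecke_eq using assms
  by (intro restrict_ext) (simp add: H.QA_add vec_closed)

lemma of_vec_mult:
  assumes "vec m" "h \<in> carrier free_alg"
  shows "(\<lambda>K\<in>\<Lambda>. of_vec m K \<otimes>\<^bsub>hecke n\<^esub> H.cls h) = of_vec (\<lambda>K. m K \<star> h)"
  unfolding of_vec_def hecke_eq using assms
  by (intro restrict_ext) (simp add: H.QA_mult vec_closed)

lemma of_vec_smult:
  "(\<lambda>K\<in>\<Lambda>. c \<odot>\<^bsub>hecke n\<^esub> of_vec m K) = of_vec (\<lambda>K. c *\<^sub>F m K)"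
  unfolding of_vec_def hecke_eq by (intro restrict_ext) (simp add: H.QA_smult)

text \<open>\<open>act\<close> works on representatives, so one is chosen; \<open>act_eqv\<close>
  makes the result independent of the choice.\<close>

definition endo :: "hasse_elt \<Rightarrow> (nat set \<Rightarrow> free_elt set) \<Rightarrow> nat set \<Rightarrow> free_elt set" where
  "endo f = (\<lambda>u\<in>module_sum. of_vec (act f (SOME m. vec m \<and> u = of_vec m)))"

lemma endo_of_vec:
  assumes "f \<in> carrier Qq" "vec m"
  shows "endo f (of_vec m) = of_vec (act f m)"
proof -
  define m' where "m' = (SOME m'. vec m' \<and> of_vec m = of_vec m')"
  have "vec m' \<and> of_vec m = of_vec m'"
    unfolding m'_def by (rule someI[of _ m]) (use assms in simp)
  then have "act f m k \<approx> act f m' k" for k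
    using assms(1) by (intro act_eqv) (auto simp: of_vec_eq_iff)
  then have "of_vec (act f m') = of_vec (act f m)"
    unfolding of_vec_eq_iff using H.eqv_sym by blast
  then show ?thesis using of_vec_in[OF assms(2)] by (simp add: endo_def m'_def)
qed

lemma module_sum_ext:
  assumes "\<phi> \<in> extensional module_sum" "\<psi> \<in> extensional module_sum"
    and "\<And>m. vec m \<Longrightarrow> \<phi> (of_vec m) = \<psi> (of_vec m)"
  shows "\<phi> = \<psi>"
proof (rule extensionalityI[OF assms(1,2)])
  fix u assume "u \<in> module_sum"
  then show "\<phi> u = \<psi> u" by (rule module_sum_cases) (simp add: assms(3))
qed

lemma endo_extensional: "endo f \<in> extensional module_sum"
  by (simp add: endo_def)

lemma endo_closed:
  assumes f: "f \<in> carrier Qq"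
  shows "endo f \<in> carrier (hecke_endo n)"
proof -
  have "endo f u \<in> module_sum" if "u \<in> module_sum" for u
    using that by (rule module_sum_cases) (simp add: endo_of_vec f of_vec_in vec_act)
  moreover have "endo f (\<lambda>K\<in>\<Lambda>. u K \<oplus>\<^bsub>hecke n\<^esub> v K)
      = (\<lambda>K\<in>\<Lambda>. endo f u K \<oplus>\<^bsub>hecke n\<^esub> endo f v K)"
    if u: "u \<in> module_sum" and v: "v \<in> module_sum" for u v
  proof -
    obtain m where m: "vec m" "u = of_vec m" using u by (rule module_sum_cases)
    moreover obtain m' where m': "vec m'" "v = of_vec m'" using v by (rule module_sum_cases)
    ultimately show ?thesis
      by (simp add: of_vec_add endo_of_vec f vec_add vec_act)
         (simp add: of_vec_def hasse.path_act_arg_add)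
  qed
  moreover have "endo f (\<lambda>K\<in>\<Lambda>. u K \<otimes>\<^bsub>hecke n\<^esub> h)
      = (\<lambda>K\<in>\<Lambda>. endo f u K \<otimes>\<^bsub>hecke n\<^esub> h)"
    if u: "u \<in> module_sum" and h: "h \<in> carrier (hecke n)" for u h
  proof -
    obtain m where m: "vec m" "u = of_vec m" using u by (rule module_sum_cases)
    obtain h' where h': "h' \<in> carrier free_alg" "h = H.cls h'"
      using h by (auto simp: hecke_eq H.QA_simps)
    show ?thesis using m h'
      by (simp add: of_vec_mult endo_of_vec f vec_mult vec_act) (simp add: of_vec_def act_mult_right)
  qed
  ultimately show ?thesis
    using endo_extensional[of f] by (simp add: hecke_endo_def dsum_end_def module_sum_def PiE_def)
qed

lemma endo_ops:
  assumes f: "f \<in> carrier Qq" and g: "g \<in> carrier Qq"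
  shows "endo (f \<cdot> g) = endo f \<otimes>\<^bsub>hecke_endo n\<^esub> endo g"
    and "endo (f + g) = endo f \<oplus>\<^bsub>hecke_endo n\<^esub> endo g"
    and "endo (c *\<^sub>Q f) = c \<odot>\<^bsub>hecke_endo n\<^esub> endo f"
    and "endo \<one>\<^bsub>Qq\<^esub> = \<one>\<^bsub>hecke_endo n\<^esub>"
proof -
  have "endo f \<otimes>\<^bsub>hecke_endo n\<^esub> endo g = compose module_sum (endo f) (endo g)"
    by (simp add: hecke_endo_def dsum_end_def module_sum_def)
  then show "endo (f \<cdot> g) = endo f \<otimes>\<^bsub>hecke_endo n\<^esub> endo g"
    using f g by (intro module_sum_ext endo_extensional)
      (simp_all add: compose_extensional compose_eq endo_of_vec of_vec_in vec_act,
       simp add: of_vec_def hasse.path_act_mult)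
  have add: "endo f \<oplus>\<^bsub>hecke_endo n\<^esub> endo g
      = (\<lambda>u\<in>module_sum. \<lambda>K\<in>\<Lambda>. endo f u K \<oplus>\<^bsub>hecke n\<^esub> endo g u K)"
    by (simp add: hecke_endo_def dsum_end_def module_sum_def)
  show "endo (f + g) = endo f \<oplus>\<^bsub>hecke_endo n\<^esub> endo g"
    unfolding add using f g
    by (intro module_sum_ext endo_extensional restrict_extensional)
      (simp add: endo_of_vec of_vec_in of_vec_add vec_act, simp add: of_vec_def hasse.path_act_add)
  have smult: "c \<odot>\<^bsub>hecke_endo n\<^esub> endo f = (\<lambda>u\<in>module_sum. \<lambda>K\<in>\<Lambda>. c \<odot>\<^bsub>hecke n\<^esub> endo f u K)"
    by (simp add: hecke_endo_def dsum_end_def module_sum_def)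
  show "endo (c *\<^sub>Q f) = c \<odot>\<^bsub>hecke_endo n\<^esub> endo f"
    unfolding smult using f
    by (intro module_sum_ext endo_extensional restrict_extensional)
      (simp add: endo_of_vec of_vec_in of_vec_smult vec_act, simp add: of_vec_def hasse.path_act_smult)
  have one: "\<one>\<^bsub>hecke_endo n\<^esub> = (\<lambda>u\<in>module_sum. u)"
    by (simp add: hecke_endo_def dsum_end_def module_sum_def)
  show "endo \<one>\<^bsub>Qq\<^esub> = \<one>\<^bsub>hecke_endo n\<^esub>"
    unfolding one
  proof (intro module_sum_ext endo_extensional restrict_extensional)
    fix m assume m: "vec m"
    have "act \<one>\<^bsub>Qq\<^esub> m K = m K" if "K \<in> \<Lambda>" for K
      using hasse.path_act_one[of hasse_quiver K m] that hasse_quiver_wf by (simp add: hasse_verts)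
    then have "of_vec (act \<one>\<^bsub>Qq\<^esub> m) = of_vec m" by (simp add: of_vec_eq_iff)
    then show "endo \<one>\<^bsub>Qq\<^esub> (of_vec m) = (\<lambda>u\<in>module_sum. u) (of_vec m)"
      using m by (simp add: endo_of_vec of_vec_in Q.A.one_closed)
  qed
qed

lemma endo_eq_iff:
  assumes f: "f \<in> carrier Qq" and g: "g \<in> carrier Qq"
  shows "endo f = endo g \<longleftrightarrow> f \<simeq> g"
proof -
  have "endo f = endo g \<longleftrightarrow> (\<forall>m. vec m \<longrightarrow> endo f (of_vec m) = endo g (of_vec m))"
    using module_sum_ext[OF endo_extensional endo_extensional] by metis
  also have "\<dots> \<longleftrightarrow> null (f - g)"
    using f g by (auto simp: endo_of_vec of_vec_eq_iff null_def hasse.path_act_diff H.eqv_def)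
  also have "\<dots> \<longleftrightarrow> f \<simeq> g" using f g by (simp add: null_iff Q.eqv_def)
  finally show ?thesis .
qed

text \<open>The endomorphism is determined by the images of the generators. Their coordinates serve
  as coefficients of the lifts; nothing is lost since coordinates at slots that are not compatible
  vanish.\<close>

lemma endo_surj:
  assumes \<phi>: "\<phi> \<in> carrier (hecke_endo n)"
  shows "\<exists>f\<in>carrier Qq. endo f = \<phi>"
proof -
  \<comment> \<open>Stated for every endomorphism, as it is applied both to \<open>\<phi>\<close>
    and to \<open>endo f\<close> when the two are compared.\<close>
  have props: "\<psi> \<in> module_sum \<rightarrow>\<^sub>E module_sum"
    "\<And>m m'. vec m \<Longrightarrow> vec m' \<Longrightarrow> \<psi> (of_vec (\<lambda>K. m K + m' K)) =
      (\<lambda>K\<in>\<Lambda>. \<psi> (of_vec m) K \<oplus>\<^bsub>hecke n\<^esub> \<psi> (of_vec m') K)"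
    "\<And>m h. vec m \<Longrightarrow> h \<in> carrier free_alg \<Longrightarrow> \<psi> (of_vec (\<lambda>K. m K \<star> h)) =
      (\<lambda>K\<in>\<Lambda>. \<psi> (of_vec m) K \<otimes>\<^bsub>hecke n\<^esub> H.cls h)"
    if "\<psi> \<in> carrier (hecke_endo n)" for \<psi>
  proof -
    have psi: "\<psi> \<in> module_sum \<rightarrow>\<^sub>E module_sum"
      "\<And>u v. u \<in> module_sum \<Longrightarrow> v \<in> module_sum \<Longrightarrow>
         \<psi> (\<lambda>i\<in>\<Lambda>. u i \<oplus>\<^bsub>hecke n\<^esub> v i) = (\<lambda>i\<in>\<Lambda>. \<psi> u i \<oplus>\<^bsub>hecke n\<^esub> \<psi> v i)"
      "\<And>u h. u \<in> module_sum \<Longrightarrow> h \<in> carrier (hecke n) \<Longrightarrow>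
         \<psi> (\<lambda>i\<in>\<Lambda>. u i \<otimes>\<^bsub>hecke n\<^esub> h) = (\<lambda>i\<in>\<Lambda>. \<psi> u i \<otimes>\<^bsub>hecke n\<^esub> h)"
      using that by (auto simp: hecke_endo_def dsum_end_def module_sum_def)
    show "\<psi> \<in> module_sum \<rightarrow>\<^sub>E module_sum" by (rule psi(1))
    show "\<And>m m'. vec m \<Longrightarrow> vec m' \<Longrightarrow> \<psi> (of_vec (\<lambda>K. m K + m' K)) =
      (\<lambda>K\<in>\<Lambda>. \<psi> (of_vec m) K \<oplus>\<^bsub>hecke n\<^esub> \<psi> (of_vec m') K)"
      using psi(2)[OF of_vec_in of_vec_in] by (simp add: of_vec_add)
    have cls: "H.cls h \<in> carrier (hecke n)" if "h \<in> carrier free_alg" for h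
      using that by (simp add: hecke_eq H.QA_simps)
    show "\<And>m h. vec m \<Longrightarrow> h \<in> carrier free_alg \<Longrightarrow> \<psi> (of_vec (\<lambda>K. m K \<star> h)) =
      (\<lambda>K\<in>\<Lambda>. \<psi> (of_vec m) K \<otimes>\<^bsub>hecke n\<^esub> H.cls h)"
      using psi(3)[OF of_vec_in cls] by (simp add: of_vec_mult)
  qed
  have "\<exists>m. vec m \<and> \<phi> (of_vec (x_at J)) = of_vec m" for J
  proof -
    have "\<phi> (of_vec (x_at J)) \<in> module_sum"
      using props(1)[OF \<phi>] of_vec_in[OF vec_x_at] by auto
    then show ?thesis by (rule module_sum_cases) blast
  qed
  then obtain z where z: "\<And>J. vec (z J)" "\<And>J. \<phi> (of_vec (x_at J)) = of_vec (z J)" by metis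
  have right: "z J K \<star> \<xi> i \<approx> (1 + \<q>) *\<^sub>F z J K"
    if J: "J \<in> \<Lambda>" and K: "K \<in> \<Lambda>" and i: "i \<in> J" for J K i
  proof -
    have li: "letter i" using J i by (auto simp: letter_def)
    \<comment> \<open>Endomorphisms are additive and linear over H; the scalar 1 + q is therefore
      applied as right multiplication by an element of H.\<close>
    let ?c = "(1 + \<q>) *\<^sub>F \<one>\<^sub>F"
    have mult_c: "f \<star> ?c = (1 + \<q>) *\<^sub>F f" if "f \<in> carrier free_alg" for f
      using that by (simp add: path_algebra_mult_smult(2))
    have "x_at J u \<star> \<xi> i \<approx> x_at J u \<star> ?c" for u
      using x_rep_xi[OF J i] mult_c[OF x_rep_closed, of J] by (simp add: x_at_def)
    then have "of_vec (\<lambda>u. x_at J u \<star> \<xi> i) = of_vec (\<lambda>u. x_at J u \<star> ?c)"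
      by (simp add: of_vec_eq_iff)
    then have "of_vec (\<lambda>u. z J u \<star> \<xi> i) = of_vec (\<lambda>u. z J u \<star> ?c)"
      using props(3)[OF \<phi> vec_x_at, of "\<xi> i" J] props(3)[OF \<phi> vec_x_at, of ?c J] li
      by (simp add: z of_vec_mult)
    then have "z J K \<star> \<xi> i \<approx> z J K \<star> ?c" using K by (simp add: of_vec_eq_iff)
    then show ?thesis using mult_c vec_closed[OF z(1) K] by simp
  qed
  define f where "f = (\<Sum>(K, J, b)\<in>lift_index. coord (z J K) b *\<^sub>Q lift (K, J, b))"
  have f: "f \<in> carrier Qq"
    unfolding f_def by (intro path_algebra_sum_carrier) (auto intro: path_algebra_smult_closed lift_closed)
  have act: "act f (x_at J) K \<approx> z J K" if J: "J \<in> \<Lambda>" and K: "K \<in> \<Lambda>" for J K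
  proof -
    have left: "module_at K (z J K)" using z(1) K by (simp add: vec_def)
    have fe: "f = (\<Sum>p\<in>lift_index. (\<lambda>(K, J, b). coord (z J K) b) p *\<^sub>Q lift p)"
      by (auto simp: f_def intro!: sum.cong)
    have "act f (x_at J) K \<approx> (\<Sum>b\<in>slots. (if compatible K J b then coord (z J K) b else 0) *\<^sub>F basis_elt b)"
      using act_lift_sum[OF K J, of "\<lambda>(K, J, b). coord (z J K) b"] unfolding fe prod.case .
    also have "\<dots> = (\<Sum>b\<in>slots. coord (z J K) b *\<^sub>F basis_elt b)"
      using coord_incompatible[OF K J _ _ left right[OF J K]] by (intro sum.cong) auto
    also have "\<dots> \<approx> z J K"
      by (rule H.eqv_sym[OF eqv_coord_sum[OF module_at_closed[OF left]]])
    finally show ?thesis .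
  qed
  have gen: "endo f (of_vec (x_at J)) = \<phi> (of_vec (x_at J))" if "J \<in> \<Lambda>" for J
    using act[OF that] by (simp add: endo_of_vec f vec_x_at z of_vec_eq_iff)
  have E: "endo f \<in> carrier (hecke_endo n)" by (rule endo_closed[OF f])
  have mult: "endo f (of_vec (\<lambda>K. x_at J K \<star> h)) = \<phi> (of_vec (\<lambda>K. x_at J K \<star> h))"
    if "J \<in> \<Lambda>" "h \<in> carrier free_alg" for J h
    using gen[OF that(1)] props(3)[OF E vec_x_at that(2)] props(3)[OF \<phi> vec_x_at that(2)] by simp
  \<comment> \<open>Agreement passes from the generators to the whole direct sum by additivity, one
    vertex at a time.\<close>
  have sums: "vec (\<lambda>K. \<Sum>J\<in>S. x_at J K \<star> h J) \<and>
      endo f (of_vec (\<lambda>K. \<Sum>J\<in>S. x_at J K \<star> h J)) = \<phi> (of_vec (\<lambda>K. \<Sum>J\<in>S. x_at J K \<star> h J))"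
    if h: "\<forall>J\<in>\<Lambda>. h J \<in> carrier free_alg" and S: "S \<subseteq> \<Lambda>" for h S
    using finite_subset[OF S] S
  proof (induction S rule: infinite_finite_induct)
    case (insert J S)
    then have J: "J \<in> \<Lambda>" "h J \<in> carrier free_alg" using h by auto
    have 1: "vec (\<lambda>K. x_at J K \<star> h J)" by (rule vec_mult[OF vec_x_at J(2)])
    have IH: "vec (\<lambda>K. \<Sum>J\<in>S. x_at J K \<star> h J)"
      "endo f (of_vec (\<lambda>K. \<Sum>J\<in>S. x_at J K \<star> h J)) = \<phi> (of_vec (\<lambda>K. \<Sum>J\<in>S. x_at J K \<star> h J))"
      using insert by auto
    show ?case
      using vec_add[OF 1 IH(1)] props(2)[OF E 1 IH(1)] props(2)[OF \<phi> 1 IH(1)] IH(2) mult[OF J]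
        insert.hyps by simp
  next
    case empty
    show ?case using mult[of "{}" 0] by (simp add: vec_def module_at_zero)
  qed auto
  have "endo f = \<phi>"
  proof (rule module_sum_ext)
    show "\<phi> \<in> extensional module_sum" using props(1)[OF \<phi>] by (auto simp: PiE_def)
    fix m assume m: "vec m"
    then have "\<forall>J\<in>\<Lambda>. \<exists>h. h \<in> carrier free_alg \<and> m J \<approx> x_rep J \<star> h"
      unfolding vec_def module_at_def by blast
    then obtain h where h: "\<forall>J\<in>\<Lambda>. h J \<in> carrier free_alg \<and> m J \<approx> x_rep J \<star> h J" by metis
    have "(\<Sum>J\<in>\<Lambda>. x_at J K \<star> h J) = x_rep K \<star> h K" if "K \<in> \<Lambda>" for K
    proof -
      have "(\<Sum>J\<in>\<Lambda>. x_at J K \<star> h J) = (\<Sum>J\<in>\<Lambda>. if J = K then x_rep K \<star> h K else 0)"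
        by (intro sum.cong) (auto simp: x_at_def)
      also have "\<dots> = x_rep K \<star> h K" using that by (subst sum.delta) auto
      finally show ?thesis .
    qed
    then have "of_vec m = of_vec (\<lambda>K. \<Sum>J\<in>\<Lambda>. x_at J K \<star> h J)"
      using h by (simp only: of_vec_eq_iff) simp
    then show "endo f (of_vec m) = \<phi> (of_vec m)"
      using sums[of h "\<Lambda>"] h by simp
  qed (rule endo_extensional)
  then show ?thesis using f by blast
qed

text \<open>The isomorphism is the inverse of the map induced by \<open>endo\<close>: the fibre of
  \<open>endo\<close> over an endomorphism is a coset of the relation ideal, hence already an
  element of the quotient algebra.\<close>

lemma hecke_endo_iso:
  "(\<lambda>\<phi>. {f \<in> carrier Qq. endo f = \<phi>}) \<in> algebra_iso (hecke_endo n) Q.QA"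
proof -
  let ?\<theta> = "\<lambda>\<phi>. {f \<in> carrier Qq. endo f = \<phi>}"
  have \<theta>: "?\<theta> (endo f) = Q.cls f" if f: "f \<in> carrier Qq" for f
    using f Q.eqv_carrier[of _ f] by (auto simp: endo_eq_iff Q.mem_cls_iff)
  have E: "carrier (hecke_endo n) = endo ` carrier Qq"
    using endo_closed endo_surj by blast
  have "?\<theta> \<in> ring_hom (hecke_endo n) Q.QA"
  proof (rule ring_hom_memI)
    fix x y assume "x \<in> carrier (hecke_endo n)" "y \<in> carrier (hecke_endo n)"
    then obtain f g where fg: "f \<in> carrier Qq" "g \<in> carrier Qq" "x = endo f" "y = endo g"
      unfolding E by blast
    show "?\<theta> x \<in> carrier Q.QA" using fg by (simp add: \<theta> Q.QA_simps)
    show "?\<theta> (x \<otimes>\<^bsub>hecke_endo n\<^esub> y) = ?\<theta> x \<otimes>\<^bsub>Q.QA\<^esub> ?\<theta> y"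
      unfolding fg(3,4) endo_ops(1)[OF fg(1,2), symmetric]
      using fg by (simp only: \<theta> Q.QA_mult path_algebra_mult_closed)
    show "?\<theta> (x \<oplus>\<^bsub>hecke_endo n\<^esub> y) = ?\<theta> x \<oplus>\<^bsub>Q.QA\<^esub> ?\<theta> y"
      unfolding fg(3,4) endo_ops(2)[OF fg(1,2), symmetric]
      using fg by (simp only: \<theta> Q.QA_add path_algebra_carrier_add)
  next
    have "?\<theta> (endo \<one>\<^bsub>Qq\<^esub>) = \<one>\<^bsub>Q.QA\<^esub>" by (simp only: \<theta> Q.A.one_closed Q.QA_simps)
    then show "?\<theta> \<one>\<^bsub>hecke_endo n\<^esub> = \<one>\<^bsub>Q.QA\<^esub>"
      using endo_ops(4)[OF Q.A.one_closed Q.A.one_closed] by simp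
  qed
  moreover have "bij_betw ?\<theta> (carrier (hecke_endo n)) (carrier Q.QA)"
    unfolding bij_betw_def
  proof
    show "inj_on ?\<theta> (carrier (hecke_endo n))"
    proof (rule inj_onI)
      fix x y assume "x \<in> carrier (hecke_endo n)" "y \<in> carrier (hecke_endo n)" and eq: "?\<theta> x = ?\<theta> y"
      then obtain f where "f \<in> carrier Qq" "x = endo f" unfolding E by blast
      then have "f \<in> ?\<theta> x" by simp
      then show "x = y" unfolding eq using \<open>x = endo f\<close> by simp
    qed
    have "?\<theta> ` carrier (hecke_endo n) = (\<lambda>f. ?\<theta> (endo f)) ` carrier Qq"
      unfolding E image_image ..
    also have "\<dots> = carrier Q.QA"
      unfolding Q.QA_simps by (rule image_cong[OF refl \<theta>])
    finally show "?\<theta> ` carrier (hecke_endo n) = carrier Q.QA" .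
  qed
  moreover have "?\<theta> (c \<odot>\<^bsub>hecke_endo n\<^esub> x) = c \<odot>\<^bsub>Q.QA\<^esub> ?\<theta> x" if "x \<in> carrier (hecke_endo n)" for c x
  proof -
    from that have "x \<in> endo ` carrier Qq" unfolding E .
    then obtain f where f: "f \<in> carrier Qq" "x = endo f" by (rule imageE)
    have "?\<theta> (c \<odot>\<^bsub>hecke_endo n\<^esub> x) = Q.cls (c *\<^sub>Q f)"
      unfolding f(2) endo_ops(3)[OF f(1) f(1), of c, symmetric]
      by (rule \<theta>[OF path_algebra_smult_closed[OF f(1)]])
    also have "\<dots> = c \<odot>\<^bsub>Q.QA\<^esub> Q.cls f" by (rule Q.QA_smult[symmetric])
    also have "Q.cls f = ?\<theta> x" unfolding f(2) by (rule \<theta>[OF f(1), symmetric])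
    finally show ?thesis .
  qed
  ultimately show ?thesis by (simp add: algebra_iso_def ring_iso_def)
qed

end

theorem theorem7p3:
  fixes n :: nat
  assumes "n \<ge> 2"
  shows "algebra_isomorphic (hecke_endo n) (quotient_algebra Qq (relation_ideal Qq (hasse_relations n)))"
proof -
  interpret dihedral_hecke n using assms by unfold_locales
  show ?thesis using hecke_endo_iso by (auto simp: algebra_isomorphic_def)
qed

end
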